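(* A pentagonal tiling of an orientable compact connected surface without boundary is the simple pentagonal subdivision of some quadrilateral tiling if and only if it is possible to label some of its vertices by $\bullet$ such that every unlabelled vertex has degree $3$, and every tile is of type $P_1$: a non-degenerate pentagon whose consecutive vertices are $\bullet,\ u,\ \bullet,\ u,\ u$, where $u$ denotes an unlabelled vertex (so each tile has exactly two $\bullet$-vertices and they are non-adjacent).
   Context: A tiling of a compact connected surface without boundary is a graph embedded in the surface such that the complementary regions (tiles) are open disks; tilings are edge-to-edge, every vertex has degree at least $3$, every tile has at least $3$ edges, and tiles may be degenerate (boundary not a simple closed curve). A pentagonal (resp. quadrilateral) tiling has $5$ (resp. $4$) edges along each tile boundary; a polygon is non-degenerate if its boundary is a simple closed curve. A simple pentagonal subdivision of a quadrilateral tiling is the pentagonal tiling obtained by placing a new vertex at the middle point of every edge and, inside each quadrilateral tile, joining by an arc the middle points of one of the two pairs of opposite edges of the tile, such that the middle point of each edge is used exactly once. *)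

theory Defs
  imports "HOL-Analysis.Analysis" "HOL-Complex_Analysis.Winding_Numbers"
begin

section \<open>Closed surfaces and orientability\<close>

text \<open>Second countability is automatic, since \<open>S\<close> is compact and locally Euclidean.\<close>

definition closed_surface :: "'a::t2_space set \<Rightarrow> bool" where
  "closed_surface S \<longleftrightarrow> S \<noteq> {} \<and> compact S \<and> connected S \<and>
     (\<forall>x\<in>S. \<exists>U. openin (top_of_set S) U \<and> x \<in> U \<and> U homeomorphic (ball 0 1 :: complex set))"

definition surface_chart :: "'a::t2_space set \<Rightarrow> 'a set \<Rightarrow> ('a \<Rightarrow> complex) \<Rightarrow> bool" where
  "surface_chart S U \<phi> \<longleftrightarrow>
     openin (top_of_set S) U \<and> open (\<phi> ` U) \<and> (\<exists>\<psi>. homeomorphism U (\<phi> ` U) \<phi> \<psi>)"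

text \<open>For a homeomorphism \<open>\<tau>\<close> between open subsets of the plane, the winding number of the image
  of a small circle about \<open>z\<close> around \<open>\<tau> z\<close> is the local degree of \<open>\<tau>\<close> at \<open>z\<close>, i.e. \<open>1\<close> or \<open>-1\<close>.\<close>

definition orientation_preserving_on :: "complex set \<Rightarrow> (complex \<Rightarrow> complex) \<Rightarrow> bool" where
  "orientation_preserving_on D \<tau> \<longleftrightarrow>
     (\<forall>z\<in>D. \<forall>\<^sub>F r in at_right 0. winding_number (\<tau> \<circ> circlepath z r) (\<tau> z) = 1)"

definition orientable_surface :: "'a::t2_space set \<Rightarrow> bool" where
  "orientable_surface S \<longleftrightarrow>
     (\<exists>A. (\<forall>(U,\<phi>)\<in>A. surface_chart S U \<phi>) \<and> (\<Union>(U,\<phi>)\<in>A. U) = S \<and>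
        (\<forall>(U,\<phi>)\<in>A. \<forall>(U',\<phi>')\<in>A.
           orientation_preserving_on (\<phi> ` (U \<inter> U')) (\<phi>' \<circ> inv_into U \<phi>)))"

section \<open>Tilings\<close>

text \<open>A graph embedded in \<open>S\<close> is given by its vertex set \<open>V\<close> and the set \<open>E\<close> of its \<^emph>\<open>open\<close> edges,
  an edge being a simple path without its two end points. Loops (the end points coincide) and
  multiple edges are allowed.\<close>

definition graph_edge :: "'a::t2_space set \<Rightarrow> 'a set \<Rightarrow> 'a set \<Rightarrow> bool" where
  "graph_edge S V e \<longleftrightarrow>
     (\<exists>g. simple_path g \<and> path_image g \<subseteq> S \<and> pathstart g \<in> V \<and> pathfinish g \<in> V \<and>
          e = g ` {0<..<1} \<and> e \<inter> V = {})"

definition embedded_graph :: "'a::t2_space set \<Rightarrow> 'a set \<Rightarrow> 'a set set \<Rightarrow> bool" where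
  "embedded_graph S V E \<longleftrightarrow>
     finite V \<and> V \<subseteq> S \<and> finite E \<and> (\<forall>e\<in>E. graph_edge S V e) \<and> pairwise disjnt E"

text \<open>For an open edge \<open>e\<close>, the set \<open>closure e - e\<close> consists of its end points; a loop contributes
  \<open>2\<close> to the degree of its vertex.\<close>

definition edge_ends_at :: "'a::t2_space set \<Rightarrow> 'a \<Rightarrow> nat" where
  "edge_ends_at e v = (if v \<notin> closure e - e then 0 else if closure e - e = {v} then 2 else 1)"

definition vertex_degree :: "'a::t2_space set set \<Rightarrow> 'a \<Rightarrow> nat" where
  "vertex_degree E v = (\<Sum>e\<in>E. edge_ends_at e v)"

definition tiles :: "'a::t2_space set \<Rightarrow> 'a set \<Rightarrow> 'a set set \<Rightarrow> 'a set set" where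
  "tiles S V E = components (S - (V \<union> \<Union>E))"

text \<open>The model of an \<open>n\<close>-gon is the closed unit disk, with its boundary circle divided into \<open>n\<close>
  sides by the \<open>n\<close>-th roots of unity; side \<open>k\<close> (without end points) runs from corner \<open>k\<close> to corner
  \<open>k + 1\<close>.\<close>

definition corner :: "nat \<Rightarrow> nat \<Rightarrow> complex" where
  "corner n k = cis (2 * pi * real k / real n)"

definition side :: "nat \<Rightarrow> nat \<Rightarrow> complex set" where
  "side n k = (\<lambda>t. cis (2 * pi * t / real n)) ` {real k<..<real k + 1}"

text \<open>\<open>polygon_map V E n f T\<close>: the tile \<open>T\<close> is an open disk with \<open>n\<close> edges along its boundary, as
  witnessed by the continuous map \<open>f\<close> from the model \<open>n\<close>-gon. Different corners may have the same
  image, and so may different sides: tiles may be degenerate, and an edge with \<open>T\<close> on both of its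
  sides is counted twice.\<close>

definition polygon_map ::
  "'a::t2_space set \<Rightarrow> 'a set set \<Rightarrow> nat \<Rightarrow> (complex \<Rightarrow> 'a) \<Rightarrow> 'a set \<Rightarrow> bool" where
  "polygon_map V E n f T \<longleftrightarrow>
     continuous_on (cball 0 1) f \<and> (\<exists>g. homeomorphism (ball 0 1) T f g) \<and>
     (\<forall>k<n. f (corner n k) \<in> V \<and> inj_on f (side n k) \<and> f ` side n k \<in> E)"

definition tiling :: "'a::t2_space set \<Rightarrow> 'a set \<Rightarrow> 'a set set \<Rightarrow> bool" where
  "tiling S V E \<longleftrightarrow>
     embedded_graph S V E \<and> (\<forall>v\<in>V. vertex_degree E v \<ge> 3) \<and>
     (\<forall>T\<in>tiles S V E. \<exists>n\<ge>3. \<exists>f. polygon_map V E n f T)"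

definition polygonal_tiling :: "nat \<Rightarrow> 'a::t2_space set \<Rightarrow> 'a set \<Rightarrow> 'a set set \<Rightarrow> bool" where
  "polygonal_tiling n S V E \<longleftrightarrow>
     tiling S V E \<and> (\<forall>T\<in>tiles S V E. \<exists>f. polygon_map V E n f T)"

abbreviation "quadrilateral_tiling \<equiv> polygonal_tiling 4"
abbreviation "pentagonal_tiling \<equiv> polygonal_tiling 5"

section \<open>Simple pentagonal subdivision\<close>

text \<open>\<open>simple_pentagonal_subdivision S V E V' E'\<close>: the graph \<open>(V', E')\<close> is a simple pentagonal
  subdivision of the quadrilateral tiling \<open>(V, E)\<close>. There is no metric, so the middle point \<open>m e\<close>
  is any chosen point of the open edge \<open>e\<close>. In the tile \<open>T\<close>, the opposite sides \<open>k T\<close> and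
  \<open>k T + 2\<close> of the model quadrilateral are used. The arc \<open>c T\<close> is drawn in the model, because in
  \<open>S\<close> the same edge may be two different sides of \<open>T\<close>. The cardinality condition says that the middle
  point of each edge is used exactly once, counting separately the two sides of the edge.\<close>

definition simple_pentagonal_subdivision ::
  "'a::t2_space set \<Rightarrow> 'a set \<Rightarrow> 'a set set \<Rightarrow> 'a set \<Rightarrow> 'a set set \<Rightarrow> bool" where
  "simple_pentagonal_subdivision S V E V' E' \<longleftrightarrow>
     (\<exists>(m :: 'a set \<Rightarrow> 'a) (f :: 'a set \<Rightarrow> complex \<Rightarrow> 'a)
        (k :: 'a set \<Rightarrow> nat) (c :: 'a set \<Rightarrow> real \<Rightarrow> complex).
        (\<forall>e\<in>E. m e \<in> e) \<and>
        (\<forall>T\<in>tiles S V E.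
           polygon_map V E 4 (f T) T \<and> k T \<in> {0, 1} \<and>
           arc (c T) \<and> c T ` {0<..<1} \<subseteq> ball 0 1 \<and>
           pathstart (c T) \<in> side 4 (k T) \<and>
           f T (pathstart (c T)) = m (f T ` side 4 (k T)) \<and>
           pathfinish (c T) \<in> side 4 (k T + 2) \<and>
           f T (pathfinish (c T)) = m (f T ` side 4 (k T + 2))) \<and>
        (\<forall>e\<in>E. card {(T, j). T \<in> tiles S V E \<and> j \<in> {k T, k T + 2} \<and> f T ` side 4 j = e} = 1) \<and>
        V' = V \<union> m ` E \<and>
        E' = (\<Union>e\<in>E. components (e - {m e})) \<union> (\<lambda>T. f T ` c T ` {0<..<1}) ` tiles S V E)"

section \<open>Labelled pentagons\<close>

text \<open>\<open>L\<close> is the set of vertices labelled by a bullet. Non-degeneracy (the boundary is a simple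
  closed curve) is injectivity of the polygon map on the boundary circle.\<close>

definition type_P1 :: "'a::t2_space set \<Rightarrow> 'a set \<Rightarrow> 'a set set \<Rightarrow> 'a set \<Rightarrow> bool" where
  "type_P1 L V E T \<longleftrightarrow>
     (\<exists>f. polygon_map V E 5 f T \<and> inj_on f (sphere 0 1) \<and>
          f (corner 5 0) \<in> L \<and> f (corner 5 1) \<notin> L \<and> f (corner 5 2) \<in> L \<and>
          f (corner 5 3) \<notin> L \<and> f (corner 5 4) \<notin> L)"

end

theory Submission
  imports Defs "HOL-Complex_Analysis.Riemann_Mapping"
begin

text \<open>The local structure of a tiling comes from invariance of domain: two sides of tiles that are the
  same edge fit together to a strip that is open in the surface, so every edge is exactly two sides of
  tiles, and because the punctured neighbourhood of a vertex is connected, all tile corners at that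
  vertex are linked through such strips.

  Let the pentagonal tiling be the simple subdivision of a quadrilateral tiling, and label the
  vertices of the latter. As every edge is used on exactly one side, orienting it along the positively
  oriented tile that uses it makes every vertex a source or a sink, so a quadrilateral has no loop.
  Half edges join a labelled to an unlabelled vertex and arcs join unlabelled vertices, so a pentagon
  has an odd number of sides that are arcs. These all are the arc of one quadrilateral and thus
  at most two sides, hence exactly one, which is the pattern of \<open>P\<^sub>1\<close>; the missing loops and degree \<open>3\<close>
  exclude degenerate pentagons.

  Conversely, at an unlabelled vertex \<open>u\<close>, let \<open>a\<close> be the number of tiles in which \<open>u\<close> is the vertex
  between the two bullets, and \<open>b\<close> the number of the other tile corners at \<open>u\<close>. Then \<open>a + b = 3\<close> and \<open>b\<close>
  is even, so \<open>b \<le> 2 * a\<close>; summation over all \<open>u\<close> gives the same total on both sides, so \<open>a = 1\<close> and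
  \<open>b = 2\<close> everywhere. Thus \<open>u\<close> lies on exactly two half edges, whose union with \<open>u\<close> is an edge between
  bullets, and gluing the two pentagons along each edge without bullets gives the quadrilaterals.\<close>

text \<open>Everything is topological: edges are arbitrary arcs, charts need not be differentiable
  and a tile may meet itself, so neither tangents nor a cyclic order at a vertex are at hand. A
  Boolean property of tile corners that spreads to all corners at a vertex replaces the cyclic
  order; it is instantiated with the source or sink type and with being the folded corner.
  Orientation is measured by local degrees, the winding numbers \<open>1\<close> or
  \<open>-1\<close> of images of small circles, and a strip glued from two tiles compares their
  signs. Two polygon maps parametrize a common side differently, so before pentagons are glued the
  parametrization is adjusted by coning a homeomorphism of the circle. Exponential coordinates
  unroll a polygon to a half plane in which every side has length one. In the converse,
  \<open>b\<close> is even because every edge without bullets is a side of two tiles, and the totals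
  agree because each pentagon has one corner between its bullets and two others without
  bullet.\<close>

section \<open>Maps between the surface and the plane\<close>

text \<open>For closed \<open>B\<close> the image of \<open>K \<inter> B\<close> is compact, and
  saturation makes its trace on the image of \<open>X\<close> the image of
  \<open>X \<inter> B\<close>. The set \<open>X\<close> itself may fail to be closed, which covers
  open edges, sectors and open discs.\<close>

lemma homeomorphism_saturated:
  fixes f :: "'a::topological_space \<Rightarrow> 'b::t2_space"
  assumes "compact K" "continuous_on K f" "X \<subseteq> K" "inj_on f X"
    and sat: "\<And>z. z \<in> K \<Longrightarrow> f z \<in> f ` X \<Longrightarrow> z \<in> X"
  shows "homeomorphism X (f ` X) f (inv_into X f)"
proof -
  have "continuous_on (f ` X) (inv_into X f)"
    unfolding continuous_on_closed_invariant
  proof (intro allI impI)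
    fix B :: "'a set" assume "closed B"
    then have "compact (f ` (K \<inter> B))"
      using assms by (meson compact_Int_closed compact_continuous_image continuous_on_subset inf_le1)
    then have cl: "closed (f ` (K \<inter> B))" by (rule compact_imp_closed)
    have "f ` (K \<inter> B) \<inter> f ` X = inv_into X f -` B \<inter> f ` X"
    proof (intro equalityI subsetI)
      fix y assume "y \<in> f ` (K \<inter> B) \<inter> f ` X"
      then obtain z where z: "z \<in> K" "z \<in> B" "y = f z" "f z \<in> f ` X" by auto
      with sat have "z \<in> X" by blast
      with z assms(4) show "y \<in> inv_into X f -` B \<inter> f ` X" by auto
    next
      fix y assume "y \<in> inv_into X f -` B \<inter> f ` X"
      then obtain x where "x \<in> X" "y = f x" "x \<in> B" using assms(4) by auto
      with assms(3) show "y \<in> f ` (K \<inter> B) \<inter> f ` X" by auto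
    qed
    with cl show "\<exists>A. closed A \<and> A \<inter> f ` X = inv_into X f -` B \<inter> f ` X" by blast
  qed
  moreover have "continuous_on X f" using assms continuous_on_subset by blast
  ultimately show ?thesis
    using assms(4) by (auto simp: homeomorphism_def inv_into_into inv_into_f_f image_iff)
qed

lemma surface_chart_at:
  assumes "closed_surface S" "x \<in> S"
  obtains U h k where "openin (top_of_set S) U" "x \<in> U" "homeomorphism U (ball 0 1 :: complex set) h k"
  using assms unfolding closed_surface_def homeomorphic_def by meson

lemma openin_homeomorphism_preimage:
  assumes "openin (top_of_set S) U" "homeomorphism U D h k" "open P"
  shows "openin (top_of_set S) (U \<inter> h -` P)"
proof -
  have "continuous_on U h" using assms(2) by (simp add: homeomorphism_def)
  then have "openin (top_of_set U) (U \<inter> h -` P)"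
    using assms(3) continuous_openin_preimage_gen by blast
  then show ?thesis using assms(1) openin_trans by blast
qed

text \<open>Openness is local, so at each image point a chart \<open>h\<close> turns
  \<open>G\<close> into the planar map \<open>h \<circ> G\<close>, to which invariance of domain
  applies; the chart then pulls the open planar image back.\<close>

lemma surface_image_open:
  fixes G :: "complex \<Rightarrow> 'a::t2_space"
  assumes S: "closed_surface S" and W: "open W" "continuous_on W G" "inj_on G W" "G ` W \<subseteq> S"
  shows "openin (top_of_set S) (G ` W)"
  unfolding openin_subopen[of "top_of_set S" "G ` W"]
proof
  fix x assume "x \<in> G ` W"
  then have "x \<in> S" using W by blast
  then obtain U h k where U: "openin (top_of_set S) U" "x \<in> U" "homeomorphism U (ball 0 1 :: complex set) h k"
    using surface_chart_at S by blast
  let ?W = "W \<inter> G -` U"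
  have "openin (top_of_set W) ?W"
    using U(1) W(2,4) by (metis continuous_openin_preimage image_subset_iff_funcset)
  then have oW: "open ?W" using W(1) openin_open_trans by blast
  have c: "continuous_on ?W (h \<circ> G)"
  proof (rule continuous_on_compose)
    show "continuous_on ?W G" using W(2) continuous_on_subset by blast
    show "continuous_on (G ` ?W) h" using U(3) by (auto simp: homeomorphism_def intro: continuous_on_subset)
  qed
  have hi: "inj_on h U" using U(3) by (metis homeomorphism_apply1 inj_on_inverseI)
  have i: "inj_on (h \<circ> G) ?W"
    using W(3) hi by (auto simp: inj_on_def)
  have "open ((h \<circ> G) ` ?W)" by (rule invariance_of_domain[OF c oW i])
  then have o: "openin (top_of_set S) (U \<inter> h -` ((h \<circ> G) ` ?W))"
    by (rule openin_homeomorphism_preimage[OF U(1,3)])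
  have "U \<inter> h -` ((h \<circ> G) ` ?W) \<subseteq> G ` W" using hi by (auto simp: inj_on_def)
  moreover have "x \<in> U \<inter> h -` ((h \<circ> G) ` ?W)" using \<open>x \<in> G ` W\<close> U(2) by auto
  ultimately show "\<exists>T. openin (top_of_set S) T \<and> x \<in> T \<and> T \<subseteq> G ` W" using o by blast
qed

text \<open>The opposite direction of \<open>surface_image_open\<close>, again reduced to the plane
  by charts. It expresses that the surface has dimension two and no boundary: a boundary point or a
  piece of a curve would contradict openness of the image.\<close>

lemma surface_inj_open:
  fixes h :: "'a::t2_space \<Rightarrow> complex"
  assumes S: "closed_surface S" and N: "openin (top_of_set S) N" "continuous_on N h" "inj_on h N"
  shows "open (h ` N)"
  unfolding open_subopen[of "h ` N"]
proof
  fix y assume "y \<in> h ` N"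
  then obtain x where x: "x \<in> N" "y = h x" by blast
  then have "x \<in> S" using N openin_imp_subset by blast
  then obtain U p q where U: "openin (top_of_set S) U" "x \<in> U" "homeomorphism U (ball 0 1 :: complex set) p q"
    using surface_chart_at S by blast
  let ?D = "ball 0 1 \<inter> q -` (N \<inter> U)"
  have cq: "continuous_on (ball 0 1) q" and qU: "q ` ball 0 1 = U" using U(3) by (auto simp: homeomorphism_def)
  have "openin (top_of_set U) (N \<inter> U)"
    using N(1) U(1) by (meson inf_le2 openin_Int openin_imp_subset openin_subset_trans)
  then have "openin (top_of_set (ball 0 1)) ?D"
    using cq qU by (metis continuous_openin_preimage image_subset_iff_funcset order_refl)
  then have oD: "open ?D" using openin_open_trans open_ball by blast
  have c: "continuous_on ?D (h \<circ> q)"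
  proof (rule continuous_on_compose)
    show "continuous_on ?D q" using cq continuous_on_subset by blast
    show "continuous_on (q ` ?D) h" by (rule continuous_on_subset[OF N(2)]) auto
  qed
  have "inj_on q (ball 0 1)" using U(3) by (metis homeomorphism_apply2 inj_on_inverseI)
  then have i: "inj_on (h \<circ> q) ?D" using N(3) by (auto simp: inj_on_def)
  have "open ((h \<circ> q) ` ?D)" by (rule invariance_of_domain[OF c oD i])
  moreover have "y \<in> (h \<circ> q) ` ?D"
  proof -
    have "p x \<in> ball 0 1" "q (p x) = x" using U by (auto simp: homeomorphism_def)
    then show ?thesis using x U(2) by (auto intro!: image_eqI[of _ _ "p x"])
  qed
  moreover have "(h \<circ> q) ` ?D \<subseteq> h ` N" by auto
  ultimately show "\<exists>T. open T \<and> y \<in> T \<and> T \<subseteq> h ` N" by blast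
qed

text \<open>In a chart, \<open>B\<close> is a small round disc about \<open>x\<close>, and a planar
  disc stays connected without its centre. The last conclusion says that \<open>x\<close> is not
  isolated.\<close>

lemma surface_punctured_disc:
  assumes S: "closed_surface S" and P: "openin (top_of_set S) P" "x \<in> P"
  obtains B where "openin (top_of_set S) B" "x \<in> B" "B \<subseteq> P" "connected (B - {x})" "x \<in> closure (B - {x})"
proof -
  have "x \<in> S" using P openin_imp_subset by blast
  then obtain U p q where U: "openin (top_of_set S) U" "x \<in> U" "homeomorphism U (ball 0 1 :: complex set) p q"
    using surface_chart_at S by blast
  have cp: "continuous_on U p" and cq: "continuous_on (ball 0 1) q" and qU: "q ` ball 0 1 = U"
    and pU: "p ` U = ball 0 1" and qp: "\<And>y. y \<in> U \<Longrightarrow> q (p y) = y" and pq: "\<And>z. z \<in> ball 0 1 \<Longrightarrow> p (q z) = z"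
    using U(3) by (auto simp: homeomorphism_def)
  have "openin (top_of_set U) (P \<inter> U)"
    using P(1) U(1) by (meson inf_le2 openin_Int openin_imp_subset openin_subset_trans)
  then have "openin (top_of_set (ball 0 1)) (ball 0 1 \<inter> q -` (P \<inter> U))"
    using cq qU by (metis continuous_openin_preimage image_subset_iff_funcset order_refl)
  then have "open (ball 0 1 \<inter> q -` (P \<inter> U))" using openin_open_trans open_ball by blast
  moreover have "p x \<in> ball 0 1 \<inter> q -` (P \<inter> U)" using U P qp pU by auto
  ultimately obtain r where r: "r > 0" "ball (p x) r \<subseteq> ball 0 1 \<inter> q -` (P \<inter> U)"
    using open_contains_ball by metis
  have rb: "ball (p x) r \<subseteq> ball 0 1" using r by blast
  let ?B = "U \<inter> p -` ball (p x) r"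
  have Bq: "?B = q ` ball (p x) r"
  proof (intro equalityI subsetI)
    fix y assume "y \<in> ?B" then show "y \<in> q ` ball (p x) r" using qp by (metis IntE image_eqI vimageE)
  next
    fix y assume "y \<in> q ` ball (p x) r"
    then obtain z where "z \<in> ball (p x) r" "y = q z" by blast
    moreover then have "z \<in> ball 0 1" using rb by blast
    ultimately show "y \<in> ?B" using pq qU by auto
  qed
  have Bx: "?B - {x} = q ` (ball (p x) r - {p x})"
  proof -
    have iq: "inj_on q (ball 0 1)" using pq inj_on_inverseI by metis
    have "{x} = q ` {p x}" using qp U by simp
    then show ?thesis unfolding Bq using inj_on_image_set_diff[OF iq, of "ball (p x) r" "{p x}"] rb r(1)
      by (metis Diff_subset centre_in_ball insert_subset empty_subsetI subset_trans)
  qed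
  have cqb: "continuous_on (ball (p x) r) q" using cq rb continuous_on_subset by blast
  show ?thesis
  proof
    show "openin (top_of_set S) ?B" by (rule openin_homeomorphism_preimage[OF U(1,3)]) auto
    show "x \<in> ?B" using U r by auto
    show "?B \<subseteq> P" unfolding Bq using r by auto
    show "connected (?B - {x})" unfolding Bx
    proof (rule connected_continuous_image)
      show "continuous_on (ball (p x) r - {p x}) q" using cqb continuous_on_subset by blast
      show "connected (ball (p x) r - {p x})"
        by (rule connected_open_delete) (auto simp: connected_ball)
    qed
    show "x \<in> closure (?B - {x})"
    proof -
      have lp: "p x \<in> closure (ball (p x) r - {p x})"
        using islimpt_ball[of "p x" "p x" r] r(1) by (simp add: islimpt_in_closure)
      have "q ` (ball (p x) r \<inter> closure (ball (p x) r - {p x})) \<subseteq> closure (q ` (ball (p x) r - {p x}))"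
      proof (clarify)
        fix z assume z: "z \<in> ball (p x) r" "z \<in> closure (ball (p x) r - {p x})"
        show "q z \<in> closure (q ` (ball (p x) r - {p x}))"
          unfolding closure_iff_nhds_not_empty
        proof (intro allI impI)
          fix A V assume A: "V \<subseteq> A" "open V" "q z \<in> V"
          obtain D where D: "open D" "D \<inter> ball (p x) r = q -` V \<inter> ball (p x) r"
            using cqb A(2) continuous_on_open_invariant by metis
          then have "z \<in> D" using z A by auto
          then have "D \<inter> (ball (p x) r - {p x}) \<noteq> {}" using z D
            by (metis Int_commute open_Int_closure_eq_empty disjoint_iff)
          then obtain w where "w \<in> D" "w \<in> ball (p x) r - {p x}" by blast
          then have "q w \<in> V" "q w \<in> q ` (ball (p x) r - {p x})" using D by auto
          then show "q ` (ball (p x) r - {p x}) \<inter> A \<noteq> {}" using A by blast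
        qed
      qed
      moreover have "p x \<in> ball (p x) r \<inter> closure (ball (p x) r - {p x})" using lp r(1) by simp
      ultimately have "q (p x) \<in> closure (q ` (ball (p x) r - {p x}))" by blast
      then show ?thesis unfolding Bx using qp U by simp
    qed
  qed
qed

section \<open>Local degree\<close>

text \<open>Loops with the same winding number about \<open>w\<close> are homotopic in the plane
  without \<open>w\<close>, but \<open>\<tau>\<close> is controlled on the disc only. A retraction
  pulls the homotopy into the punctured disc, where \<open>\<tau>\<close> is continuous and avoids
  \<open>\<tau> w\<close>.\<close>

lemma winding_number_injective_image:
  fixes \<tau> :: "complex \<Rightarrow> complex"
  assumes W: "continuous_on W \<tau>" "inj_on \<tau> W" "cball w R \<subseteq> W" "R > 0"
    and g: "path g" "pathfinish g = pathstart g" "path_image g \<subseteq> cball w R - {w}"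
    and h: "path h" "pathfinish h = pathstart h" "path_image h \<subseteq> cball w R - {w}"
    and eq: "winding_number g w = winding_number h w"
  shows "winding_number (\<tau> \<circ> g) (\<tau> w) = winding_number (\<tau> \<circ> h) (\<tau> w)"
proof -
  have 1: "homotopic_loops (-{w}) g h"
    using winding_number_homotopic_loops_eq[of g w h] g h eq by blast
  \<comment> \<open>Radial retraction of the punctured plane onto the punctured disc of radius
    \<open>R\<close>.\<close>
  define \<rho> where "\<rho> z = w + of_real (min 1 (R / norm (z - w))) * (z - w)" for z
  have c: "continuous_on (-{w}) \<rho>" unfolding \<rho>_def
    by (intro continuous_intros) auto
  have im: "\<rho> \<in> (-{w}) \<rightarrow> cball w R - {w}"
  proof (intro funcsetI DiffI)
    fix z assume z: "z \<in> -{w}"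
    then have p: "norm (z - w) > 0" by auto
    have "norm (\<rho> z - w) = min 1 (R / norm (z - w)) * norm (z - w)"
      using W(4) by (simp add: \<rho>_def norm_mult)
    also have "\<dots> \<le> R / norm (z - w) * norm (z - w)"
      by (intro mult_right_mono) auto
    also have "\<dots> = R" using p by simp
    finally show "\<rho> z \<in> cball w R" by (simp add: dist_norm norm_minus_commute)
    show "\<rho> z \<notin> {w}" using p W(4) by (auto simp: \<rho>_def min_def)
  qed
  have id: "\<rho> z = z" if "z \<in> cball w R - {w}" for z
  proof -
    have "norm (z - w) \<le> R" "norm (z - w) > 0" using that by (auto simp: dist_norm norm_minus_commute)
    then have "min 1 (R / norm (z - w)) = 1" by (simp add: min_def field_simps)
    then show ?thesis by (simp add: \<rho>_def)
  qed
  have "homotopic_loops (cball w R - {w}) (\<rho> \<circ> g) (\<rho> \<circ> h)"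
    by (rule homotopic_loops_continuous_image[OF 1 c im])
  moreover have "homotopic_loops (cball w R - {w}) g (\<rho> \<circ> g)"
    by (rule homotopic_loops_eq) (use g id in \<open>auto simp: path_image_def image_subset_iff\<close>)
  moreover have "homotopic_loops (cball w R - {w}) h (\<rho> \<circ> h)"
    by (rule homotopic_loops_eq) (use h id in \<open>auto simp: path_image_def image_subset_iff\<close>)
  ultimately have 2: "homotopic_loops (cball w R - {w}) g h"
    using homotopic_loops_sym homotopic_loops_trans by blast
  have "homotopic_loops (-{\<tau> w}) (\<tau> \<circ> g) (\<tau> \<circ> h)"
  proof (rule homotopic_loops_continuous_image[OF 2])
    show "continuous_on (cball w R - {w}) \<tau>" using W continuous_on_subset by blast
    show "\<tau> \<in> cball w R - {w} \<rightarrow> -{\<tau> w}"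
    proof (intro funcsetI)
      fix z assume z: "z \<in> cball w R - {w}"
      then have "z \<in> W" "w \<in> W" using W by auto
      with z W(2) show "\<tau> z \<in> -{\<tau> w}" by (auto simp: inj_on_def)
    qed
  qed
  then show ?thesis by (rule winding_number_homotopic_loops)
qed

text \<open>It suffices that \<open>\<tau> z\<close> lies inside the simple closed image curve. If
  it lay outside, the image of the open disc would be open in the outside by invariance of domain
  and closed as the trace of a compact image, so it would be all of the connected but unbounded
  outside.\<close>

lemma winding_number_injective_circle:
  fixes \<tau> :: "complex \<Rightarrow> complex"
  assumes W: "continuous_on W \<tau>" "inj_on \<tau> W" "cball z r \<subseteq> W" "r > 0"
  shows "winding_number (\<tau> \<circ> circlepath z r) (\<tau> z) \<in> {1, -1}"
proof -
  let ?g = "\<tau> \<circ> circlepath z r"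
  have pi: "path_image ?g = \<tau> ` sphere z r"
    using W(4) by (simp add: path_image_compose)
  have ss: "sphere z r \<subseteq> W" using W(3) by auto
  have sp: "simple_path ?g"
  proof (rule simple_path_continuous_image)
    show "simple_path (circlepath z r)" using W(4) by (simp add: simple_path_circlepath)
    show "continuous_on (path_image (circlepath z r)) \<tau>" "inj_on \<tau> (path_image (circlepath z r))"
      using W ss by (auto intro: continuous_on_subset inj_on_subset)
  qed
  have lp: "pathfinish ?g = pathstart ?g" by (simp add: pathfinish_compose pathstart_compose)
  have "\<tau> z \<in> inside (path_image ?g)"
  proof (rule ccontr)
    assume n: "\<not> ?thesis"
    have disj: "\<tau> ` ball z r \<inter> path_image ?g = {}"
    proof -
      have "\<tau> ` ball z r \<inter> \<tau> ` sphere z r = \<tau> ` (ball z r \<inter> sphere z r)"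
        using inj_on_image_Int[OF W(2) subset_trans[OF ball_subset_cball W(3)] ss] by simp
      also have "ball z r \<inter> sphere z r = {}" by auto
      finally show ?thesis unfolding pi by simp
    qed
    have wb: "ball z r \<subseteq> W" using W(3) ball_subset_cball by blast
    have co: "connected (\<tau> ` ball z r)"
      using continuous_on_subset[OF W(1) wb] by (intro connected_continuous_image) auto
    have cpt: "compact (\<tau> ` cball z r)"
      using continuous_on_subset[OF W(1,3)] by (intro compact_continuous_image) auto
    have zb: "\<tau> z \<in> \<tau> ` ball z r" using W(4) by auto
    then have "\<tau> z \<in> outside (path_image ?g)"
      using n disj by (metis ComplI Int_iff UnE empty_iff inside_Un_outside)
    have cout: "connected (outside (path_image ?g))"
      by (rule connected_outside) (auto simp: pi intro!: compact_imp_bounded compact_continuous_image continuous_on_subset[OF W(1) ss])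
    have sub: "\<tau> ` ball z r \<subseteq> outside (path_image ?g)"
    proof -
      have "outside (path_image ?g) \<in> components (- path_image ?g)"
        using outside_in_components cout \<open>\<tau> z \<in> outside (path_image ?g)\<close> by blast
      then show ?thesis
        using components_maximal[of "outside (path_image ?g)" "- path_image ?g" "\<tau> ` ball z r"]
          disj co zb \<open>\<tau> z \<in> outside (path_image ?g)\<close> by blast
    qed
    have "open (\<tau> ` ball z r)"
      using continuous_on_subset[OF W(1) wb] inj_on_subset[OF W(2) wb] by (intro invariance_of_domain) auto
    then have o: "openin (top_of_set (outside (path_image ?g))) (\<tau> ` ball z r)"
      using sub by (rule open_subset[rotated])
    have "outside (path_image ?g) \<inter> \<tau> ` cball z r = \<tau> ` ball z r"
    proof -
      have "\<tau> ` cball z r = \<tau> ` ball z r \<union> path_image ?g" 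
        unfolding pi by (auto simp: image_iff) (metis less_eq_real_def mem_ball mem_sphere mem_cball)+
      moreover have "outside (path_image ?g) \<inter> path_image ?g = {}" by (rule outside_no_overlap)
      ultimately show ?thesis using sub by blast
    qed
    then have "closedin (top_of_set (outside (path_image ?g))) (\<tau> ` ball z r)"
      using compact_imp_closed[OF cpt] by (metis closedin_closed_Int)
    then have "\<tau> ` ball z r = outside (path_image ?g)"
      using o cout zb by (metis connected_clopen empty_iff)
    moreover have "bounded (\<tau> ` ball z r)"
      using cpt by (meson ball_subset_cball bounded_subset compact_imp_bounded image_mono)
    moreover have "\<not> bounded (outside (path_image ?g))"
      by (rule unbounded_outside) (auto simp: pi intro!: compact_imp_bounded compact_continuous_image continuous_on_subset[OF W(1) ss])
    ultimately show False by simp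
  qed
  then show ?thesis using simple_closed_path_winding_number_inside[OF sp] by blast
qed

section \<open>Exponential coordinates on the model polygon\<close>

text \<open>\<open>kap n\<close> maps the upper half plane to the punctured model polygon, the real line to its boundary, and
  the integer \<open>k\<close> to corner \<open>k\<close>.\<close>

definition kap :: "nat \<Rightarrow> complex \<Rightarrow> complex" where
  "kap n z = exp (\<i> * of_real (2 * pi / real n) * z)"

definition half_strip :: "nat \<Rightarrow> complex set" where
  "half_strip j = {z. real j < Re z \<and> Re z < real j + 1 \<and> 0 \<le> Im z}"

text \<open>The slice of the polygon over a side, with the side but without the bounding radii and
  the centre. Slices over different sides are disjoint, so strips can be glued without choosing
  collar widths.\<close>

definition sector :: "nat \<Rightarrow> nat \<Rightarrow> complex set" where
  "sector n j = kap n ` half_strip j"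

lemma continuous_on_kap [continuous_intros]:
  "continuous_on A g \<Longrightarrow> continuous_on A (\<lambda>x. kap n (g x))"
  unfolding kap_def by (intro continuous_intros)

lemma norm_kap: "norm (kap n z) = exp (- (2 * pi / real n * Im z))"
  by (simp add: kap_def norm_exp_eq_Re)

lemma kap_in_ball: "n > 0 \<Longrightarrow> kap n z \<in> ball 0 1 \<longleftrightarrow> Im z > 0"
  by (simp add: norm_kap zero_less_divide_iff zero_less_mult_iff)

lemma kap_in_cball:
  assumes "n > 0"
  shows "kap n z \<in> cball 0 1 \<longleftrightarrow> Im z \<ge> 0"
proof -
  define c where "c = 2 * pi / real n"
  have "c > 0" using assms by (simp add: c_def)
  then show ?thesis by (simp add: norm_kap flip: c_def) (simp add: zero_le_mult_iff)
qed

lemma kap_in_sphere: "n > 0 \<Longrightarrow> kap n z \<in> sphere 0 1 \<longleftrightarrow> Im z = 0"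
  by (simp add: norm_kap)

lemma kap_of_real: "kap n (of_real t) = cis (2 * pi * t / real n)"
  by (simp add: kap_def cis_conv_exp mult.assoc)

lemma kap_eq_iff:
  assumes "n > 0"
  shows "kap n z = kap n w \<longleftrightarrow> (\<exists>m::int. z = w + of_int m * of_nat n)"
proof -
  have *: "\<i> * complex_of_real (2 * pi / real n) * z = \<i> * complex_of_real (2 * pi / real n) * w + of_int (2 * m) * pi * \<i>
      \<longleftrightarrow> z = w + of_int m * of_nat n" for m :: int
  proof -
    have "\<i> * complex_of_real (2 * pi / real n) * w + of_int (2 * m) * pi * \<i>
       = \<i> * complex_of_real (2 * pi / real n) * (w + of_int m * of_nat n)"
      using assms by (simp add: field_simps)
    then show ?thesis using assms by simp
  qed
  show ?thesis unfolding kap_def exp_eq * ..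
qed

lemma kap_shift [simp]: "n > 0 \<Longrightarrow> kap n (z + of_nat n) = kap n z"
  unfolding kap_eq_iff by (intro exI[of _ 1]) simp

lemma kap_inj_strip:
  assumes "kap n z = kap n w" "n > 0" "\<bar>Re z - Re w\<bar> < real n"
  shows "z = w"
proof -
  obtain m :: int where m: "z = w + of_int m * of_nat n" using assms(1,2) kap_eq_iff by blast
  then have "Re z - Re w = of_int m * real n" by simp
  then have "\<bar>real_of_int m\<bar> * real n < 1 * real n" using assms by (simp add: abs_mult)
  then have "\<bar>real_of_int m\<bar> < 1" using assms(2) by (metis mult_less_cancel_right_disj of_nat_0_le_iff not_less)
  then have "m = 0" by linarith
  with m show ?thesis by simp
qed

lemma kap_surj:
  assumes "n > 0" "w \<noteq> 0"
  obtains z where "kap n z = w" "0 \<le> Re z" "Re z < real n"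
proof -
  define z0 where "z0 = Ln w / (\<i> * of_real (2 * pi / real n))"
  have 0: "kap n z0 = w" using assms by (simp add: kap_def z0_def)
  \<comment> \<open>Shifting by this multiple of the period moves the logarithm into one fundamental
    strip.\<close>
  define m where "m = \<lfloor>Re z0 / real n\<rfloor>"
  define z where "z = z0 + of_int (-m) * of_nat n"
  have "kap n z = w" using 0 kap_eq_iff[OF assms(1)] z_def by blast
  moreover have "of_int m \<le> Re z0 / real n" "Re z0 / real n < of_int m + 1"
    by (auto simp: m_def)
  then have "0 \<le> Re z" "Re z < real n" using assms(1) by (auto simp: z_def field_simps)
  ultimately show ?thesis using that by blast
qed

lemma corner_kap: "corner n k = kap n (of_nat k)"
  using kap_of_real[of n "real k"] by (simp add: corner_def)

lemma corner_n [simp]: "n > 0 \<Longrightarrow> corner n n = corner n 0"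
  using kap_shift[of n 0] by (simp add: corner_kap)

lemma side_kap: "side n k = (\<lambda>t. kap n (of_real t)) ` {real k<..<real k + 1}"
  by (simp add: side_def kap_of_real)

lemma side_kap01: "side n k = (\<lambda>t. kap n (of_nat k + of_real t)) ` {0<..<1}"
proof -
  have "{real k<..<real k + 1} = (\<lambda>t. real k + t) ` {0<..<1}"
    by (auto intro!: image_eqI[of _ _ "x - real k" for x])
  then show ?thesis by (simp add: side_kap image_image)
qed

lemma corner_in_sphere: "corner n k \<in> sphere 0 1"
  by (simp add: corner_def)

lemma side_subset_sphere: "side n k \<subseteq> sphere 0 1"
  by (auto simp: side_def)

lemma sphere_cases:
  assumes "n > 0" "w \<in> sphere 0 1"
  obtains k where "k < n" "w = corner n k" | k where "k < n" "w \<in> side n k"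
proof -
  obtain z where z: "kap n z = w" "0 \<le> Re z" "Re z < real n" using assms by (metis kap_surj dist_0_norm mem_sphere norm_zero zero_neq_one)
  then have "Im z = 0" using assms kap_in_sphere by metis
  then have zr: "z = of_real (Re z)" by (simp add: complex_eq_iff)
  define k where "k = nat \<lfloor>Re z\<rfloor>"
  have k: "real k \<le> Re z" "Re z < real k + 1" using z(2) by (auto simp: k_def)
  then have "k < n" using z(3) by linarith
  show ?thesis
  proof (cases "Re z = real k")
    case True
    then have "w = corner n k" using z(1) zr by (metis corner_kap of_real_of_nat_eq)
    then show ?thesis using that \<open>k < n\<close> by blast
  next
    case False
    then have "w \<in> side n k" unfolding side_kap using k z(1) zr by (intro image_eqI[of _ _ "Re z"]) auto
    then show ?thesis using that \<open>k < n\<close> by blast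
  qed
qed

lemma side_subset_sector: "side n j \<subseteq> sector n j"
  unfolding sector_def side_kap by (auto simp: half_strip_def)

lemma sector_unique:
  assumes "z \<in> half_strip j" "w \<in> half_strip j'" "j < n" "j' < n" "kap n z = kap n w"
  shows "z = w" "j = j'"
proof -
  have "Re z < real n" "Re w < real n" "Re z > 0" "Re w > 0"
    using assms(1-4) by (auto simp: half_strip_def)
  then have "\<bar>Re z - Re w\<bar> < real n" by linarith
  then show "z = w" using kap_inj_strip assms by (metis gr0I not_less0)
  with assms show "j = j'" unfolding half_strip_def by auto
qed

lemma sector_disjoint: "j < n \<Longrightarrow> j' < n \<Longrightarrow> w \<in> sector n j \<Longrightarrow> w \<in> sector n j' \<Longrightarrow> j = j'"
  using sector_unique unfolding sector_def by blast

lemma sector_subset_cball: "n > 0 \<Longrightarrow> sector n j \<subseteq> cball 0 1"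
  unfolding sector_def using kap_in_cball by (auto simp: half_strip_def)

text \<open>The sector is the trace on the closed disc of the image of the full vertical strip,
  which is open by invariance of domain.\<close>

lemma sector_cball_compl_compact:
  assumes "n > 0"
  shows "compact (cball 0 1 - sector n j)"
proof -
  let ?D = "{z. real j < Re z \<and> Re z < real j + 1}"
  have "open ?D"
    using open_Int[OF open_halfspace_Re_gt[of "real j"] open_halfspace_Re_lt[of "real j + 1"]]
    by (simp add: Int_def)
  moreover have "inj_on (kap n) ?D"
    by (rule inj_onI) (rule kap_inj_strip[of n], use assms in auto)
  ultimately have "open (kap n ` ?D)"
    by (intro invariance_of_domain continuous_on_kap continuous_on_id)
  moreover have "cball 0 1 - sector n j = cball 0 1 - kap n ` ?D"
    using kap_in_cball[OF assms] unfolding sector_def half_strip_def by blast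
  ultimately show ?thesis by (simp add: compact_diff)
qed

lemma corner_inj: "k < n \<Longrightarrow> j < n \<Longrightarrow> corner n k = corner n j \<Longrightarrow> k = j"
  using kap_inj_strip[of n "of_nat k" "of_nat j"] by (simp add: corner_kap)

section \<open>Embedded graphs\<close>

lemma embedded_edge:
  assumes "embedded_graph S V E" "e \<in> E"
  obtains g where "simple_path g" "path_image g \<subseteq> S" "pathstart g \<in> V" "pathfinish g \<in> V"
    "e = g ` {0<..<1}" "closure e = path_image g" "closure e - e = {pathstart g, pathfinish g}"
proof -
  obtain g where g: "simple_path g" "path_image g \<subseteq> S" "pathstart g \<in> V" "pathfinish g \<in> V"
      "e = g ` {0<..<1}" "e \<inter> V = {}"
    using assms unfolding embedded_graph_def graph_edge_def by meson
  have cg: "continuous_on {0..1} g" using g(1) by (simp add: simple_path_def path_def)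
  have "closed (path_image g)" using g(1) by (simp add: compact_imp_closed compact_path_image simple_path_imp_path)
  then have 1: "closure e \<subseteq> path_image g" unfolding g(5) path_image_def
    by (intro closure_minimal) auto
  have "g ` closure {0<..<1} \<subseteq> closure e" unfolding g(5)
    by (rule image_closure_subset) (simp_all add: cg closure_subset)
  then have 2: "closure e = path_image g" using 1 by (auto simp: path_image_def)
  have "{0..1::real} = {0<..<1} \<union> {0,1}" by auto
  then have "path_image g = e \<union> {pathstart g, pathfinish g}"
    unfolding path_image_def g(5) pathstart_def pathfinish_def by (metis image_Un image_insert image_empty)
  then have "closure e - e = {pathstart g, pathfinish g}" using 2 g(3,4,6) by auto
  with g 2 show ?thesis using that by blast
qed

lemma embedded_edge_facts:
  assumes "embedded_graph S V E" "e \<in> E"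
  shows "e \<subseteq> S" "e \<noteq> {}" "connected e" "e \<inter> V = {}" "closure e - e \<subseteq> V" "closure e \<subseteq> S"
proof -
  obtain g where g: "simple_path g" "path_image g \<subseteq> S" "pathstart g \<in> V" "pathfinish g \<in> V"
    "e = g ` {0<..<1}" "closure e = path_image g" "closure e - e = {pathstart g, pathfinish g}"
    using embedded_edge assms by metis
  show "e \<subseteq> S" using g by (metis closure_subset subset_trans)
  show "e \<noteq> {}" using g by simp
  show "connected e" unfolding g(5) using g(1)
    by (intro connected_continuous_image) (auto simp: simple_path_def path_def intro: continuous_on_subset)
  show "e \<inter> V = {}" using assms unfolding embedded_graph_def graph_edge_def by blast
  show "closure e - e \<subseteq> V" "closure e \<subseteq> S" using g by auto
qed

lemma embedded_edges_disjoint: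
  assumes "embedded_graph S V E" "e \<in> E" "e' \<in> E" "x \<in> e" "x \<in> e'"
  shows "e = e'"
  using assms unfolding embedded_graph_def by (metis disjnt_iff pairwiseD)

lemma embedded_edge_closure_disjoint:
  assumes "embedded_graph S V E" "e \<in> E" "e' \<in> E" "e \<noteq> e'"
  shows "e \<inter> closure e' = {}"
proof -
  have False if "x \<in> e" "x \<in> closure e'" for x
  proof (cases "x \<in> e'")
    case True
    then show False using embedded_edges_disjoint[OF assms(1-3)] that assms(4) by auto
  next
    case False
    then have "x \<in> V" using embedded_edge_facts(5)[OF assms(1,3)] that by auto
    then show False using embedded_edge_facts(4)[OF assms(1,2)] that by auto
  qed
  then show ?thesis by auto
qed

text \<open>The open parameter interval is saturated because both ends of the path are vertices and
  the open edge contains none; hence the inverse parametrization is continuous.\<close>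

lemma embedded_edge_coord:
  assumes "embedded_graph S V E" "e \<in> E"
  obtains q :: "'a::t2_space \<Rightarrow> real" where "continuous_on e q" "inj_on q e"
proof -
  obtain g where g: "simple_path g" "pathstart g \<in> V" "pathfinish g \<in> V" "e = g ` {0<..<1}"
    using embedded_edge assms by metis
  have i: "inj_on g {0<..<1}"
    using g(1) unfolding simple_path_def loop_free_def by (force simp: inj_on_def)
  have "homeomorphism {0<..<1} (g ` {0<..<1}) g (inv_into {0<..<1} g)"
  proof (rule homeomorphism_saturated[of "{0..1}"])
    show "continuous_on {0..1} g" using g(1) by (simp add: simple_path_def path_def)
    show "z \<in> {0<..<1}" if "z \<in> {0..1}" "g z \<in> g ` {0<..<1}" for z
    proof (rule ccontr)
      assume "z \<notin> {0<..<1}"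
      then have "z = 0 \<or> z = 1" using that by auto
      then have "g z \<in> V" using g by (auto simp: pathstart_def pathfinish_def)
      moreover have "e \<inter> V = {}" using embedded_edge_facts assms by metis
      ultimately show False using that g(4) by blast
    qed
  qed (use i in auto)
  then show ?thesis using that[of "inv_into {0<..<1} g"] g(4)
    by (metis homeomorphism_cont2 homeomorphism_apply2 inj_on_inverseI)
qed

text \<open>The edge coordinate would embed \<open>P\<close> into the real axis as an open subset of
  the plane.\<close>

lemma embedded_edge_no_interior:
  assumes S: "closed_surface S" and e: "embedded_graph S V E" "e \<in> E"
    and P: "openin (top_of_set S) P" "P \<subseteq> e"
  shows "P = {}"
proof (rule ccontr)
  assume "P \<noteq> {}"
  obtain q :: "'a \<Rightarrow> real" where q: "continuous_on e q" "inj_on q e" by (rule embedded_edge_coord[OF e])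
  have "open ((complex_of_real \<circ> q) ` P)"
  proof (rule surface_inj_open[OF S P(1)])
    show "continuous_on P (complex_of_real \<circ> q)"
      unfolding comp_def by (intro continuous_on_of_real continuous_on_subset[OF q(1) P(2)])
    show "inj_on (complex_of_real \<circ> q) P" using q(2) P(2) by (auto simp: inj_on_def)
  qed
  moreover obtain x where "x \<in> P" using \<open>P \<noteq> {}\<close> by blast
  ultimately obtain r where r: "r > 0" "ball (of_real (q x)) r \<subseteq> (complex_of_real \<circ> q) ` P"
    by (metis comp_apply image_eqI open_contains_ball)
  have "of_real (q x) + \<i> * of_real (r/2) \<in> ball (complex_of_real (q x)) r"
    using r(1) by (simp add: dist_norm norm_mult)
  then obtain y where "of_real (q x) + \<i> * of_real (r/2) = complex_of_real (q y)" using r(2) by auto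
  then show False using r(1) by (auto simp: complex_eq_iff)
qed

section \<open>Tilings by polygons\<close>

lemma sector_cases: "w \<in> sector n j \<Longrightarrow> n > 0 \<Longrightarrow> w \<in> ball 0 1 \<or> w \<in> side n j"
proof -
  assume "w \<in> sector n j" "n > 0"
  then obtain z where z: "w = kap n z" "real j < Re z" "Re z < real j + 1" "0 \<le> Im z"
    by (auto simp: sector_def half_strip_def)
  show ?thesis
  proof (cases "Im z = 0")
    case True
    then have "z = of_real (Re z)" by (simp add: complex_eq_iff)
    then have "w = kap n (of_real (Re z))" using z(1) by simp
    then show ?thesis using z by (auto simp: side_kap)
  next
    case False
    then show ?thesis using kap_in_ball[OF \<open>n > 0\<close>, of z] z by auto
  qed
qed

definition inc_on01 :: "(real \<Rightarrow> real) \<Rightarrow> bool" where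
  "inc_on01 s \<longleftrightarrow> (\<forall>x y. 0 < x \<longrightarrow> x < y \<longrightarrow> y < 1 \<longrightarrow> s x < s y)"

definition dec_on01 :: "(real \<Rightarrow> real) \<Rightarrow> bool" where
  "dec_on01 s \<longleftrightarrow> (\<forall>x y. 0 < x \<longrightarrow> x < y \<longrightarrow> y < 1 \<longrightarrow> s y < s x)"

lemma not_inc_and_dec: "\<not> (inc_on01 s \<and> dec_on01 s)"
proof
  assume "inc_on01 s \<and> dec_on01 s"
  then have "s (1/3) < s (1/2)" "s (1/2) < s (1/3)" by (auto simp: inc_on01_def dec_on01_def)
  then show False by simp
qed

text \<open>The difference \<open>s y - s x\<close> has no zero on the triangle
  \<open>0 < x < y < 1\<close>, which is convex and hence connected, so its sign is
  constant.\<close>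

lemma inj_continuous_inc_or_dec:
  assumes "continuous_on {0<..<1} s" "inj_on s {0<..<1}"
  shows "inc_on01 s \<or> dec_on01 s"
proof -
  define P where "P = {p :: real \<times> real. 0 < fst p \<and> fst p < snd p \<and> snd p < 1}"
  have "convex P"
  proof (rule convexI)
    fix p q :: "real \<times> real" and u v :: real
    assume a: "p \<in> P" "q \<in> P" "0 \<le> u" "0 \<le> v" "u + v = 1"
    have c: "convex {0<..<1::real}" "convex {(0::real)<..}" by simp_all
    have "u *\<^sub>R fst p + v *\<^sub>R fst q \<in> {0<..<1}" "u *\<^sub>R snd p + v *\<^sub>R snd q \<in> {0<..<1}"
      by (rule convexD[OF c(1)]; use a in \<open>simp add: P_def\<close>)+
    moreover have "u *\<^sub>R (snd p - fst p) + v *\<^sub>R (snd q - fst q) \<in> {0<..}"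
      by (rule convexD[OF c(2)]; use a in \<open>simp add: P_def\<close>)
    ultimately show "u *\<^sub>R p + v *\<^sub>R q \<in> P" by (simp add: P_def algebra_simps)
  qed
  then have "connected P" by (rule convex_connected)
  moreover have "continuous_on P (\<lambda>p. s (snd p) - s (fst p))"
    by (intro continuous_on_diff continuous_on_compose2[OF assms(1)] continuous_on_snd continuous_on_fst continuous_on_id)
       (auto simp: P_def)
  ultimately have c: "connected ((\<lambda>p. s (snd p) - s (fst p)) ` P)" by (rule connected_continuous_image[rotated])
  have nz: "0 \<notin> (\<lambda>p. s (snd p) - s (fst p)) ` P"
  proof
    assume "0 \<in> (\<lambda>p. s (snd p) - s (fst p)) ` P"
    then obtain a b where "0 < a" "a < b" "b < 1" "s a = s b" by (auto simp: P_def)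
    then show False using inj_onD[OF assms(2), of a b] by auto
  qed
  show ?thesis
  proof (rule ccontr)
    assume "\<not> ?thesis"
    then obtain x y x' y' where a: "0 < x" "x < y" "y < 1" "\<not> s x < s y" "0 < x'" "x' < y'" "y' < 1" "\<not> s y' < s x'"
      unfolding inc_on01_def dec_on01_def by blast
    have "(x, y) \<in> P" "(x', y') \<in> P" using a by (auto simp: P_def)
    then have "s y - s x \<in> (\<lambda>p. s (snd p) - s (fst p)) ` P" "s y' - s x' \<in> (\<lambda>p. s (snd p) - s (fst p)) ` P"
      by force+
    then have "{s y - s x..s y' - s x'} \<subseteq> (\<lambda>p. s (snd p) - s (fst p)) ` P"
      using c connected_contains_Icc by blast
    moreover have "0 \<in> {s y - s x..s y' - s x'}" using a by simp
    ultimately show False using nz by blast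
  qed
qed

definition open_strip :: "complex set" where
  "open_strip = {z. 0 < Re z \<and> Re z < 1}"

lemma open_open_strip: "open open_strip"
  using open_Int[OF open_halfspace_Re_gt[of 0] open_halfspace_Re_lt[of 1]]
  by (simp add: Int_def open_strip_def)

lemma convex_open_strip: "convex open_strip"
  using convex_Int[OF convex_halfspace_Re_gt[of 0] convex_halfspace_Re_lt[of 1]]
  by (simp add: Int_def open_strip_def)

text \<open>One polygon map is fixed per tile, so that a side can be named by a pair
  \<open>(T, j)\<close> although its edge may occur again in the same or in another tile. The number
  \<open>n\<close> is common to all tiles and will be \<open>4\<close> or \<open>5\<close>.\<close>

locale ptiling =
  fixes S :: "'a::t2_space set" and V :: "'a set" and E :: "'a set set"
    and n :: nat and f :: "'a set \<Rightarrow> complex \<Rightarrow> 'a"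
  assumes surf: "closed_surface S" and graph: "embedded_graph S V E" and n3: "n \<ge> 3"
    and pm: "\<And>T. T \<in> tiles S V E \<Longrightarrow> polygon_map V E n (f T) T"
begin

abbreviation "TT \<equiv> tiles S V E"

definition ed :: "'a set \<Rightarrow> nat \<Rightarrow> 'a set" where
  "ed T j = f T ` side n j"

definition cor :: "'a set \<Rightarrow> nat \<Rightarrow> 'a" where
  "cor T j = f T (corner n j)"

lemma n0: "n > 0" using n3 by simp

lemma tile_facts:
  assumes "T \<in> TT"
  shows "T \<subseteq> S" "T \<inter> (V \<union> \<Union>E) = {}" "connected T" "T \<noteq> {}"
  using in_components_subset[OF assms[unfolded tiles_def]] in_components_connected[OF assms[unfolded tiles_def]]
    in_components_nonempty[OF assms[unfolded tiles_def]] by auto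

lemma tile_unique: "T \<in> TT \<Longrightarrow> T' \<in> TT \<Longrightarrow> x \<in> T \<Longrightarrow> x \<in> T' \<Longrightarrow> T = T'"
  unfolding tiles_def by (metis IntI components_nonoverlap empty_iff)

lemma f_cont: "T \<in> TT \<Longrightarrow> continuous_on (cball 0 1) (f T)"
  using pm unfolding polygon_map_def by blast

lemma f_ball:
  assumes "T \<in> TT"
  shows "f T ` ball 0 1 = T" "inj_on (f T) (ball 0 1)"
proof -
  obtain g where "homeomorphism (ball 0 1) T (f T) g" using pm[OF assms] unfolding polygon_map_def by blast
  then show "f T ` ball 0 1 = T" "inj_on (f T) (ball 0 1)"
    by (auto simp: homeomorphism_def intro: inj_on_inverseI)
qed

lemma f_in_tile: "T \<in> TT \<Longrightarrow> z \<in> ball 0 1 \<Longrightarrow> f T z \<in> T"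
  using f_ball by blast

lemma cor_V: "T \<in> TT \<Longrightarrow> k \<le> n \<Longrightarrow> cor T k \<in> V"
  using pm[of T] n0 corner_n[of n] unfolding polygon_map_def cor_def
  by (metis le_neq_implies_less)

lemma cor_n [simp]: "cor T n = cor T 0"
  by (simp add: cor_def n0)

lemma ed_E: "T \<in> TT \<Longrightarrow> k < n \<Longrightarrow> ed T k \<in> E"
  using pm unfolding polygon_map_def ed_def by blast

lemma side_inj: "T \<in> TT \<Longrightarrow> k < n \<Longrightarrow> inj_on (f T) (side n k)"
  using pm unfolding polygon_map_def by blast

lemma edge_V: "e \<in> E \<Longrightarrow> x \<in> e \<Longrightarrow> x \<notin> V"
  using embedded_edge_facts(4)[OF graph] by blast

lemma edge_unique: "e \<in> E \<Longrightarrow> e' \<in> E \<Longrightarrow> x \<in> e \<Longrightarrow> x \<in> e' \<Longrightarrow> e = e'"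
  using embedded_edges_disjoint[OF graph] .

lemma f_sphere:
  assumes "T \<in> TT" "z \<in> sphere 0 1"
  shows "f T z \<in> V \<union> \<Union>E"
  using sphere_cases[OF n0 assms(2)] 
proof cases
  case (1 k)
  then show ?thesis using cor_V[OF assms(1), of k] by (simp add: cor_def)
next
  case (2 k)
  then show ?thesis using ed_E[OF assms(1), of k] by (auto simp: ed_def)
qed

lemma cball_cases: "(z :: complex) \<in> cball 0 1 \<Longrightarrow> z \<in> ball 0 1 \<or> z \<in> sphere 0 1"
  by auto

lemma f_edge:
  assumes "T \<in> TT" "z \<in> cball 0 1" "f T z \<in> e" "e \<in> E"
  obtains j where "j < n" "z \<in> side n j" "ed T j = e"
proof -
  have "z \<notin> ball 0 1" using f_in_tile[OF assms(1)] tile_facts(2)[OF assms(1)] assms(3,4) by auto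
  then have zs: "z \<in> sphere 0 1" using cball_cases assms(2) by blast
  show ?thesis
  proof (rule sphere_cases[OF n0 zs])
    fix k assume k: "k < n" "z = corner n k"
    then have "f T z \<in> V" using cor_V[OF assms(1), of k] by (simp add: cor_def)
    then show ?thesis using edge_V[OF assms(4,3)] by simp
  next
    fix k assume k: "k < n" "z \<in> side n k"
    then have "f T z \<in> ed T k" by (auto simp: ed_def)
    then have "ed T k = e" using edge_unique ed_E[OF assms(1) k(1)] assms(3,4) by metis
    then show ?thesis using that k by blast
  qed
qed

lemma f_vertex:
  assumes "T \<in> TT" "z \<in> cball 0 1" "f T z \<in> V"
  obtains k where "k < n" "z = corner n k"
proof -
  have "z \<notin> ball 0 1" using f_in_tile[OF assms(1)] tile_facts(2)[OF assms(1)] assms(3) by auto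
  then have zs: "z \<in> sphere 0 1" using cball_cases assms(2) by blast
  show ?thesis
  proof (rule sphere_cases[OF n0 zs])
    fix k assume k: "k < n" "z = corner n k"
    then show ?thesis by (rule that)
  next
    fix k assume k: "k < n" "z \<in> side n k"
    then have "f T z \<in> ed T k" by (auto simp: ed_def)
    then show ?thesis using edge_V ed_E[OF assms(1) k(1)] assms(3) by metis
  qed
qed

lemma f_cball_S: "T \<in> TT \<Longrightarrow> f T ` cball 0 1 \<subseteq> S"
proof
  fix x assume T: "T \<in> TT" and "x \<in> f T ` cball 0 1"
  then obtain z where z: "x = f T z" "z \<in> ball 0 1 \<or> z \<in> sphere 0 1" using cball_cases by blast
  have "V \<subseteq> S" using graph by (simp add: embedded_graph_def)
  moreover have "\<Union>E \<subseteq> S" using embedded_edge_facts(1)[OF graph] by blast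
  ultimately have "V \<union> \<Union>E \<subseteq> S" by blast
  then have "z \<in> sphere 0 1 \<Longrightarrow> f T z \<in> S" using f_sphere[OF T, of z] by auto
  moreover have "z \<in> ball 0 1 \<Longrightarrow> f T z \<in> S" using f_in_tile[OF T, of z] tile_facts(1)[OF T] by auto
  ultimately show "x \<in> S" using z by auto
qed

text \<open>Boundary points go to the graph and interior points into the tile, so identifications
  can only take place on the boundary circle.\<close>

lemma f_interior_unique:
  assumes "T \<in> TT" "T' \<in> TT" "z \<in> ball 0 1" "z' \<in> cball 0 1" "f T z = f T' z'"
  shows "T = T'" "z = z'"
proof -
  have 1: "f T z \<in> T" using f_in_tile assms by blast
  have zb: "z' \<in> ball 0 1"
  proof (rule ccontr)
    assume "z' \<notin> ball 0 1"
    then have "f T z \<in> V \<union> \<Union>E" using f_sphere[OF assms(2)] cball_cases[OF assms(4)] assms(5) by metis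
    then show False using 1 tile_facts(2)[OF assms(1)] by blast
  qed
  then have "f T z \<in> T'" using f_in_tile assms by metis
  then show "T = T'" using tile_unique 1 assms by metis
  then show "z = z'" using f_ball(2)[OF assms(1)] zb assms by (metis inj_onD)
qed

lemma tile_closure:
  assumes "T \<in> TT"
  shows "closure T = f T ` cball 0 1"
proof
  have "closed (f T ` cball 0 1)" using f_cont[OF assms] by (intro compact_imp_closed compact_continuous_image) auto
  moreover have "T \<subseteq> f T ` cball 0 1" using f_ball(1)[OF assms] ball_subset_cball by blast
  ultimately show "closure T \<subseteq> f T ` cball 0 1" by (rule closure_minimal[rotated])
  have "f T ` closure (ball 0 1) \<subseteq> closure T"
    by (rule image_closure_subset) (simp_all add: f_cont[OF assms] f_ball(1)[OF assms] closure_subset)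
  then show "f T ` cball 0 1 \<subseteq> closure T" by simp
qed

text \<open>Follows from \<open>f_interior_unique\<close> unless both points lie on sides, where
  disjointness of edges decides. It is what makes glued strips injective.\<close>

lemma sector_meet:
  assumes "T \<in> TT" "T' \<in> TT" "j < n" "j' < n" "z \<in> sector n j" "w \<in> sector n j'" "f T z = f T' w"
  shows "(T = T' \<and> j = j' \<and> z = w) \<or> (z \<in> side n j \<and> w \<in> side n j' \<and> ed T j = ed T' j')"
proof -
  have c: "z \<in> cball 0 1" "w \<in> cball 0 1" using sector_subset_cball[OF n0] assms by blast+
  consider "z \<in> ball 0 1" | "w \<in> ball 0 1" | "z \<in> side n j" "w \<in> side n j'"
    using sector_cases[OF assms(5) n0] sector_cases[OF assms(6) n0] by blast
  then show ?thesis
  proof cases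
    case 1
    then have "T = T'" "z = w" using f_interior_unique[OF assms(1,2) 1 c(2) assms(7)] by auto
    then show ?thesis using sector_disjoint assms by blast
  next
    case 2
    then have "T = T'" "z = w" using f_interior_unique[OF assms(2,1) 2 c(1)] assms(7) by auto
    then show ?thesis using sector_disjoint assms by blast
  next
    case 3
    have "f T z \<in> ed T j" using 3(1) by (auto simp: ed_def)
    moreover have "f T z \<in> ed T' j'" unfolding assms(7) using 3(2) by (auto simp: ed_def)
    ultimately have "ed T j = ed T' j'" using edge_unique ed_E assms by metis
    then show ?thesis using 3 by blast
  qed
qed

lemma sector_inj: "T \<in> TT \<Longrightarrow> j < n \<Longrightarrow> inj_on (f T) (sector n j)"
proof (rule inj_onI)
  fix z w assume a: "T \<in> TT" "j < n" "z \<in> sector n j" "w \<in> sector n j" "f T z = f T w"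
  show "z = w" using sector_meet[OF a(1,1,2,2,3,4,5)] inj_onD[OF side_inj[OF a(1,2)] a(5)] by blast
qed

definition par :: "'a set \<Rightarrow> nat \<Rightarrow> real \<Rightarrow> 'a" where
  "par T j x = f T (kap n (of_nat j + of_real x))"

lemma par_0: "par T j 0 = cor T j"
  by (simp add: par_def cor_def corner_kap)

lemma par_1: "par T j 1 = cor T (Suc j)"
  by (simp add: par_def cor_def corner_kap add.commute)

lemma par_cont: "T \<in> TT \<Longrightarrow> continuous_on {0..1} (par T j)"
  unfolding par_def
  by (rule continuous_on_compose2[OF f_cont]) (auto intro!: continuous_intros simp: norm_kap)

lemma par_ed: "par T j ` {0<..<1} = ed T j"
  by (simp add: par_def ed_def side_kap01 image_image)

lemma par_side: "x \<in> {0<..<1} \<Longrightarrow> kap n (of_nat j + of_real x) \<in> side n j"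
  by (auto simp: side_kap01)

lemma par_inj: "T \<in> TT \<Longrightarrow> j < n \<Longrightarrow> inj_on (par T j) {0<..<1}"
proof (rule inj_onI)
  fix x y assume a: "T \<in> TT" "j < n" "x \<in> {0<..<1::real}" "y \<in> {0<..<1}" "par T j x = par T j y"
  then have "kap n (of_nat j + of_real x) = kap n (of_nat j + of_real y)"
    using inj_onD[OF side_inj[OF a(1,2)]] par_side unfolding par_def by blast
  then have "of_nat j + complex_of_real x = of_nat j + of_real y"
    by (rule kap_inj_strip) (use a n3 in auto)
  then show "x = y" by simp
qed

lemma ed_closure:
  assumes "T \<in> TT" "j < n"
  shows "closure (ed T j) - ed T j = {cor T j, cor T (Suc j)}"
proof -
  have "closure (ed T j) = par T j ` {0..1}"
  proof
    show "closure (ed T j) \<subseteq> par T j ` {0..1}"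
      using par_cont[OF assms(1)] unfolding par_ed[symmetric]
      by (intro closure_minimal compact_imp_closed compact_continuous_image image_mono) auto
    have "par T j ` closure {0<..<1} \<subseteq> closure (ed T j)"
      by (rule image_closure_subset) (simp_all add: par_cont[OF assms(1)] par_ed closure_subset)
    then show "par T j ` {0..1} \<subseteq> closure (ed T j)" by simp
  qed
  also have "{0..1::real} = {0<..<1} \<union> {0, 1}" by auto
  finally have "closure (ed T j) = ed T j \<union> {cor T j, cor T (Suc j)}"
    by (simp only: image_Un par_ed image_insert image_empty par_0 par_1)
  moreover have "cor T j \<notin> ed T j" "cor T (Suc j) \<notin> ed T j"
    using edge_V[OF ed_E[OF assms]] cor_V[OF assms(1)] assms(2) by (metis Suc_leI less_imp_le)+
  ultimately show ?thesis by blast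
qed

lemma par_homeo:
  assumes "T \<in> TT" "j < n"
  shows "homeomorphism {0<..<1} (ed T j) (par T j) (inv_into {0<..<1} (par T j))"
  unfolding par_ed[symmetric]
proof (rule homeomorphism_saturated[OF _ par_cont[OF assms(1)]])
  show "inj_on (par T j) {0<..<1}" using par_inj assms by blast
  fix x :: real assume x: "x \<in> {0..1}" "par T j x \<in> par T j ` {0<..<1}"
  then have "par T j x \<notin> V" using edge_V[OF ed_E[OF assms]] by (simp add: par_ed)
  then have "x \<noteq> 0 \<and> x \<noteq> 1" using cor_V[OF assms(1)] assms(2) par_0 par_1 by (metis Suc_leI less_imp_le)
  then show "x \<in> {0<..<1}" using x by auto
qed auto

text \<open>The change of parameter between two sides over the same edge. It is meaningful on the
  open interval, where \<open>par\<close> is injective; nothing is known about its values at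
  \<open>0\<close> and \<open>1\<close>.\<close>

definition transit :: "'a set \<Rightarrow> nat \<Rightarrow> 'a set \<Rightarrow> nat \<Rightarrow> real \<Rightarrow> real" where
  "transit T j T' j' x = inv_into {0<..<1} (par T' j') (par T j x)"

lemma transit_facts:
  assumes "T \<in> TT" "j < n" "T' \<in> TT" "j' < n" "ed T j = ed T' j'"
  shows "continuous_on {0<..<1} (transit T j T' j')"
    and "\<And>x. x \<in> {0<..<1} \<Longrightarrow> transit T j T' j' x \<in> {0<..<1}"
    and "\<And>x. x \<in> {0<..<1} \<Longrightarrow> par T' j' (transit T j T' j' x) = par T j x"
    and "inj_on (transit T j T' j') {0<..<1}"
    and "transit T j T' j' ` {0<..<1} = {0<..<1}"
proof -
  have h: "homeomorphism {0<..<1} (ed T j) (par T j) (inv_into {0<..<1} (par T j))"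
    and h': "homeomorphism (ed T j) {0<..<1} (inv_into {0<..<1} (par T' j')) (par T' j')"
    using par_homeo[OF assms(1,2)] homeomorphism_symD[OF par_homeo[OF assms(3,4)]] unfolding assms(5) .
  have c: "homeomorphism {0<..<1} {0<..<1} (inv_into {0<..<1} (par T' j') \<circ> par T j) (inv_into {0<..<1} (par T j) \<circ> par T' j')"
    by (rule homeomorphism_compose[OF h h'])
  have e: "inv_into {0<..<1} (par T' j') \<circ> par T j = transit T j T' j'"
    by (auto simp: transit_def)
  show "continuous_on {0<..<1} (transit T j T' j')" "transit T j T' j' ` {0<..<1} = {0<..<1}"
    using c unfolding e by (rule homeomorphism_cont1, rule homeomorphism_image1)
  then show "\<And>x. x \<in> {0<..<1} \<Longrightarrow> transit T j T' j' x \<in> {0<..<1}" by blast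
  show "inj_on (transit T j T' j') {0<..<1}"
    using homeomorphism_apply1[OF c[unfolded e]] by (rule inj_on_inverseI)
  show "\<And>x. x \<in> {0<..<1} \<Longrightarrow> par T' j' (transit T j T' j' x) = par T j x"
    unfolding transit_def by (rule f_inv_into_f) (use par_ed[of T j] par_ed[of T' j'] assms(5) in blast)
qed

lemma transit_inc_or_dec:
  assumes "T \<in> TT" "j < n" "T' \<in> TT" "j' < n" "ed T j = ed T' j'"
  shows "inc_on01 (transit T j T' j') \<or> dec_on01 (transit T j T' j')"
  using inj_continuous_inc_or_dec transit_facts(1,4)[OF assms] by blast

text \<open>\<open>T\<close> is put into the upper half of the vertical strip, and the reflected \<open>T'\<close> into the lower half.\<close>

definition glue :: "'a set \<Rightarrow> nat \<Rightarrow> 'a set \<Rightarrow> nat \<Rightarrow> complex \<Rightarrow> 'a" where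
  "glue T j T' j' z = (if 0 \<le> Im z then f T (kap n (of_nat j + z))
     else f T' (kap n (of_nat j' + of_real (transit T j T' j' (Re z)) - \<i> * of_real (Im z))))"

lemma glue_facts:
  assumes a: "T \<in> TT" "j < n" "T' \<in> TT" "j' < n" "ed T j = ed T' j'" and ne: "(T, j) \<noteq> (T', j')"
  shows "continuous_on open_strip (glue T j T' j')" "inj_on (glue T j T' j') open_strip"
    "glue T j T' j' ` open_strip = f T ` sector n j \<union> f T' ` sector n j'"
proof -
  let ?s = "transit T j T' j'"
  let ?u = "\<lambda>z. kap n (of_nat j + z)"
  let ?l = "\<lambda>z. kap n (of_nat j' + of_real (?s (Re z)) - \<i> * of_real (Im z))"
  let ?Q = open_strip
  let ?U = "?Q \<inter> {z. Im z \<ge> 0}" and ?L = "?Q \<inter> {z. Im z \<le> 0}"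
  note s = transit_facts[OF a]
  have us: "?u z \<in> sector n j" if "z \<in> ?Q" "Im z \<ge> 0" for z
    using that unfolding sector_def by (intro imageI) (auto simp: half_strip_def open_strip_def)
  have ls: "?l z \<in> sector n j'" if "z \<in> ?Q" "Im z \<le> 0" for z
    using that s(2)[of "Re z"] unfolding sector_def by (intro imageI) (auto simp: half_strip_def open_strip_def)
  have ui: "?u z = ?u w \<Longrightarrow> z = w" if "z \<in> ?Q" "w \<in> ?Q" for z w
    using kap_inj_strip[of n "of_nat j + z" "of_nat j + w"] that n3 by (auto simp: open_strip_def)
  have li: "z = w" if "?l z = ?l w" "z \<in> ?Q" "w \<in> ?Q" for z w
  proof -
    have z: "?s (Re z) \<in> {0<..<1}" "?s (Re w) \<in> {0<..<1}" using s(2) that by (auto simp: open_strip_def)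
    have "of_nat j' + complex_of_real (?s (Re z)) - \<i> * of_real (Im z) = of_nat j' + complex_of_real (?s (Re w)) - \<i> * of_real (Im w)"
      by (rule kap_inj_strip[OF that(1)]) (use z n3 in auto)
    then have "?s (Re z) = ?s (Re w)" "Im z = Im w" by (simp_all add: complex_eq_iff)
    moreover have "Re z \<in> {0<..<1}" "Re w \<in> {0<..<1}" using that by (auto simp: open_strip_def)
    ultimately show "z = w" using inj_onD[OF s(4)] by (simp add: complex_eq_iff)
  qed
  have real: "f T (?u z) = f T' (?l z)" if "z \<in> ?Q" "Im z = 0" for z
  proof -
    have "z = of_real (Re z)" using that by (simp add: complex_eq_iff)
    then have "f T (?u z) = par T j (Re z)" by (metis par_def)
    also have "\<dots> = par T' j' (?s (Re z))" using s(3)[of "Re z"] that by (auto simp: open_strip_def)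
    finally show ?thesis using that by (simp add: par_def)
  qed
  have geq: "glue T j T' j' z = f T' (?l z)" if "z \<in> ?Q" "Im z \<le> 0" for z
    using real[of z] that by (auto simp: glue_def)
  have cu: "continuous_on ?U (\<lambda>z. f T (?u z))"
    by (rule continuous_on_compose2[OF f_cont[OF a(1)]])
       (use us sector_subset_cball[OF n0] in \<open>auto intro!: continuous_intros\<close>)
  have cs: "continuous_on ?L (\<lambda>z. ?s (Re z))"
    by (rule continuous_on_compose2[OF s(1)]) (auto intro!: continuous_intros simp: open_strip_def)
  have cl: "continuous_on ?L (\<lambda>z. f T' (?l z))"
    by (rule continuous_on_compose2[OF f_cont[OF a(3)]])
       (use ls sector_subset_cball[OF n0] in \<open>auto intro!: continuous_intros cs\<close>)
  \<comment> \<open>Both halves are closed in the strip and agree on the real segment, where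
    \<open>transit\<close> translates the parameters.\<close>
  have "continuous_on (?U \<union> ?L) (\<lambda>z. if 0 \<le> Im z then f T (?u z) else f T' (?l z))"
  proof (rule continuous_on_cases_local[OF _ _ cu cl])
    have "closedin (top_of_set ?Q) ?U" "closedin (top_of_set ?Q) ?L"
      using closed_halfspace_Im_ge[of 0] closed_halfspace_Im_le[of 0] closedin_closed_Int by blast+
    moreover have "?U \<union> ?L = ?Q" by auto
    ultimately show "closedin (top_of_set (?U \<union> ?L)) ?U" "closedin (top_of_set (?U \<union> ?L)) ?L" by simp_all
    show "\<And>x. x \<in> ?U \<and> \<not> 0 \<le> Im x \<or> x \<in> ?L \<and> 0 \<le> Im x \<Longrightarrow> f T (?u x) = f T' (?l x)" using real by auto
  qed
  moreover have "?U \<union> ?L = ?Q" by auto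
  ultimately show "continuous_on open_strip (glue T j T' j')" unfolding glue_def by simp
  \<comment> \<open>A point below the axis lies in the interior of \<open>T'\<close>, so by
    \<open>sector_meet\<close> it can coincide only with a point of the same side, which
    \<open>ne\<close> excludes. Different sides of one tile \<open>T = T'\<close> are
    included.\<close>
  have cross: False if "z \<in> ?Q" "w \<in> ?Q" "Im z \<ge> 0" "Im w < 0" "f T (?u z) = f T' (?l w)" for z w
  proof -
    have "?l w \<in> ball 0 1" using kap_in_ball[OF n0] that by simp
    then have "?l w \<notin> side n j'" using side_subset_sphere[of n j'] by auto
    then have "(T, j) = (T', j')" using sector_meet[OF a(1,3,2,4) us ls that(5)] that by auto
    then show False using ne by blast
  qed
  show "inj_on (glue T j T' j') open_strip"
  proof (rule inj_onI)
    fix z w assume zw: "z \<in> ?Q" "w \<in> ?Q" "glue T j T' j' z = glue T j T' j' w"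
    consider "Im z \<ge> 0" "Im w \<ge> 0" | "Im z < 0" "Im w < 0" | "Im z \<ge> 0" "Im w < 0" | "Im w \<ge> 0" "Im z < 0" by linarith
    then show "z = w"
    proof cases
      case 1
      then have "?u z = ?u w" using inj_onD[OF sector_inj[OF a(1,2)] _ us us] zw by (simp add: glue_def)
      then show ?thesis using ui zw by blast
    next
      case 2
      then have "?l z = ?l w" using inj_onD[OF sector_inj[OF a(3,4)] _ ls ls] zw by (simp add: glue_def)
      then show ?thesis using li zw by blast
    next
      case 3
      then show ?thesis using cross[of z w] zw by (simp add: glue_def)
    next
      case 4
      then show ?thesis using cross[of w z] zw by (simp add: glue_def)
    qed
  qed
  show "glue T j T' j' ` open_strip = f T ` sector n j \<union> f T' ` sector n j'"
  proof (intro equalityI subsetI)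
    fix x assume "x \<in> glue T j T' j' ` ?Q"
    then obtain z where z: "z \<in> ?Q" "x = glue T j T' j' z" by blast
    show "x \<in> f T ` sector n j \<union> f T' ` sector n j'"
    proof (cases "Im z \<ge> 0")
      case True then show ?thesis using z us[of z] by (auto simp: glue_def)
    next
      case False then show ?thesis using z ls[of z] by (auto simp: glue_def)
    qed
  next
    fix x assume "x \<in> f T ` sector n j \<union> f T' ` sector n j'"
    then show "x \<in> glue T j T' j' ` ?Q"
    proof
      assume "x \<in> f T ` sector n j"
      then obtain z where z: "x = f T (kap n z)" "z \<in> half_strip j" by (auto simp: sector_def)
      then have "z - of_nat j \<in> ?Q" "glue T j T' j' (z - of_nat j) = x"
        by (auto simp: open_strip_def half_strip_def glue_def)
      then show ?thesis by blast
    next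
      assume "x \<in> f T' ` sector n j'"
      then obtain z where z: "x = f T' (kap n z)" "z \<in> half_strip j'" by (auto simp: sector_def)
      then have "Re z - real j' \<in> ?s ` {0<..<1}" unfolding s(5) by (auto simp: half_strip_def)
      then obtain t where t: "t \<in> {0<..<1}" "?s t = Re z - real j'" by (metis imageE)
      let ?w = "Complex t (- Im z)"
      have w: "?w \<in> ?Q" "Im ?w \<le> 0" using t z by (auto simp: open_strip_def half_strip_def)
      have "of_nat j' + complex_of_real (?s (Re ?w)) - \<i> * of_real (Im ?w) = z"
        using t by (simp add: complex_eq_iff)
      then have "glue T j T' j' ?w = x" using geq[OF w] z by simp
      then show ?thesis using w by blast
    qed
  qed
qed

lemma two_sectors_open:
  assumes a: "T \<in> TT" "j < n" "T' \<in> TT" "j' < n" "ed T j = ed T' j'" and ne: "(T, j) \<noteq> (T', j')"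
  shows "openin (top_of_set S) (f T ` sector n j \<union> f T' ` sector n j')"
proof -
  note g = glue_facts[OF a ne]
  have "glue T j T' j' ` open_strip \<subseteq> S"
    unfolding g(3) using f_cball_S[OF a(1)] f_cball_S[OF a(3)] sector_subset_cball[OF n0] by blast
  from surface_image_open[OF surf open_open_strip g(1,2) this] show ?thesis unfolding g(3) .
qed

end

section \<open>Every edge is exactly two sides of tiles\<close>

text \<open>Finiteness belongs to the conclusion because \<open>card\<close> is \<open>0\<close> on
  infinite sets.\<close>

lemma finite_card_le_2:
  assumes "\<And>x y z. x \<in> A \<Longrightarrow> y \<in> A \<Longrightarrow> z \<in> A \<Longrightarrow> x \<noteq> y \<Longrightarrow> y \<noteq> z \<Longrightarrow> x \<noteq> z \<Longrightarrow> False"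
  shows "finite A \<and> card A \<le> 2"
proof (rule ccontr)
  assume n: "\<not> ?thesis"
  obtain B where B: "B \<subseteq> A" "card B = 3"
  proof (cases "finite A")
    case True
    then have "3 \<le> card A" using n by simp
    then show ?thesis using obtain_subset_with_card_n that by metis
  next
    case False
    then show ?thesis using infinite_arbitrarily_large[of A 3] that by metis
  qed
  obtain x y z where "B = {x, y, z}" "x \<noteq> y" "y \<noteq> z" "x \<noteq> z" using B(2) unfolding card_3_iff by metis
  then show False using assms[of x y z] B(1) by blast
qed

lemma openin_diff_closed: "closed C \<Longrightarrow> openin (top_of_set S) (S - C)"
  by (simp add: Diff_eq openin_open_Int open_Compl)

context ptiling begin

definition sides_of :: "'a set \<Rightarrow> ('a set \<times> nat) set" where
  "sides_of e = {(T, j). T \<in> TT \<and> j < n \<and> ed T j = e}"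

text \<open>A vertical move in exponential coordinates leads from the boundary into the open disc,
  and by continuity a short one stays in \<open>P\<close>. Thus a coincidence on the boundary yields
  one at an interior point, where \<open>f_interior_unique\<close> is available.\<close>

lemma push_into_tile:
  assumes "T \<in> TT" "Im z \<ge> 0" "openin (top_of_set S) P" "f T (kap n z) \<in> P"
  obtains y where "0 < y" "y < 1" "f T (kap n (z + \<i> * of_real y)) \<in> P"
proof -
  let ?g = "\<lambda>y::real. f T (kap n (z + \<i> * of_real y))"
  have im: "kap n (z + \<i> * of_real y) \<in> cball 0 1" if "y \<in> {0..}" for y
    using kap_in_cball[OF n0] that assms(2) by simp
  have "continuous_on {0..} ?g"
    by (rule continuous_on_compose2[OF f_cont[OF assms(1)]]) (use im in \<open>auto intro!: continuous_intros\<close>)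
  moreover have "?g \<in> {0..} \<rightarrow> S" using im f_cball_S[OF assms(1)] by (auto simp del: mem_cball_0)
  ultimately have "openin (top_of_set {0..}) ({0..} \<inter> ?g -` P)"
    using continuous_openin_preimage assms(3) by blast
  moreover have "0 \<in> {0..} \<inter> ?g -` P" using assms(4) by simp
  ultimately obtain r where r: "r > 0" "ball 0 r \<inter> {0..} \<subseteq> {0..} \<inter> ?g -` P"
    unfolding openin_contains_ball by blast
  let ?y = "min (r/2) (1/2)"
  have "?y \<in> ball 0 r \<inter> {0..}" using r(1) by (auto simp: dist_norm)
  then have "?g ?y \<in> P" using r(2) by blast
  then show ?thesis using that[of ?y] r(1) by simp
qed

lemma kap_push_ball: "Im z \<ge> 0 \<Longrightarrow> 0 < y \<Longrightarrow> kap n (z + \<i> * of_real y) \<in> ball 0 1"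
  using kap_in_ball[OF n0] by simp

text \<open>Two sectors over an edge already form an open set around it. A third side would have
  interior points of its tile inside that set, next to its middle, and these are identified with
  nothing else.\<close>

lemma sides_of_le_2: "finite (sides_of e) \<and> card (sides_of e) \<le> 2"
proof (rule finite_card_le_2)
  fix p q r assume a: "p \<in> sides_of e" "q \<in> sides_of e" "r \<in> sides_of e" "p \<noteq> q" "q \<noteq> r" "p \<noteq> r"
  obtain T1 j1 T2 j2 T3 j3 where e: "p = (T1, j1)" "q = (T2, j2)" "r = (T3, j3)" by (metis surj_pair)
  have b: "T1 \<in> TT" "j1 < n" "ed T1 j1 = e" "T2 \<in> TT" "j2 < n" "ed T2 j2 = e" "T3 \<in> TT" "j3 < n" "ed T3 j3 = e"
    using a(1-3) unfolding e sides_of_def by auto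
  have "ed T1 j1 = ed T2 j2" "(T1, j1) \<noteq> (T2, j2)" using b a(4) e by auto
  then have O: "openin (top_of_set S) (f T1 ` sector n j1 \<union> f T2 ` sector n j2)"
    using two_sectors_open b by blast
  let ?z = "of_nat j3 + complex_of_real (1/2)"
  have "f T3 (kap n ?z) \<in> ed T1 j1" unfolding b(3) using par_ed[of T3 j3] b(9) imageI[of "1/2" "{0<..<1}" "par T3 j3"] by (simp add: par_def)
  then have "f T3 (kap n ?z) \<in> f T1 ` sector n j1 \<union> f T2 ` sector n j2"
    using side_subset_sector[of n j1] unfolding ed_def by blast
  then obtain y where y: "0 < y" "y < 1" "f T3 (kap n (?z + \<i> * of_real y)) \<in> f T1 ` sector n j1 \<union> f T2 ` sector n j2"
    using push_into_tile[OF b(7) _ O, of ?z] by auto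
  let ?w = "kap n (?z + \<i> * of_real y)"
  have ws: "?w \<in> sector n j3" unfolding sector_def using y by (intro imageI) (auto simp: half_strip_def)
  have wb: "?w \<in> ball 0 1" using kap_push_ball[of ?z y] y by simp
  have wn: "?w \<notin> side n j3" using wb side_subset_sphere[of n j3] by auto
  from y(3) show False
  proof
    assume "f T3 ?w \<in> f T1 ` sector n j1"
    then obtain u where "u \<in> sector n j1" "f T3 ?w = f T1 u" by blast
    then show False using sector_meet[OF b(7,1,8,2) ws] wn a(6) e by blast
  next
    assume "f T3 ?w \<in> f T2 ` sector n j2"
    then obtain u where "u \<in> sector n j2" "f T3 ?w = f T2 u" by blast
    then show False using sector_meet[OF b(7,4,8,5) ws] wn a(5) e by blast
  qed
qed

lemma finite_tiles: "finite TT"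
proof -
  have "TT \<subseteq> fst ` (\<Union>e\<in>E. sides_of e)"
  proof
    fix T assume "T \<in> TT"
    then have "(T, 0) \<in> sides_of (ed T 0)" "ed T 0 \<in> E" using ed_E n0 by (auto simp: sides_of_def)
    then show "T \<in> fst ` (\<Union>e\<in>E. sides_of e)" by force
  qed
  moreover have "finite E" using graph by (simp add: embedded_graph_def)
  ultimately show ?thesis using sides_of_le_2 by (meson finite_UN_I finite_imageI finite_subset)
qed

lemma tile_cball_closed: "T \<in> TT \<Longrightarrow> closed (f T ` cball 0 1)"
  using tile_closure closed_closure by metis

lemma tile_cballs_closed: "A \<subseteq> TT \<Longrightarrow> closed (\<Union>T\<in>A. f T ` cball 0 1)"
  using finite_tiles tile_cball_closed by (intro closed_UN) (auto intro: finite_subset)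

lemma finite_E: "finite E" and finite_V: "finite V"
  using graph by (auto simp: embedded_graph_def)

lemma not_graph_in_tile:
  assumes "x \<in> S" "x \<notin> V" "x \<notin> \<Union>E"
  obtains T where "T \<in> TT" "x \<in> T"
  using Union_components[of "S - (V \<union> \<Union>E)"] assms unfolding tiles_def by blast

text \<open>Removing the closed tiles, the vertices and the other closed edges leaves an open subset
  of the surface inside \<open>e\<close>, which is empty by
  \<open>embedded_edge_no_interior\<close>.\<close>

lemma edge_covered:
  assumes "e \<in> E" "x \<in> e"
  obtains T where "T \<in> TT" "x \<in> f T ` cball 0 1"
proof -
  let ?C = "(\<Union>T\<in>TT. f T ` cball 0 1) \<union> V \<union> (\<Union>e'\<in>E-{e}. closure e')"
  have "closed ?C"
  proof (intro closed_Un tile_cballs_closed closed_UN ballI)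
    show "closed V" using finite_V by (rule finite_imp_closed)
  qed (use finite_E in auto)
  then have "openin (top_of_set S) (S - ?C)" by (rule openin_diff_closed)
  moreover have "S - ?C \<subseteq> e"
  proof
    fix y assume y: "y \<in> S - ?C"
    show "y \<in> e"
    proof (rule ccontr)
      assume "y \<notin> e"
      have "y \<notin> \<Union>E"
      proof
        assume "y \<in> \<Union>E"
        then obtain e' where e': "e' \<in> E" "y \<in> e'" by blast
        then have "e' \<in> E - {e}" "y \<in> closure e'" using \<open>y \<notin> e\<close> closure_subset by auto
        then show False using y by blast
      qed
      then obtain T where T: "T \<in> TT" "y \<in> T" by (rule not_graph_in_tile[of y, rotated 2]) (use y in auto)
      then have "y \<in> f T ` cball 0 1" using tile_closure closure_subset by blast
      then show False using y T(1) by blast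
    qed
  qed
  ultimately have "S - ?C = {}" using embedded_edge_no_interior[OF surf graph assms(1)] by blast
  moreover have "x \<in> S" using embedded_edge_facts(1)[OF graph assms(1)] assms(2) by blast
  moreover have "x \<notin> V" using edge_V assms by blast
  moreover have "x \<notin> (\<Union>e'\<in>E-{e}. closure e')"
    using embedded_edge_closure_disjoint[OF graph assms(1)] assms(2) by auto
  ultimately have "x \<in> (\<Union>T\<in>TT. f T ` cball 0 1)" by blast
  then show ?thesis using that by blast
qed

lemma S_covered:
  assumes "x \<in> S" "x \<notin> V"
  obtains T z where "T \<in> TT" "z \<in> cball 0 1" "x = f T z"
proof (cases "x \<in> \<Union>E")
  case True
  then obtain e where "e \<in> E" "x \<in> e" by blast
  then obtain T where T: "T \<in> TT" "x \<in> f T ` cball 0 1" by (rule edge_covered)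
  from T(2) show ?thesis using that[OF T(1)] by (rule imageE)
next
  case False
  then obtain T where T: "T \<in> TT" "x \<in> T" by (rule not_graph_in_tile[OF assms])
  then have "x \<in> f T ` cball 0 1" using tile_closure closure_subset by blast
  then show ?thesis using that[OF T(1)] by (rule imageE)
qed

lemma sides_of_nonempty: 
  assumes "e \<in> E" 
  obtains T j where "T \<in> TT" "j < n" "ed T j = e"
proof -
  obtain x where x: "x \<in> e" using embedded_edge_facts(2)[OF graph assms] by blast
  obtain T where T: "T \<in> TT" "x \<in> f T ` cball 0 1" using assms x by (rule edge_covered)
  then obtain z where z: "z \<in> cball 0 1" "f T z \<in> e" using x by blast
  obtain j where "j < n" "ed T j = e" using f_edge[OF T(1) z assms] by blast
  then show ?thesis using that T by blast
qed

text \<open>With a single side the sector would contain a neighbourhood of the middle of the edge.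
  The inverse of \<open>f T\<close> would map this neighbourhood onto an open planar set inside the
  closed disc that contains a point of the circle.\<close>

lemma sides_of_not_single:
  assumes "e \<in> E" "sides_of e = {(T, j)}"
  shows False
proof -
  have "(T, j) \<in> sides_of e" using assms(2) by simp
  then have a: "T \<in> TT" "j < n" "ed T j = e" by (simp_all add: sides_of_def)
  have uniq: "T' = T \<and> j' = j" if "T' \<in> TT" "j' < n" "ed T' j' = e" for T' j'
  proof -
    have "(T', j') \<in> sides_of e" using that by (simp add: sides_of_def)
    then show ?thesis using assms(2) by simp
  qed
  let ?z = "kap n (of_nat j + complex_of_real (1/2))"
  let ?x = "f T ?z"
  have zs: "?z \<in> side n j" by (rule par_side) simp
  then have xe: "?x \<in> e" unfolding a(3)[symmetric] ed_def by blast
  have hs: "homeomorphism (sector n j) (f T ` sector n j) (f T) (inv_into (sector n j) (f T))"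
  proof (rule homeomorphism_saturated[OF _ f_cont[OF a(1)] sector_subset_cball[OF n0] sector_inj[OF a(1,2)]])
    fix z assume z: "z \<in> cball 0 1" "f T z \<in> f T ` sector n j"
    then obtain w where w: "w \<in> sector n j" "f T z = f T w" by blast
    from sector_cases[OF w(1) n0] show "z \<in> sector n j"
    proof
      assume "w \<in> ball 0 1"
      then have "w = z" using f_interior_unique(2)[OF a(1,1) _ z(1)] w(2) by simp
      then show ?thesis using w by simp
    next
      assume "w \<in> side n j"
      then have "f T z \<in> e" using w(2) a(3) by (auto simp: ed_def)
      from f_edge[OF a(1) z(1) this assms(1)]
      obtain i where i: "i < n" "z \<in> side n i" "ed T i = e" .
      then have "z \<in> side n j" using uniq[OF a(1) i(1,3)] by simp
      then show ?thesis using subsetD[OF side_subset_sector] by simp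
    qed
  qed simp
  \<comment> \<open>Whatever lies outside this closed set lies in the sector, and uniqueness of the
    side keeps the middle point outside it.\<close>
  let ?C = "V \<union> (\<Union>T'\<in>TT-{T}. f T' ` cball 0 1) \<union> f T ` (cball 0 1 - sector n j)"
  have "closed (f T ` (cball 0 1 - sector n j))"
    by (intro compact_imp_closed compact_continuous_image continuous_on_subset[OF f_cont[OF a(1)]] sector_cball_compl_compact n0) auto
  then have "closed ?C" using tile_cballs_closed[of "TT - {T}"] finite_V
    by (metis Diff_subset closed_Un finite_imp_closed)
  then have op: "openin (top_of_set S) (S - ?C)" by (rule openin_diff_closed)
  have sub: "S - ?C \<subseteq> f T ` sector n j"
  proof
    fix y assume y: "y \<in> S - ?C"
    then have "y \<in> S" "y \<notin> V" by auto
    then obtain T' w where w: "T' \<in> TT" "w \<in> cball 0 1" "y = f T' w" by (rule S_covered)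
    then have "T' = T" using y by blast
    then show "y \<in> f T ` sector n j" using y w by blast
  qed
  have xS: "?x \<in> S - ?C"
  proof
    show "?x \<in> S" using embedded_edge_facts(1)[OF graph assms(1)] xe by blast
    have "?x \<notin> V" using edge_V assms(1) xe by blast
    moreover have "?x \<notin> f T' ` cball 0 1" if "T' \<in> TT - {T}" for T'
    proof
      assume "?x \<in> f T' ` cball 0 1"
      then obtain w where w0: "?x = f T' w" "w \<in> cball 0 1" by (rule imageE)
      then have w: "w \<in> cball 0 1" "f T' w \<in> e" using xe by simp_all
      have T': "T' \<in> TT" "T' \<noteq> T" using \<open>T' \<in> TT - {T}\<close> by auto
      from f_edge[OF T'(1) w assms(1)] obtain i where i: "i < n" "ed T' i = e" .
      then show False using uniq[OF T'(1) i] T'(2) by simp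
    qed
    moreover have "?x \<notin> f T ` (cball 0 1 - sector n j)"
    proof
      assume "?x \<in> f T ` (cball 0 1 - sector n j)"
      then obtain w where w0: "?x = f T w" "w \<in> cball 0 1 - sector n j" by (rule imageE)
      then have w: "w \<in> cball 0 1" "w \<notin> sector n j" "f T w \<in> e" using xe by simp_all
      from f_edge[OF a(1) w(1,3) assms(1)]
      obtain i where i: "i < n" "w \<in> side n i" "ed T i = e" .
      then have "w \<in> side n j" using uniq[OF a(1) i(1,3)] by simp
      then show False using subsetD[OF side_subset_sector] w(2) by simp
    qed
    ultimately show "?x \<notin> ?C" by blast
  qed
  let ?h = "inv_into (sector n j) (f T)"
  have "continuous_on (S - ?C) ?h" using homeomorphism_cont2[OF hs] sub by (rule continuous_on_subset)
  moreover have "inj_on ?h (S - ?C)" using sub by (rule inj_on_subset[OF inj_on_inv_into]) simp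
  ultimately have "open (?h ` (S - ?C))" using surface_inj_open[OF surf op] by blast
  moreover have "?h ` (S - ?C) \<subseteq> cball 0 1"
  proof -
    have "?h ` (S - ?C) \<subseteq> ?h ` f T ` sector n j" using sub by (rule image_mono)
    also have "\<dots> = sector n j" by (rule homeomorphism_image2[OF hs])
    finally show ?thesis using sector_subset_cball[OF n0] by (rule subset_trans)
  qed
  ultimately have "?h ` (S - ?C) \<subseteq> interior (cball 0 1)" by (rule interior_maximal[rotated])
  moreover have "?h ?x = ?z" using subsetD[OF side_subset_sector zs] by (intro inv_into_f_f sector_inj a)
  ultimately have "?z \<in> interior (cball 0 1)" using imageI[OF xS, of ?h] by auto
  then show False using side_subset_sphere[of n j] zs by auto
qed

theorem card_sides_of:
  assumes "e \<in> E"
  shows "card (sides_of e) = 2"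
proof -
  obtain T j where "(T, j) \<in> sides_of e" using sides_of_nonempty[OF assms] unfolding sides_of_def by blast
  then have "card (sides_of e) \<noteq> 0" using sides_of_le_2[of e] by auto
  moreover have "card (sides_of e) \<noteq> 1"
    using sides_of_not_single[OF assms] by (metis card_1_singletonE surj_pair)
  ultimately show ?thesis using sides_of_le_2[of e] by linarith
qed

lemma sides_of_two:
  assumes "e \<in> E" "p \<in> sides_of e" "q \<in> sides_of e" "p \<noteq> q"
  shows "sides_of e = {p, q}"
proof -
  have "card {p, q} = 2" using assms by simp
  then show ?thesis using card_sides_of[OF assms(1)] sides_of_le_2[of e] assms
    by (metis card_subset_eq empty_subsetI insert_subset)
qed

section \<open>The link of a vertex\<close>

text \<open>Within \<open>d\<close> of its ends, a change of edge parameter respects which half of the edge a point is in; so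
  points of an edge close to a vertex belong to matching corners of the two adjacent tiles.\<close>

definition splits_ends :: "(real \<Rightarrow> real) \<Rightarrow> real \<Rightarrow> bool" where
  "splits_ends s d \<longleftrightarrow> (\<forall>x. 0 < x \<longrightarrow> x < 1 \<longrightarrow>
    (x < d \<longrightarrow> (inc_on01 s \<longrightarrow> s x < 1/2) \<and> (dec_on01 s \<longrightarrow> s x > 1/2)) \<and>
    (x > 1 - d \<longrightarrow> (inc_on01 s \<longrightarrow> s x > 1/2) \<and> (dec_on01 s \<longrightarrow> s x < 1/2)))"

lemma splits_ends_mono: "splits_ends s d \<Longrightarrow> d' \<le> d \<Longrightarrow> splits_ends s d'"
  unfolding splits_ends_def by fastforce

text \<open>By monotonicity the preimage \<open>b\<close> of the middle parameter decides on which
  side of \<open>1/2\<close> an image lies; \<open>d\<close> is the distance of \<open>b\<close>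
  from the nearer end.\<close>

lemma transit_splits_ends:
  assumes a: "T \<in> TT" "j < n" "T' \<in> TT" "j' < n" "ed T j = ed T' j'"
  shows "\<exists>d>0. splits_ends (transit T j T' j') d"
proof -
  let ?s = "transit T j T' j'"
  have "1/2 \<in> ?s ` {0<..<1}" unfolding transit_facts(5)[OF a] by simp
  then obtain b where b: "?s b = 1/2" "0 < b" "b < 1" by force
  define d where "d = min b (1 - b)"
  have "splits_ends ?s d" unfolding splits_ends_def
  proof (intro allI impI)
    fix x :: real assume x: "0 < x" "x < 1"
    have 1: "x < d \<Longrightarrow> x < b" "x > 1 - d \<Longrightarrow> b < x" by (auto simp: d_def)
    have 2: "inc_on01 ?s \<Longrightarrow> x < b \<Longrightarrow> ?s x < 1/2" "dec_on01 ?s \<Longrightarrow> x < b \<Longrightarrow> ?s x > 1/2"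
      "inc_on01 ?s \<Longrightarrow> x > b \<Longrightarrow> ?s x > 1/2" "dec_on01 ?s \<Longrightarrow> x > b \<Longrightarrow> ?s x < 1/2"
      using b x unfolding inc_on01_def dec_on01_def by metis+
    show "(x < d \<longrightarrow> (inc_on01 ?s \<longrightarrow> ?s x < 1/2) \<and> (dec_on01 ?s \<longrightarrow> ?s x > 1/2)) \<and>
      (x > 1 - d \<longrightarrow> (inc_on01 ?s \<longrightarrow> ?s x > 1/2) \<and> (dec_on01 ?s \<longrightarrow> ?s x < 1/2))"
      using 1 2 by blast
  qed
  moreover have "d > 0" using b by (simp add: d_def)
  ultimately show ?thesis by blast
qed

text \<open>A minimum over the finitely many pairs of sides; the inserted \<open>1\<close> keeps it
  defined if there are none.\<close>

lemma all_split_ends: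
  obtains d where "d > 0"
    "\<And>T j T' j'. T \<in> TT \<Longrightarrow> j < n \<Longrightarrow> T' \<in> TT \<Longrightarrow> j' < n \<Longrightarrow> ed T j = ed T' j' \<Longrightarrow> splits_ends (transit T j T' j') d"
proof -
  let ?I = "{p \<in> (TT \<times> {..<n}) \<times> (TT \<times> {..<n}). ed (fst (fst p)) (snd (fst p)) = ed (fst (snd p)) (snd (snd p))}"
  let ?s = "\<lambda>p. transit (fst (fst p)) (snd (fst p)) (fst (snd p)) (snd (snd p))"
  have "\<forall>p\<in>?I. \<exists>d>0. splits_ends (?s p) d" by (intro ballI transit_splits_ends) auto
  from bchoice[OF this] obtain D where D: "\<forall>p\<in>?I. D p > 0 \<and> splits_ends (?s p) (D p)" ..
  have fin: "finite ?I" using finite_tiles by simp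
  define d where "d = Min (insert 1 (D ` ?I))"
  have d: "d > 0" unfolding d_def using fin D by (subst Min_gr_iff) auto
  have "splits_ends (transit T j T' j') d" if a: "T \<in> TT" "j < n" "T' \<in> TT" "j' < n" "ed T j = ed T' j'" for T j T' j'
  proof -
    have p: "((T, j), (T', j')) \<in> ?I" using a by simp
    have "splits_ends (transit T j T' j') (D ((T, j), (T', j')))" using bspec[OF D p] by simp
    moreover have "d \<le> D ((T, j), (T', j'))" unfolding d_def using fin p by (intro Min_le) auto
    ultimately show ?thesis by (rule splits_ends_mono)
  qed
  with d show ?thesis by (rule that)
qed

text \<open>For \<open>i = 0\<close> the real part may be negative, and \<open>kap\<close> wraps it
  to the last side. The boxes are compact and supply closed sets of the surface;
  \<open>corner_nbhd\<close> is open in the plane, so that removing it from the disc leaves a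
  compact set.\<close>

definition corner_box :: "real \<Rightarrow> nat \<Rightarrow> complex set" where
  "corner_box d i = kap n ` {z. \<bar>Re z - real i\<bar> \<le> d \<and> 0 \<le> Im z \<and> Im z \<le> 1}"

definition corner_nbhd :: "real \<Rightarrow> nat \<Rightarrow> complex set" where
  "corner_nbhd d i = kap n ` {z. \<bar>Re z - real i\<bar> < d \<and> \<bar>Im z\<bar> < 1}"

lemma corner_box_compact: "compact (corner_box d i)"
proof -
  have "{z. \<bar>Re z - real i\<bar> \<le> d \<and> 0 \<le> Im z \<and> Im z \<le> 1} = cbox (Complex (real i - d) 0) (Complex (real i + d) 1)"
    by (auto simp: in_cbox_complex_iff abs_le_iff)
  then show ?thesis unfolding corner_box_def
    by (auto intro!: compact_continuous_image continuous_intros)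
qed

lemma corner_box_cball: "corner_box d i \<subseteq> cball 0 1"
  unfolding corner_box_def using kap_in_cball[OF n0] by blast

lemma corner_nbhd_open: "d \<le> 1/2 \<Longrightarrow> open (corner_nbhd d i)"
proof -
  assume d: "d \<le> 1/2"
  have "{z. \<bar>Re z - real i\<bar> < d \<and> \<bar>Im z\<bar> < 1} = box (Complex (real i - d) (-1)) (Complex (real i + d) 1)"
    by (auto simp: in_box_complex_iff abs_less_iff)
  then have "open {z. \<bar>Re z - real i\<bar> < d \<and> \<bar>Im z\<bar> < 1}" using open_box by metis
  moreover have "inj_on (kap n) {z. \<bar>Re z - real i\<bar> < d \<and> \<bar>Im z\<bar> < 1}"
  proof (rule inj_onI)
    fix z w assume "z \<in> {z. \<bar>Re z - real i\<bar> < d \<and> \<bar>Im z\<bar> < 1}" "w \<in> {z. \<bar>Re z - real i\<bar> < d \<and> \<bar>Im z\<bar> < 1}"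
      and k: "kap n z = kap n w"
    then have "\<bar>Re z - Re w\<bar> < 1" using d by auto
    then show "z = w" using kap_inj_strip[OF k n0] n3 by linarith
  qed
  ultimately show ?thesis unfolding corner_nbhd_def
    by (intro invariance_of_domain continuous_on_kap continuous_on_id)
qed

lemma corner_nbhd_box: "corner_nbhd d i \<inter> cball 0 1 \<subseteq> corner_box d i"
  unfolding corner_nbhd_def corner_box_def using kap_in_cball[OF n0] by force

lemma corner_in_nbhd: "d > 0 \<Longrightarrow> corner n i \<in> corner_nbhd d i"
  unfolding corner_nbhd_def corner_kap by (intro imageI) simp

text \<open>A common point makes \<open>i - i'\<close> differ from a multiple of \<open>n\<close> by
  less than \<open>1\<close>, so the indices are congruent modulo \<open>n\<close>.\<close>

lemma corner_box_unique:
  assumes "w \<in> corner_box d i" "w \<in> corner_box d i'" "d < 1/2" "i < n" "i' < n"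
  shows "i = i'"
proof -
  obtain z z' where z: "w = kap n z" "\<bar>Re z - real i\<bar> \<le> d" "w = kap n z'" "\<bar>Re z' - real i'\<bar> \<le> d"
    using assms(1,2) unfolding corner_box_def by blast
  then obtain m :: int where m: "z = z' + of_int m * of_nat n" using kap_eq_iff[OF n0] by metis
  then have "Re z = Re z' + of_int m * real n" by simp
  then have "\<bar>real i - real i' - of_int m * real n\<bar> < 1" using z assms(3) by linarith
  then have "\<bar>of_int (int i - int i' - m * int n)\<bar> < (1::real)" by simp
  then have "int i - int i' = m * int n" by linarith
  then have "int i mod int n = int i' mod int n" by (metis mod_eq_dvd_iff dvd_triv_right)
  then show ?thesis using assms(4,5) by simp
qed

text \<open>Near corner \<open>i\<close> the boundary consists of the start of side \<open>i\<close>
  and the end of the preceding side. For \<open>i = 0\<close> the latter is side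
  \<open>n - 1\<close>, whose end carries the index \<open>n\<close>; there \<open>c n = c 0\<close>
  is used.\<close>

lemma corner_box_boundary:
  assumes T: "T \<in> TT" and w: "w \<in> corner_box d i" "i < n" "d < 1/2" "w \<in> sphere 0 1" "f T w \<noteq> cor T i"
    and c: "c n = c (0::nat)"
  obtains j x where "j < n" "0 < x" "x < 1" "f T w = par T j x"
    "(x \<le> d \<and> (c i :: bool) = c j) \<or> (1 - d \<le> x \<and> c i = c (Suc j))"
proof -
  obtain z where z: "w = kap n z" "\<bar>Re z - real i\<bar> \<le> d" using w unfolding corner_box_def by auto
  have "Im z = 0" using w(4) z(1) kap_in_sphere[OF n0] by metis
  then have zr: "z = of_real (Re z)" by (simp add: complex_eq_iff)
  have ne: "Re z \<noteq> real i"
  proof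
    assume "Re z = real i"
    then have "w = corner n i" using z(1) zr corner_kap by (metis of_real_of_nat_eq)
    then show False using w(5) by (simp add: cor_def)
  qed
  show ?thesis
  proof (cases "Re z > real i")
    case True
    have "f T w = par T i (Re z - real i)" unfolding par_def z(1) using zr by (simp add: of_real_diff)
    then show ?thesis using True z w(2,3) by (intro that[of i "Re z - real i"]) auto
  next
    case False
    then have lt: "Re z < real i" using ne by simp
    show ?thesis
    proof (cases "i = 0")
      case True
      have "of_nat (n - 1) + complex_of_real (Re z + 1) = z + of_nat n"
        using n0 zr by (simp add: of_nat_diff complex_eq_iff)
      then have "f T w = par T (n - 1) (Re z + 1)" unfolding par_def z(1) using kap_shift[OF n0, of z] by metis
      then show ?thesis using True lt z w(3) n0 c by (intro that[of "n - 1" "Re z + 1"]) auto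
    next
      case False
      then have "of_nat (i - 1) + complex_of_real (Re z - real i + 1) = z"
        using zr by (simp add: of_nat_diff complex_eq_iff)
      then have "f T w = par T (i - 1) (Re z - real i + 1)" unfolding par_def z(1) by metis
      then show ?thesis using False lt z w(2,3) by (intro that[of "i - 1" "Re z - real i + 1"]) auto
    qed
  qed
qed

text \<open>The property \<open>c\<close> of tile corners is passed on across every edge. Otherwise the corners with and
  without \<open>c\<close> would separate a punctured neighbourhood of the vertex into two closed sets.\<close>

theorem vertex_link:
  fixes c :: "'a set \<Rightarrow> nat \<Rightarrow> bool"
  assumes cn: "\<And>T. T \<in> TT \<Longrightarrow> c T n = c T 0"
    and compat: "\<And>T j T' j'. T \<in> TT \<Longrightarrow> j < n \<Longrightarrow> T' \<in> TT \<Longrightarrow> j' < n \<Longrightarrow> ed T j = ed T' j' \<Longrightarrow> (T, j) \<noteq> (T', j') \<Longrightarrow>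
       (inc_on01 (transit T j T' j') \<and> c T j = c T' j' \<and> c T (Suc j) = c T' (Suc j')) \<or>
       (dec_on01 (transit T j T' j') \<and> c T j = c T' (Suc j') \<and> c T (Suc j) = c T' j')"
    and T1: "T1 \<in> TT" "i1 < n" and T2: "T2 \<in> TT" "i2 < n" and v: "cor T1 i1 = cor T2 i2" and c1: "c T1 i1"
  shows "c T2 i2"
proof (rule ccontr)
  assume c2: "\<not> c T2 i2"
  define v where "v = cor T1 i1"
  have v2: "cor T2 i2 = v" using v by (simp add: v_def)
  obtain d0 where d0: "d0 > 0"
    "\<And>T j T' j'. T \<in> TT \<Longrightarrow> j < n \<Longrightarrow> T' \<in> TT \<Longrightarrow> j' < n \<Longrightarrow> ed T j = ed T' j' \<Longrightarrow> splits_ends (transit T j T' j') d0"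
    using all_split_ends by metis
  \<comment> \<open>Strictly below \<open>d0\<close> because the boxes are closed, and below
    \<open>1/2\<close> so that boxes of one polygon are disjoint and the two ends of a side are not
    confused.\<close>
  define d where "d = min (d0 / 2) (1/4)"
  have d: "d > 0" "d < d0" "d < 1/2" "d \<le> 1/2" using d0 by (auto simp: d_def)
  let ?K = "\<lambda>T. {i. i < n \<and> cor T i = v}"
  \<comment> \<open>A point of the surface outside this closed set has all its preimages in corner
    neighbourhoods at \<open>v\<close>.\<close>
  let ?F = "V - {v} \<union> (\<Union>T\<in>TT. f T ` (cball 0 1 - (\<Union>i\<in>?K T. corner_nbhd d i)))"
  have "closed ?F"
  proof (intro closed_Un closed_UN finite_tiles ballI)
    show "closed (V - {v})" using finite_V by (intro finite_imp_closed) simp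
    fix T assume T: "T \<in> TT"
    have "open (\<Union>i\<in>?K T. corner_nbhd d i)" using corner_nbhd_open[OF d(4)] by blast
    then show "closed (f T ` (cball 0 1 - (\<Union>i\<in>?K T. corner_nbhd d i)))"
      by (intro compact_imp_closed compact_continuous_image continuous_on_subset[OF f_cont[OF T]] compact_diff) auto
  qed
  then have op: "openin (top_of_set S) (S - ?F)" by (rule openin_diff_closed)
  have vV: "v \<in> V" unfolding v_def using cor_V T1 by simp
  have "v \<in> S - ?F"
  proof
    show "v \<in> S" using vV graph by (auto simp: embedded_graph_def)
    have "v \<notin> f T ` (cball 0 1 - (\<Union>i\<in>?K T. corner_nbhd d i))" if T: "T \<in> TT" for T
    proof
      assume "v \<in> f T ` (cball 0 1 - (\<Union>i\<in>?K T. corner_nbhd d i))"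
      then obtain w where w0: "v = f T w" "w \<in> cball 0 1 - (\<Union>i\<in>?K T. corner_nbhd d i)" by (rule imageE)
      then have w: "v = f T w" "w \<in> cball 0 1" "w \<notin> (\<Union>i\<in>?K T. corner_nbhd d i)" by simp_all
      have "f T w \<in> V" using vV w(1) by simp
      from f_vertex[OF T w(2) this] obtain k where k: "k < n" "w = corner n k" .
      then have "k \<in> ?K T" using w(1) by (simp add: cor_def)
      then show False using w(3) k(2) corner_in_nbhd[OF d(1)] by blast
    qed
    then show "v \<notin> ?F" by blast
  qed
  then obtain B where B: "openin (top_of_set S) B" "v \<in> B" "B \<subseteq> S - ?F" "connected (B - {v})"
    by (rule surface_punctured_disc[OF surf op])
  \<comment> \<open>Closed sets of points near \<open>v\<close> in corners with a given value of
    \<open>c\<close>. Together they cover the punctured disc and both meet it, so connectedness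
    fails if they are disjoint there.\<close>
  define A where "A b = (\<Union>T\<in>TT. \<Union>i\<in>{i. i < n \<and> cor T i = v \<and> c T i = b}. f T ` corner_box d i)" for b
  have Acl: "closed (A b)" for b unfolding A_def
    by (intro closed_UN finite_tiles ballI compact_imp_closed compact_continuous_image corner_box_compact
        continuous_on_subset[OF f_cont corner_box_cball]) auto
  have AI: "f T w \<in> A b" if "T \<in> TT" "i < n" "cor T i = v" "c T i = b" "w \<in> corner_box d i" for T w b i
    unfolding A_def by (rule UN_I[OF that(1)], rule UN_I[of i]) (use that in auto)
  have cov: "B - {v} \<subseteq> A True \<union> A False"
  proof
    fix y assume y: "y \<in> B - {v}"
    then have y': "y \<in> S" "y \<notin> ?F" using B(3) by auto
    then have "y \<notin> V" using y by simp
    with y'(1) obtain T w where w: "T \<in> TT" "w \<in> cball 0 1" "y = f T w" by (rule S_covered)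
    have "w \<in> (\<Union>i\<in>?K T. corner_nbhd d i)"
    proof (rule ccontr)
      assume "\<not> ?thesis"
      then have "y \<in> f T ` (cball 0 1 - (\<Union>i\<in>?K T. corner_nbhd d i))" using w(2,3) by simp
      then show False using y'(2) w(1) by blast
    qed
    then obtain i where i: "i < n" "cor T i = v" "w \<in> corner_nbhd d i" by blast
    then have "w \<in> corner_box d i" using corner_nbhd_box w(2) by blast
    then have "y \<in> A (c T i)" using AI[OF w(1) i(1,2) refl] w(3) by blast
    then show "y \<in> A True \<union> A False" by (cases "c T i") auto
  qed
  have ne: "A b \<inter> (B - {v}) \<noteq> {}" if T: "T \<in> TT" "i < n" "cor T i = v" "c T i = b" for b T i
  proof -
    have "f T (kap n (of_nat i)) \<in> B" using T(3) B(2) by (simp add: cor_def corner_kap)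
    then obtain y where y: "0 < y" "y < 1" "f T (kap n (of_nat i + \<i> * of_real y)) \<in> B"
      using push_into_tile[OF T(1) _ B(1), of "of_nat i"] by auto
    have "kap n (of_nat i + \<i> * of_real y) \<in> ball 0 1" using kap_push_ball[of "of_nat i"] y by simp
    then have "f T (kap n (of_nat i + \<i> * of_real y)) \<in> T" using f_in_tile T(1) by blast
    then have "f T (kap n (of_nat i + \<i> * of_real y)) \<noteq> v" using vV tile_facts(2)[OF T(1)] by blast
    moreover have "kap n (of_nat i + \<i> * of_real y) \<in> corner_box d i"
      unfolding corner_box_def using y d by (intro imageI) simp
    ultimately show ?thesis using AI[OF T] y(3) by blast
  qed
  \<comment> \<open>A common point lies on the boundary of both polygons, hence on one edge. On the
    same side its position near one end fixes \<open>c\<close>; on two different sides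
    \<open>compat\<close> and \<open>splits_ends\<close> match the ends and with them the values of
    \<open>c\<close>.\<close>
  have disj: "A True \<inter> A False \<inter> (B - {v}) = {}"
  proof (rule ccontr)
    assume "\<not> ?thesis"
    then obtain y where y: "y \<in> A True" "y \<in> A False" "y \<noteq> v" by blast
    obtain T i w where 1: "T \<in> TT" "i < n" "cor T i = v" "c T i" "w \<in> corner_box d i" "y = f T w"
      using y(1) unfolding A_def by blast
    obtain T' i' w' where 2: "T' \<in> TT" "i' < n" "cor T' i' = v" "\<not> c T' i'" "w' \<in> corner_box d i'" "y = f T' w'"
      using y(2) unfolding A_def by blast
    have wc: "w \<in> cball 0 1" "w' \<in> cball 0 1" using 1(5) 2(5) corner_box_cball by blast+
    have eq: "f T w = f T' w'" using 1(6) 2(6) by simp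
    have int: False if "T = T'" "w = w'"
    proof -
      have "i = i'" using corner_box_unique[OF 1(5) _ d(3) 1(2) 2(2)] 2(5) that by simp
      then show False using 1(4) 2(4) that by simp
    qed
    have "w \<notin> ball 0 1" using f_interior_unique[OF 1(1) 2(1) _ wc(2) eq] int by blast
    then have ws: "w \<in> sphere 0 1" using cball_cases[OF wc(1)] by blast
    have "w' \<notin> ball 0 1" using f_interior_unique[OF 2(1) 1(1) _ wc(1) eq[symmetric]] int by blast
    then have ws': "w' \<in> sphere 0 1" using cball_cases[OF wc(2)] by blast
    obtain j x where x: "j < n" "0 < x" "x < 1" "f T w = par T j x"
      "(x \<le> d \<and> c T i = c T j) \<or> (1 - d \<le> x \<and> c T i = c T (Suc j))"
      by (rule corner_box_boundary[OF 1(1,5,2) d(3) ws _ cn[OF 1(1)]]) (use 1 y in auto)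
    obtain j' x' where x': "j' < n" "0 < x'" "x' < 1" "f T' w' = par T' j' x'"
      "(x' \<le> d \<and> c T' i' = c T' j') \<or> (1 - d \<le> x' \<and> c T' i' = c T' (Suc j'))"
      by (rule corner_box_boundary[OF 2(1,5,2) d(3) ws' _ cn[OF 2(1)]]) (use 2 y in auto)
    have "y \<in> ed T j" unfolding par_ed[symmetric] using x 1(6) by auto
    moreover have "y \<in> ed T' j'" unfolding par_ed[symmetric] using x' 2(6) by auto
    ultimately have ee: "ed T j = ed T' j'" using edge_unique[OF ed_E[OF 1(1) x(1)] ed_E[OF 2(1) x'(1)]] by blast
    have pp: "par T j x = par T' j' x'" using x(4) x'(4) eq by simp
    show False
    proof (cases "(T, j) = (T', j')")
      case True
      then have "x = x'" using inj_onD[OF par_inj[OF 1(1) x(1)], of x x'] pp x x' by auto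
      then have "c T i = c T' i'" using x(5) x'(5) True d(3) by auto
      then show False using 1(4) 2(4) by simp
    next
      case False
      let ?s = "transit T j T' j'"
      note a = 1(1) x(1) 2(1) x'(1) ee
      have "par T' j' (?s x) = par T' j' x'" using transit_facts(3)[OF a, of x] x pp by auto
      moreover have "?s x \<in> {0<..<1}" using transit_facts(2)[OF a, of x] x by auto
      ultimately have sx: "?s x = x'" using inj_onD[OF par_inj[OF 2(1) x'(1)], of "?s x" x'] x' by auto
      have ne: "(x < d0 \<longrightarrow> (inc_on01 ?s \<longrightarrow> ?s x < 1/2) \<and> (dec_on01 ?s \<longrightarrow> ?s x > 1/2)) \<and>
        (x > 1 - d0 \<longrightarrow> (inc_on01 ?s \<longrightarrow> ?s x > 1/2) \<and> (dec_on01 ?s \<longrightarrow> ?s x < 1/2))"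
        using d0(2)[OF a] x(2,3) unfolding splits_ends_def by blast
      have 3: "x' < 1/2 \<Longrightarrow> c T' i' = c T' j'" "x' > 1/2 \<Longrightarrow> c T' i' = c T' (Suc j')"
        using x'(5) d(3) by linarith+
      have 4: "x < d0 \<and> c T i = c T j \<or> x > 1 - d0 \<and> c T i = c T (Suc j)" using x(5) d(2) by linarith
      have "c T i = c T' i'" using compat[OF a False] ne 3 4 unfolding sx by metis
      then show False using 1(4) 2(4) by simp
    qed
  qed
  have "A True \<inter> (B - {v}) \<noteq> {}" using ne[of T1 i1 True] T1 c1 by (simp add: v_def)
  moreover have "A False \<inter> (B - {v}) \<noteq> {}" using ne[of T2 i2 False] T2 c2 v2 by simp
  ultimately show False using B(4) Acl cov disj unfolding connected_closed by blast
qed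

text \<open>An increasing bijection of the open interval tends to \<open>0\<close> at
  \<open>0\<close>, so both parametrizations of the edge have the same limit there. Limits are taken
  because \<open>transit\<close> is uncontrolled at the end itself.\<close>

lemma inc_transit_corner:
  assumes a: "T \<in> TT" "j < n" "T' \<in> TT" "j' < n" "ed T j = ed T' j'" and i: "inc_on01 (transit T j T' j')"
  shows "cor T j = cor T' j'"
proof -
  let ?s = "transit T j T' j'"
  have s0: "(?s \<longlongrightarrow> 0) (at_right 0)"
  proof (rule order_tendstoI)
    fix y :: real assume "y < 0"
    have "eventually (\<lambda>x. x \<in> {0<..<1}) (at_right (0::real))" by (rule eventually_at_right_real) simp
    then show "eventually (\<lambda>x. y < ?s x) (at_right 0)"
    proof eventually_elim
      case (elim x)
      then show ?case using transit_facts(2)[OF a elim] \<open>y < 0\<close> by auto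
    qed
  next
    fix y :: real assume y: "0 < y"
    have "min y (1/2) \<in> ?s ` {0<..<1}" unfolding transit_facts(5)[OF a] using y by simp
    then obtain b where b: "?s b = min y (1/2)" "0 < b" "b < 1" by (metis imageE greaterThanLessThan_iff)
    have "eventually (\<lambda>x. x \<in> {0<..<b}) (at_right (0::real))" using b by (intro eventually_at_right_real)
    then show "eventually (\<lambda>x. ?s x < y) (at_right 0)"
    proof eventually_elim
      case (elim x)
      then have "0 < x" "x < b" by auto
      then have "?s x < ?s b" using i b unfolding inc_on01_def by blast
      then show ?case using b by simp
    qed
  qed
  have r: "eventually (\<lambda>x. x \<in> {0<..<1}) (at_right (0::real))" by (rule eventually_at_right_real) simp
  have lim0: "(par U k \<longlongrightarrow> par U k 0) (at 0 within {0..1})" if "U \<in> TT" for U k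
    using par_cont[OF that] unfolding continuous_on by simp
  have "filterlim ?s (at 0 within {0..1}) (at_right 0)"
    unfolding filterlim_at
  proof
    show "eventually (\<lambda>x. ?s x \<in> {0..1} \<and> ?s x \<noteq> 0) (at_right 0)"
      using r
    proof eventually_elim
      case (elim x) then show ?case using transit_facts(2)[OF a elim] by auto
    qed
  qed (rule s0)
  then have 1: "((\<lambda>x. par T' j' (?s x)) \<longlongrightarrow> par T' j' 0) (at_right 0)"
    by (rule filterlim_compose[OF lim0[OF a(3)]])
  have "filterlim (\<lambda>x. x) (at 0 within {0..1}) (at_right (0::real))"
    unfolding filterlim_at by (auto intro: eventually_mono[OF r] tendsto_ident_at)
  then have 2: "((\<lambda>x. par T j x) \<longlongrightarrow> par T j 0) (at_right 0)"
    by (rule filterlim_compose[OF lim0[OF a(1)]])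
  have "eventually (\<lambda>x. par T' j' (?s x) = par T j x) (at_right 0)"
    using r by eventually_elim (use transit_facts(3)[OF a] in auto)
  then have "((\<lambda>x. par T j x) \<longlongrightarrow> par T' j' 0) (at_right 0)" using 1 by (rule Lim_transform_eventually[rotated])
  then have "par T j 0 = par T' j' 0" using 2 by (intro tendsto_unique[of "at_right (0::real)"]) auto
  then show ?thesis by (simp add: par_0)
qed

text \<open>If two consecutive sides are folded onto the same edge, no other tile corner is linked to the
  folded one, so its vertex has degree \<open>1\<close>.\<close>

theorem no_fold:
  assumes T0: "T0 \<in> TT" "k < n" "k1 = Suc k mod n" and e: "ed T0 k = ed T0 k1" and ne: "cor T0 k \<noteq> cor T0 k1"
  shows "vertex_degree E (cor T0 k1) < 3"
proof -
  let ?e = "ed T0 k" and ?v = "cor T0 k1"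
  have k1: "k1 < n" "(k1 = Suc k \<and> Suc k < n) \<or> (k1 = 0 \<and> Suc k = n)"
    using T0 n3 by (auto simp: mod_Suc)
  have kk: "k \<noteq> k1" using k1 n3 by auto
  define c where "c T i \<longleftrightarrow> T = T0 \<and> (i = k1 \<or> k1 = 0 \<and> i = n)" for T i
  have eE: "?e \<in> E" using ed_E T0 by blast
  have so: "sides_of ?e = {(T0, k), (T0, k1)}"
    using sides_of_two[OF eE, of "(T0,k)" "(T0,k1)"] T0 k1 e kk by (auto simp: sides_of_def)
  have ck: "\<not> c T0 k" "c T0 (Suc k)" "c T0 k1" "\<not> c T0 (Suc k1)"
    using k1 kk T0(2) n3 by (auto simp: c_def)
  have key: "c T i" if "T \<in> TT" "i < n" "cor T i = ?v" for T i
  proof (rule vertex_link[of c T0 k1 T i])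
    show "c T n = c T 0" for T using k1 by (auto simp: c_def)
    fix T j T' j' assume a: "T \<in> TT" "j < n" "T' \<in> TT" "j' < n" "ed T j = ed T' j'" and d: "(T, j) \<noteq> (T', j')"
    have id: "inc_on01 (transit T j T' j') \<or> dec_on01 (transit T j T' j')" by (rule transit_inc_or_dec[OF a])
    show "(inc_on01 (transit T j T' j') \<and> c T j = c T' j' \<and> c T (Suc j) = c T' (Suc j')) \<or>
       (dec_on01 (transit T j T' j') \<and> c T j = c T' (Suc j') \<and> c T (Suc j) = c T' j')"
    proof (cases "ed T j = ?e")
      case True
      then have "(T, j) \<in> {(T0, k), (T0, k1)}" "(T', j') \<in> {(T0, k), (T0, k1)}"
        using a unfolding so[symmetric] by (auto simp: sides_of_def)
      then have "T = T0 \<and> T' = T0 \<and> (j = k \<and> j' = k1 \<or> j = k1 \<and> j' = k)" using d by auto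
      \<comment> \<open>An increasing change of parameter would identify \<open>cor T0 k\<close>
        with \<open>cor T0 k1\<close>, the starts of the two sides.\<close>
      moreover have "\<not> inc_on01 (transit T j T' j')"
        using inc_transit_corner[OF a] ne calculation by metis
      ultimately show ?thesis using id ck by metis
    next
      case False
      have "\<not> c U i \<and> \<not> c U (Suc i)" if "U \<in> TT" "i < n" "ed U i \<noteq> ?e" for U i
      proof -
        have "U = T0 \<Longrightarrow> i \<noteq> k \<and> i \<noteq> k1" using that e by metis
        then show ?thesis using that k1 by (auto simp: c_def)
      qed
      then show ?thesis using False a id by metis
    qed
  qed (use T0 k1 ck that in auto)
  have only: "e' = ?e" if e': "e' \<in> E" "edge_ends_at e' ?v \<noteq> 0" for e'
  proof -
    obtain T j where j: "T \<in> TT" "j < n" "ed T j = e'" using sides_of_nonempty[OF e'(1)] by blast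
    have "?v \<in> closure e' - e'" using e'(2) by (auto simp: edge_ends_at_def split: if_splits)
    then have "?v = cor T j \<or> ?v = cor T (Suc j)" using ed_closure[OF j(1,2)] j(3) by auto
    then show ?thesis
    proof
      assume "?v = cor T j"
      then have "c T j" using key j by simp
      then show ?thesis using j e by (auto simp: c_def)
    next
      assume v: "?v = cor T (Suc j)"
      have "T = T0 \<and> j = k"
      proof (cases "Suc j < n")
        case True
        then have "c T (Suc j)" using key v j by simp
        then show ?thesis using True k1 T0 by (auto simp: c_def)
      next
        case False
        then have "Suc j = n" using j by simp
        then have "c T 0" using key[of T 0] v j n0 by simp
        then show ?thesis using k1 \<open>Suc j = n\<close> n0 by (auto simp: c_def)
      qed
      then show ?thesis using j by simp
    qed
  qed
  \<comment> \<open>One edge remains at the folded vertex, and the crude bound of two ends per edge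
    is enough.\<close>
  have "vertex_degree E ?v = (\<Sum>e'\<in>E. if e' = ?e then edge_ends_at ?e ?v else 0)"
    unfolding vertex_degree_def by (intro sum.cong refl) (use only in auto)
  also have "\<dots> = edge_ends_at ?e ?v" using finite_E eE by (simp add: sum.delta)
  also have "\<dots> \<le> 2" by (simp add: edge_ends_at_def)
  finally show ?thesis by simp
qed

end

section \<open>Orientation\<close>

definition preserves_at :: "(complex \<Rightarrow> complex) \<Rightarrow> complex \<Rightarrow> bool" where
  "preserves_at \<tau> z \<longleftrightarrow> (\<forall>\<^sub>F r in at_right 0. winding_number (\<tau> \<circ> circlepath z r) (\<tau> z) = 1)"

text \<open>First the two circles are compared about \<open>w\<close>, where they have the same
  winding number; then the centre \<open>\<tau> w\<close> moves to \<open>\<tau> z\<close> inside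
  the image of the open disc, which avoids the curve. The factor \<open>3\<close> leaves room for a
  disc of radius \<open>2 * r\<close> about \<open>w\<close> that contains the circle about
  \<open>z\<close>.\<close>

lemma winding_number_circle_transfer:
  fixes \<tau> :: "complex \<Rightarrow> complex"
  assumes t: "continuous_on W \<tau>" "inj_on \<tau> W" and W: "cball z (3 * r) \<subseteq> W" and r: "r > 0"
    and w: "dist z w < r" and r': "0 < r'" "r' \<le> 2 * r"
  shows "winding_number (\<tau> \<circ> circlepath w r') (\<tau> w) = winding_number (\<tau> \<circ> circlepath z r) (\<tau> z)"
proof -
  have sub: "cball w (2 * r) \<subseteq> W"
  proof
    fix x assume "x \<in> cball w (2 * r)"
    then have "dist z x \<le> 3 * r" using dist_triangle[of z x w] w by simp
    then show "x \<in> W" using W by auto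
  qed
  have "winding_number (\<tau> \<circ> circlepath w r') (\<tau> w) = winding_number (\<tau> \<circ> circlepath z r) (\<tau> w)"
  proof (rule winding_number_injective_image[OF t sub])
    show "path_image (circlepath w r') \<subseteq> cball w (2 * r) - {w}" using r' by auto
    show "path_image (circlepath z r) \<subseteq> cball w (2 * r) - {w}"
    proof
      fix x assume "x \<in> path_image (circlepath z r)"
      then have x: "dist z x = r" using r by simp
      then have "dist w x \<le> 2 * r" using dist_triangle[of w x z] w by (simp add: dist_commute)
      moreover have "x \<noteq> w" using x w by auto
      ultimately show "x \<in> cball w (2 * r) - {w}" by simp
    qed
    show "winding_number (circlepath w r') w = winding_number (circlepath z r) w"
      using winding_number_circlepath[of w z r] winding_number_circlepath[of w w r'] w r'
      by (simp add: dist_norm norm_minus_commute)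
  qed (use r in auto)
  also have "\<dots> = winding_number (\<tau> \<circ> circlepath z r) (\<tau> z)"
  proof (rule winding_number_eq)
    have bW: "ball z r \<subseteq> W" and sW: "sphere z r \<subseteq> W" using W r by auto
    have pi: "path_image (\<tau> \<circ> circlepath z r) = \<tau> ` sphere z r" using r by (simp add: path_image_compose)
    show "path (\<tau> \<circ> circlepath z r)"
      using continuous_on_subset[OF t(1) sW] r by (intro path_continuous_image) auto
    show "pathfinish (\<tau> \<circ> circlepath z r) = pathstart (\<tau> \<circ> circlepath z r)"
      by (simp add: pathfinish_compose pathstart_compose)
    show "connected (\<tau> ` ball z r)"
      using continuous_on_subset[OF t(1) bW] by (intro connected_continuous_image) auto
    show "\<tau> w \<in> \<tau> ` ball z r" "\<tau> z \<in> \<tau> ` ball z r" using w r by auto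
    have "\<tau> ` ball z r \<inter> \<tau> ` sphere z r = \<tau> ` (ball z r \<inter> sphere z r)"
      using inj_on_image_Int[OF t(2) bW sW] by simp
    also have "ball z r \<inter> sphere z r = {}" by auto
    finally show "\<tau> ` ball z r \<inter> path_image (\<tau> \<circ> circlepath z r) = {}" unfolding pi by simp
  qed
  finally show ?thesis .
qed

text \<open>Replaces the eventual condition by one on a fixed circle, the same for all
  \<open>w\<close> near \<open>z\<close>; local constancy of the sign follows.\<close>

lemma preserves_at_iff:
  fixes \<tau> :: "complex \<Rightarrow> complex"
  assumes t: "continuous_on W \<tau>" "inj_on \<tau> W" and W: "cball z (3 * r) \<subseteq> W" and r: "r > 0" and w: "dist z w < r"
  shows "preserves_at \<tau> w \<longleftrightarrow> winding_number (\<tau> \<circ> circlepath z r) (\<tau> z) = 1"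
proof -
  have "\<forall>\<^sub>F r' in at_right 0. r' \<in> {0<..<2 * r}" using r by (intro eventually_at_right_real) simp
  then have "\<forall>\<^sub>F r' in at_right 0. winding_number (\<tau> \<circ> circlepath w r') (\<tau> w) = winding_number (\<tau> \<circ> circlepath z r) (\<tau> z)"
  proof eventually_elim
    case (elim r')
    then show ?case by (intro winding_number_circle_transfer[OF t W r w]) auto
  qed
  then have ev: "\<forall>\<^sub>F r' in at_right 0. (winding_number (\<tau> \<circ> circlepath w r') (\<tau> w) = 1) = (winding_number (\<tau> \<circ> circlepath z r) (\<tau> z) = 1)"
    by eventually_elim simp
  show ?thesis unfolding preserves_at_def eventually_subst[OF ev] by simp
qed

lemma open_contains_cball3:
  fixes z :: complex
  assumes "open W" "z \<in> W"
  obtains r where "r > 0" "cball z (3 * r) \<subseteq> W"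
proof -
  obtain e where "e > 0" "cball z e \<subseteq> W" using assms open_contains_cball by blast
  then show ?thesis using that[of "e / 3"] by simp
qed

lemma preserves_at_cong:
  assumes "open W" "z \<in> W" "\<And>x. x \<in> W \<Longrightarrow> \<tau> x = \<tau>' x"
  shows "preserves_at \<tau> z \<longleftrightarrow> preserves_at \<tau>' z"
proof -
  obtain r where r: "r > 0" "cball z (3 * r) \<subseteq> W" using open_contains_cball3 assms by blast
  have "\<forall>\<^sub>F r' in at_right 0. r' \<in> {0<..<r}" using r by (intro eventually_at_right_real) simp
  then have "\<forall>\<^sub>F r' in at_right 0. (winding_number (\<tau> \<circ> circlepath z r') (\<tau> z) = 1) = (winding_number (\<tau>' \<circ> circlepath z r') (\<tau>' z) = 1)"
  proof eventually_elim
    case (elim r')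
    have "circlepath z r' t \<in> W" for t
    proof -
      have "norm (exp (2 * of_real pi * \<i> * of_real t)) = 1" by (simp add: norm_exp_eq_Re)
      then have "dist z (circlepath z r' t) = r'" using elim by (simp add: circlepath dist_norm norm_mult)
      then show ?thesis using r elim by auto
    qed
    then have "\<tau> \<circ> circlepath z r' = \<tau>' \<circ> circlepath z r'" using assms(3) by auto
    then show ?case using assms by simp
  qed
  then show ?thesis unfolding preserves_at_def by (rule eventually_subst)
qed

text \<open>Local degrees are \<open>1\<close> or \<open>-1\<close> and multiply; on truth values
  the product of signs is an equivalence.\<close>

lemma preserves_at_compose:
  fixes \<tau> \<rho> :: "complex \<Rightarrow> complex"
  assumes p: "open W" "z \<in> W" "continuous_on W \<rho>" "inj_on \<rho> W"
    and t: "open W'" "\<rho> z \<in> W'" "continuous_on W' \<tau>" "inj_on \<tau> W'"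
  shows "preserves_at (\<tau> \<circ> \<rho>) z \<longleftrightarrow> (preserves_at \<tau> (\<rho> z) \<longleftrightarrow> preserves_at \<rho> z)"
proof -
  obtain R where R: "R > 0" "cball (\<rho> z) (3 * R) \<subseteq> W'" using open_contains_cball3 t by blast
  have "open (W \<inter> \<rho> -` ball (\<rho> z) R)" using p by (simp add: continuous_open_preimage)
  then obtain r where r: "r > 0" "cball z (3 * r) \<subseteq> W \<inter> \<rho> -` ball (\<rho> z) R"
    using open_contains_cball3[of "W \<inter> \<rho> -` ball (\<rho> z) R" z] p(2) R(1) by auto
  then have rW: "cball z (3 * r) \<subseteq> W" and rR: "\<rho> ` cball z (3 * r) \<subseteq> ball (\<rho> z) R" by auto
  have bW': "ball (\<rho> z) R \<subseteq> W'" using R by auto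
  have c: "continuous_on (cball z (3 * r)) (\<tau> \<circ> \<rho>)"
    by (intro continuous_on_compose continuous_on_subset[OF p(3) rW] continuous_on_subset[OF t(3)]) (use rR bW' in blast)
  have i: "inj_on (\<tau> \<circ> \<rho>) (cball z (3 * r))"
    by (rule comp_inj_on[OF inj_on_subset[OF p(4) rW] inj_on_subset[OF t(4)]]) (use rR bW' in blast)
  have 1: "preserves_at (\<tau> \<circ> \<rho>) z \<longleftrightarrow> winding_number (\<tau> \<circ> \<rho> \<circ> circlepath z r) ((\<tau> \<circ> \<rho>) z) = 1"
    using preserves_at_iff[OF c i order_refl r(1), of z] r(1) by simp
  have 2: "preserves_at \<rho> z \<longleftrightarrow> winding_number (\<rho> \<circ> circlepath z r) (\<rho> z) = 1"
    using preserves_at_iff[OF p(3,4) rW r(1), of z] r(1) by simp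
  have 3: "preserves_at \<tau> (\<rho> z) \<longleftrightarrow> winding_number (\<tau> \<circ> circlepath (\<rho> z) R) (\<tau> (\<rho> z)) = 1"
    using preserves_at_iff[OF t(3,4) R(2) R(1), of "\<rho> z"] R(1) by simp
  let ?g = "\<rho> \<circ> circlepath z r"
  have RW: "cball (\<rho> z) R \<subseteq> W'" using R by auto
  have d\<tau>: "winding_number (\<tau> \<circ> circlepath (\<rho> z) R) (\<tau> (\<rho> z)) \<in> {1, -1}"
    by (rule winding_number_injective_circle[OF t(3,4) RW R(1)])
  have rW1: "cball z r \<subseteq> W" using rW r(1) by auto
  have d\<rho>: "winding_number ?g (\<rho> z) \<in> {1, -1}"
    by (rule winding_number_injective_circle[OF p(3,4) rW1 r(1)])
  have sub: "path_image ?g \<subseteq> cball (\<rho> z) R - {\<rho> z}"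
  proof
    fix y assume "y \<in> path_image ?g"
    then obtain x where x: "y = \<rho> x" "dist z x = r" using r(1) by (auto simp: path_image_compose)
    then have xc: "x \<in> cball z (3 * r)" "x \<noteq> z" using r(1) by auto
    then have "\<rho> x \<in> ball (\<rho> z) R" using rR by blast
    moreover have "\<rho> x \<noteq> \<rho> z" using inj_onD[OF p(4), of x z] xc rW p(2) by blast
    ultimately show "y \<in> cball (\<rho> z) R - {\<rho> z}" using x(1) by auto
  qed
  have pg: "path ?g" "pathfinish ?g = pathstart ?g"
    using r(1) rW1 by (auto intro!: path_continuous_image continuous_on_subset[OF p(3)] simp: pathfinish_compose pathstart_compose)
  have "winding_number (\<tau> \<circ> \<rho> \<circ> circlepath z r) (\<tau> (\<rho> z)) =
      winding_number ?g (\<rho> z) * winding_number (\<tau> \<circ> circlepath (\<rho> z) R) (\<tau> (\<rho> z))"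
  \<comment> \<open>The inner curve is compared with a circle of the same winding number, which is
    the reversed circle if this is \<open>-1\<close>.\<close>
  proof (cases "winding_number ?g (\<rho> z) = 1")
    case True
    have "winding_number (\<tau> \<circ> ?g) (\<tau> (\<rho> z)) = winding_number (\<tau> \<circ> circlepath (\<rho> z) R) (\<tau> (\<rho> z))"
      by (rule winding_number_injective_image[OF t(3,4) RW R(1) pg sub])
         (use R(1) True winding_number_circlepath_centre in auto)
    then show ?thesis using True by (simp add: comp_assoc)
  next
    case False
    then have m1: "winding_number ?g (\<rho> z) = -1" using d\<rho> by auto
    let ?c = "circlepath (\<rho> z) R"
    have "winding_number (\<tau> \<circ> ?g) (\<tau> (\<rho> z)) = winding_number (\<tau> \<circ> reversepath ?c) (\<tau> (\<rho> z))"
    proof (rule winding_number_injective_image[OF t(3,4) RW R(1) pg sub])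
      show "winding_number ?g (\<rho> z) = winding_number (reversepath ?c) (\<rho> z)"
        using m1 R(1) winding_number_circlepath_centre by (subst winding_number_reversepath) auto
    qed (use R(1) in auto)
    also have "\<tau> \<circ> reversepath ?c = reversepath (\<tau> \<circ> ?c)" by (auto simp: reversepath_def)
    also have "winding_number (reversepath (\<tau> \<circ> ?c)) (\<tau> (\<rho> z)) = - winding_number (\<tau> \<circ> ?c) (\<tau> (\<rho> z))"
    proof (rule winding_number_reversepath)
      have sW: "sphere (\<rho> z) R \<subseteq> W'" using RW R(1) by auto
      show "path (\<tau> \<circ> ?c)" using continuous_on_subset[OF t(3) sW] R(1) by (intro path_continuous_image) auto
      show "\<tau> (\<rho> z) \<notin> path_image (\<tau> \<circ> ?c)"
      proof
        assume "\<tau> (\<rho> z) \<in> path_image (\<tau> \<circ> ?c)"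
        then obtain x where x: "x \<in> sphere (\<rho> z) R" "\<tau> (\<rho> z) = \<tau> x" using R(1) by (auto simp: path_image_compose)
        then have "\<rho> z = x" using inj_onD[OF t(4), of "\<rho> z" x] t(2) sW by blast
        then show False using x R(1) by simp
      qed
    qed
    finally have fin: "winding_number (\<tau> \<circ> ?g) (\<tau> (\<rho> z)) = - winding_number (\<tau> \<circ> ?c) (\<tau> (\<rho> z))" .
    show ?thesis by (simp only: comp_assoc m1 fin mult_minus_left mult_1_left)
  qed
  then show ?thesis unfolding 1 2 3 using d\<tau> d\<rho> by auto
qed

lemma preserves_at_translation: "preserves_at (\<lambda>z. c + z) z"
proof -
  have "\<forall>\<^sub>F r in at_right 0. r \<in> {0<..<(1::real)}" by (intro eventually_at_right_real) simp
  then show ?thesis unfolding preserves_at_def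
  proof eventually_elim
    case (elim r)
    have "(\<lambda>z. c + z) \<circ> circlepath z r = circlepath (c + z) r" by (auto simp: circlepath)
    then show ?case using elim winding_number_circlepath_centre[of r "c + z"] by simp
  qed
qed

text \<open>A circle of negative radius is the usual circle started at the opposite point, a shift
  by half the parameter interval.\<close>

lemma winding_number_circlepath_minus:
  assumes "r > 0"
  shows "winding_number (circlepath z (-r)) z = 1"
proof -
  have "circlepath z (-r) = shiftpath (1/2) (circlepath z r)"
  proof
    fix x
    have "circlepath z r (x + 1/2) = circlepath z r (x + 1/2 - 1)"
      using circlepath_add_half[of z r x] by (simp add: algebra_simps)
    then show "circlepath z (-r) x = shiftpath (1/2) (circlepath z r) x"
      unfolding circlepath_minus shiftpath_def by (simp add: add.commute)
  qed
  moreover have "winding_number (shiftpath (1/2) (circlepath z r)) z = winding_number (circlepath z r) z"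
    using assms by (intro winding_number_shiftpath) auto
  ultimately show ?thesis using winding_number_circlepath_centre[OF assms] by simp
qed

text \<open>The coordinate in which \<open>glue\<close> reads the lower half of its strip, separated
  out in order to compute its local degree.\<close>

definition reflect_strip :: "complex \<Rightarrow> (real \<Rightarrow> real) \<Rightarrow> complex \<Rightarrow> complex" where
  "reflect_strip c s z = c + of_real (s (Re z)) - \<i> * of_real (Im z)"

lemma reflect_strip_inj: "inj_on s {0<..<1} \<Longrightarrow> inj_on (reflect_strip c s) open_strip"
proof (rule inj_onI)
  fix z w assume i: "inj_on s {0<..<1}" and z: "z \<in> open_strip" "w \<in> open_strip"
    and e: "reflect_strip c s z = reflect_strip c s w"
  have "s (Re z) = s (Re w)" "Im z = Im w" using e by (auto simp: reflect_strip_def complex_eq_iff)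
  then show "z = w" using inj_onD[OF i, of "Re z" "Re w"] z by (simp add: complex_eq_iff open_strip_def)
qed

text \<open>The reflection contributes a factor \<open>-1\<close>, and \<open>s\<close> another one
  exactly if it decreases. As \<open>s\<close> may lack a derivative, the image of a small circle is
  deformed along straight segments into its image \<open>q\<close> under an affine model with slope
  \<open>\<epsilon>\<close>.\<close>

lemma preserves_at_reflect_strip:
  assumes c: "continuous_on {0<..<1} s" and s: "inc_on01 s \<or> dec_on01 s" and "z \<in> open_strip"
  shows "preserves_at (reflect_strip c s) z \<longleftrightarrow> dec_on01 s"
proof -
  have z: "z \<in> {z. 0 < Re z \<and> Re z < 1}" using assms(3) by (simp add: open_strip_def)
  let ?\<rho> = "reflect_strip c s"
  define d where "d = min (Re z) (1 - Re z)"
  have "d > 0" using z by (simp add: d_def)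
  have key: "winding_number (?\<rho> \<circ> circlepath z r) (?\<rho> z) = (if dec_on01 s then 1 else -1)" if r: "0 < r" "r < d" for r
  proof -
    define \<epsilon> :: real where "\<epsilon> = (if dec_on01 s then -1 else 1)"
    have eps: "\<epsilon> = 1 \<or> \<epsilon> = -1" "\<epsilon> = -1 \<longleftrightarrow> dec_on01 s" by (auto simp: \<epsilon>_def)
    define q where "q t = ?\<rho> z + of_real (\<epsilon> * Re (circlepath z r t - z)) - \<i> * of_real (Im (circlepath z r t - z))" for t
    have cstrip: "circlepath z r t \<in> {z. 0 < Re z \<and> Re z < 1}" and nz: "circlepath z r t \<noteq> z" for t
    proof -
      have "norm (exp (2 * of_real pi * \<i> * of_real t)) = 1" by (simp add: norm_exp_eq_Re)
      then have n: "norm (circlepath z r t - z) = r" using r by (simp add: circlepath norm_mult)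
      then have "\<bar>Re (circlepath z r t) - Re z\<bar> \<le> r" using abs_Re_le_cmod[of "circlepath z r t - z"] by simp
      then show "circlepath z r t \<in> {z. 0 < Re z \<and> Re z < 1}" using r by (auto simp: d_def)
      show "circlepath z r t \<noteq> z" using n r by auto
    qed
    have cc: "continuous_on A (circlepath z r)" for A
      unfolding circlepath by (intro continuous_intros)
    have cont: "continuous_on {0..1} (?\<rho> \<circ> circlepath z r)"
      unfolding comp_def reflect_strip_def
      by (intro continuous_intros continuous_on_compose2[OF c] cc) (use cstrip in auto)
    have seg: "closed_segment ((?\<rho> \<circ> circlepath z r) t) (q t) \<subseteq> -{?\<rho> z}" for t
    proof
      fix y assume y: "y \<in> closed_segment ((?\<rho> \<circ> circlepath z r) t) (q t)"
      let ?x = "circlepath z r t"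
      define a b D where "a = Re (?x - z)" and "b = Im (?x - z)" and "D = s (Re ?x) - s (Re z)"
      obtain u where u: "0 \<le> u" "u \<le> 1" "y = (1 - u) *\<^sub>R (?\<rho> \<circ> circlepath z r) t + u *\<^sub>R q t"
        using y by (auto simp: in_segment)
      have "y - ?\<rho> z = of_real ((1 - u) * D + u * (\<epsilon> * a)) - \<i> * of_real b"
        unfolding u(3) q_def reflect_strip_def a_def b_def D_def comp_def
        by (simp add: complex_eq_iff algebra_simps)
      moreover have "(1 - u) * D + u * (\<epsilon> * a) \<noteq> 0 \<or> b \<noteq> 0"
      proof (cases "b = 0")
        case True
        have "a \<noteq> 0" using nz[of t] True by (auto simp: a_def b_def complex_eq_iff)
        have x: "0 < Re ?x" "Re ?x < 1" "0 < Re z" "Re z < 1" using cstrip[of t] z by auto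
        \<comment> \<open>Only points level with the centre are critical; there \<open>D\<close> and
          \<open>\<epsilon> * a\<close> have the same sign by monotonicity, so the segment misses
          the centre.\<close>
        have sg: "a > 0 \<and> \<epsilon> * D > 0 \<or> a < 0 \<and> \<epsilon> * D < 0"
        proof (cases "a > 0")
          case True
          then have "Re z < Re ?x" by (simp add: a_def)
          then have "\<epsilon> * D > 0" using s eps x not_inc_and_dec[of s] unfolding D_def inc_on01_def dec_on01_def by (elim disjE) auto
          then show ?thesis using True by simp
        next
          case False
          then have "a < 0" using \<open>a \<noteq> 0\<close> by simp
          then have "Re ?x < Re z" by (simp add: a_def)
          then have "\<epsilon> * D < 0" using s eps x not_inc_and_dec[of s] unfolding D_def inc_on01_def dec_on01_def by (elim disjE) auto
          then show ?thesis using \<open>a < 0\<close> by simp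
        qed
        have "\<epsilon> * ((1 - u) * D + u * (\<epsilon> * a)) = (1 - u) * (\<epsilon> * D) + u * a"
          using eps(1) by (auto simp: algebra_simps)
        moreover have "(1 - u) * (\<epsilon> * D) + u * a \<noteq> 0"
        proof (cases "a > 0")
          case True
          then have p: "\<epsilon> * D > 0" using sg by auto
          show ?thesis
          proof (cases "u = 1")
            case False
            then have "(1 - u) * (\<epsilon> * D) > 0" "u * a \<ge> 0" using p u True by auto
            then show ?thesis by linarith
          qed (use True in simp)
        next
          case False
          then have p: "\<epsilon> * D < 0" "a < 0" using sg by auto
          show ?thesis
          proof (cases "u = 1")
            case False
            then have "(1 - u) * (\<epsilon> * D) < 0" "u * a \<le> 0" using p u by (auto simp: mult_pos_neg mult_nonneg_nonpos)
            then show ?thesis by linarith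
          qed (use p in simp)
        qed
        ultimately have "(1 - u) * D + u * (\<epsilon> * a) \<noteq> 0" by auto
        then show ?thesis by simp
      qed simp
      ultimately have "y - ?\<rho> z \<noteq> 0" by (auto simp: complex_eq_iff)
      then show "y \<in> -{?\<rho> z}" by simp
    qed
    have cq: "continuous_on {0..1} q" unfolding q_def
      by (intro continuous_intros cc)
    have loop: "circlepath z r 0 = circlepath z r 1" using pathstart_circlepath pathfinish_circlepath
      by (metis pathstart_def pathfinish_def)
    have "homotopic_loops (-{?\<rho> z}) (?\<rho> \<circ> circlepath z r) q"
      by (rule homotopic_loops_linear) (use cont cq seg loop in \<open>auto simp: path_def pathstart_def pathfinish_def q_def\<close>)
    then have w: "winding_number (?\<rho> \<circ> circlepath z r) (?\<rho> z) = winding_number q (?\<rho> z)"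
      by (rule winding_number_homotopic_loops)
    show ?thesis
    proof (cases "dec_on01 s")
      case True
      \<comment> \<open>For \<open>\<epsilon> = -1\<close> the model is a half turn, giving the
        radius \<open>-r\<close>; for \<open>\<epsilon> = 1\<close> it is a complex conjugation,
        which reverses the circle.\<close>
      then have "q = circlepath (?\<rho> z) (-r)"
        using eps by (auto simp: q_def circlepath complex_eq_iff)
      then show ?thesis using w True winding_number_circlepath_minus[OF r(1)] by simp
    next
      case False
      then have e1: "\<epsilon> = 1" using eps by auto
      have qc: "q = reversepath (circlepath (?\<rho> z) r)"
      proof
        fix t
        have "exp (2 * of_real pi * \<i> * of_real (1 - t)) = exp (- (2 * of_real pi * \<i> * of_real t)) * exp (2 * of_real pi * \<i>)"
        proof -
          have "2 * of_real pi * \<i> * of_real (1 - t) = - (2 * of_real pi * \<i> * of_real t) + 2 * complex_of_real pi * \<i>"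
            by (simp add: algebra_simps)
          then show ?thesis by (simp only: exp_add)
        qed
        also have "\<dots> = exp (- (2 * of_real pi * \<i> * of_real t))" by (simp add: exp_two_pi_i')
        also have "\<dots> = cnj (exp (2 * of_real pi * \<i> * of_real t))" by (simp add: exp_cnj)
        finally show "q t = reversepath (circlepath (?\<rho> z) r) t"
          unfolding q_def reversepath_def circlepath e1 by (simp add: complex_eq_iff)
      qed
      show ?thesis unfolding w qc using r(1) False
        by (subst winding_number_reversepath) (auto simp: winding_number_circlepath_centre)
    qed
  qed
  have "\<forall>\<^sub>F r in at_right 0. r \<in> {0<..<d}" using \<open>d > 0\<close> by (intro eventually_at_right_real)
  then have ev: "\<forall>\<^sub>F r in at_right 0. (winding_number (?\<rho> \<circ> circlepath z r) (?\<rho> z) = 1) = dec_on01 s"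
    by eventually_elim (simp add: key)
  show ?thesis unfolding preserves_at_def eventually_subst[OF ev] by simp
qed

definition oriented_atlas :: "'a::t2_space set \<Rightarrow> ('a set \<times> ('a \<Rightarrow> complex)) set \<Rightarrow> bool" where
  "oriented_atlas S A \<longleftrightarrow> (\<forall>(U,\<phi>)\<in>A. surface_chart S U \<phi>) \<and> (\<Union>(U,\<phi>)\<in>A. U) = S \<and>
        (\<forall>(U,\<phi>)\<in>A. \<forall>(U',\<phi>')\<in>A. orientation_preserving_on (\<phi> ` (U \<inter> U')) (\<phi>' \<circ> inv_into U \<phi>))"

text \<open>\<open>G\<close> stands for a local parametrization of the surface by the plane. One
  chart is asked for; \<open>positive_at_chart\<close> shows that all charts of an oriented atlas
  agree.\<close>

definition positive_at :: "('a::t2_space set \<times> ('a \<Rightarrow> complex)) set \<Rightarrow> (complex \<Rightarrow> 'a) \<Rightarrow> complex \<Rightarrow> bool" where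
  "positive_at A G z \<longleftrightarrow> (\<exists>U \<phi>. (U, \<phi>) \<in> A \<and> G z \<in> U \<and> preserves_at (\<phi> \<circ> G) z)"

lemma oriented_atlas_chart:
  assumes "oriented_atlas S A" "(U, \<phi>) \<in> A"
  shows "openin (top_of_set S) U" "open (\<phi> ` U)" "continuous_on U \<phi>" "inj_on \<phi> U" "continuous_on (\<phi> ` U) (inv_into U \<phi>)"
proof -
  have "surface_chart S U \<phi>" using assms unfolding oriented_atlas_def by blast
  then obtain \<psi> where o: "openin (top_of_set S) U" "open (\<phi> ` U)" and h: "homeomorphism U (\<phi> ` U) \<phi> \<psi>"
    unfolding surface_chart_def by blast
  show "openin (top_of_set S) U" "open (\<phi> ` U)" by (rule o)+
  show "continuous_on U \<phi>" using h by (rule homeomorphism_cont1)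
  show i: "inj_on \<phi> U" using homeomorphism_apply1[OF h] by (rule inj_on_inverseI)
  show "continuous_on (\<phi> ` U) (inv_into U \<phi>)"
  proof (rule continuous_on_eq[OF homeomorphism_cont2[OF h]])
    fix x assume "x \<in> \<phi> ` U"
    then obtain u where "u \<in> U" "x = \<phi> u" by blast
    then show "\<psi> x = inv_into U \<phi> x" using i homeomorphism_apply1[OF h] by simp
  qed
qed

lemma chart_compose:
  assumes A: "oriented_atlas S A" "(U, \<phi>) \<in> A"
    and G: "open W" "continuous_on W G" "inj_on G W" "G ` W \<subseteq> S"
  shows "open (W \<inter> G -` U)" "continuous_on (W \<inter> G -` U) (\<phi> \<circ> G)" "inj_on (\<phi> \<circ> G) (W \<inter> G -` U)"
proof -
  note c = oriented_atlas_chart[OF A]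
  have "openin (top_of_set W) (W \<inter> G -` U)"
    using c(1) G(2,4) by (metis continuous_openin_preimage image_subset_iff_funcset)
  then show "open (W \<inter> G -` U)" using G(1) openin_open_trans by blast
  show "continuous_on (W \<inter> G -` U) (\<phi> \<circ> G)"
    by (intro continuous_on_compose continuous_on_subset[OF G(2)] continuous_on_subset[OF c(3)]) auto
  show "inj_on (\<phi> \<circ> G) (W \<inter> G -` U)"
    by (intro comp_inj_on inj_on_subset[OF G(3)] inj_on_subset[OF c(4)]) auto
qed

text \<open>A change between charts of the atlas has local degree \<open>1\<close>, so by
  \<open>preserves_at_compose\<close> it does not alter the sign.\<close>

lemma positive_at_chart:
  assumes A: "oriented_atlas S A" and G: "open W" "z \<in> W" "continuous_on W G" "inj_on G W" "G ` W \<subseteq> S"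
    and U: "(U, \<phi>) \<in> A" "G z \<in> U"
  shows "positive_at A G z \<longleftrightarrow> preserves_at (\<phi> \<circ> G) z"
proof -
  have "preserves_at (\<phi> \<circ> G) z" if "(U', \<phi>') \<in> A" "G z \<in> U'" "preserves_at (\<phi>' \<circ> G) z" for U' \<phi>'
  proof -
    note c = oriented_atlas_chart[OF A U(1)] and c' = oriented_atlas_chart[OF A that(1)]
    let ?\<tau> = "\<phi> \<circ> inv_into U' \<phi>'"
    let ?D = "\<phi>' ` U' \<inter> inv_into U' \<phi>' -` U"
    have io: "inv_into U' \<phi>' ` \<phi>' ` U' = U'" by (rule inv_into_image_cancel[OF c'(4) order_refl])
    have "openin (top_of_set U') (U' \<inter> U)"
      using c(1) c'(1) by (meson inf_le1 openin_Int openin_imp_subset openin_subset_trans)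
    then have "openin (top_of_set (\<phi>' ` U')) (\<phi>' ` U' \<inter> inv_into U' \<phi>' -` (U' \<inter> U))"
      using c'(5) io by (metis continuous_openin_preimage image_subset_iff_funcset order_refl)
    moreover have "\<phi>' ` U' \<inter> inv_into U' \<phi>' -` (U' \<inter> U) = ?D" using io by blast
    ultimately have oD: "open ?D" using c'(2) openin_open_trans by metis
    have cD: "continuous_on ?D ?\<tau>"
      by (intro continuous_on_compose continuous_on_subset[OF c'(5)] continuous_on_subset[OF c(3)]) auto
    have iD: "inj_on ?\<tau> ?D"
      by (intro comp_inj_on inj_on_subset[OF inj_on_inv_into] inj_on_subset[OF c(4)]) auto
    note g' = chart_compose[OF A that(1) G(1,3,4,5)]
    have zW: "z \<in> W \<inter> G -` U'" using G that by simp
    have inv: "inv_into U' \<phi>' (\<phi>' (G x)) = G x" if "G x \<in> U'" for x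
      using c'(4) that by simp
    have zD: "(\<phi>' \<circ> G) z \<in> ?D" using that U inv by auto
    have "orientation_preserving_on (\<phi>' ` (U' \<inter> U)) ?\<tau>"
      using A that(1) U(1) unfolding oriented_atlas_def by blast
    moreover have "(\<phi>' \<circ> G) z \<in> \<phi>' ` (U' \<inter> U)" using that U by auto
    ultimately have pt: "preserves_at ?\<tau> ((\<phi>' \<circ> G) z)"
      unfolding orientation_preserving_on_def preserves_at_def by blast
    have "preserves_at (?\<tau> \<circ> (\<phi>' \<circ> G)) z"
      unfolding preserves_at_compose[OF g'(1) zW g'(2,3) oD zD cD iD] using pt that(3) by (simp only:)
    moreover have "preserves_at (?\<tau> \<circ> (\<phi>' \<circ> G)) z \<longleftrightarrow> preserves_at (\<phi> \<circ> G) z"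
      by (rule preserves_at_cong[OF g'(1) zW]) (use inv in auto)
    ultimately show ?thesis by simp
  qed
  then show ?thesis unfolding positive_at_def using U by blast
qed

lemma oriented_atlas_cover:
  assumes "oriented_atlas S A" "x \<in> S"
  obtains U \<phi> where "(U, \<phi>) \<in> A" "x \<in> U"
  using assms unfolding oriented_atlas_def by blast

lemma positive_at_compose:
  assumes A: "oriented_atlas S A" and G: "open W" "\<rho> z \<in> W" "continuous_on W G" "inj_on G W" "G ` W \<subseteq> S"
    and p: "open W0" "z \<in> W0" "continuous_on W0 \<rho>" "inj_on \<rho> W0"
  shows "positive_at A (G \<circ> \<rho>) z \<longleftrightarrow> (positive_at A G (\<rho> z) \<longleftrightarrow> preserves_at \<rho> z)"
proof -
  have "G (\<rho> z) \<in> S" using G by blast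
  then obtain U \<phi> where U: "(U, \<phi>) \<in> A" "G (\<rho> z) \<in> U" by (rule oriented_atlas_cover[OF A])
  let ?W = "W0 \<inter> \<rho> -` W"
  have oW: "open ?W" using p G(1) by (simp add: continuous_open_preimage)
  have c: "continuous_on ?W (G \<circ> \<rho>)"
    by (intro continuous_on_compose continuous_on_subset[OF p(3)] continuous_on_subset[OF G(3)]) auto
  have i: "inj_on (G \<circ> \<rho>) ?W"
    by (intro comp_inj_on inj_on_subset[OF p(4)] inj_on_subset[OF G(4)]) auto
  have im: "(G \<circ> \<rho>) ` ?W \<subseteq> S" using G(5) by auto
  have "positive_at A (G \<circ> \<rho>) z \<longleftrightarrow> preserves_at (\<phi> \<circ> (G \<circ> \<rho>)) z"
    using positive_at_chart[OF A oW _ c i im U(1), of z] p G(2) U(2) by simp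
  also have "\<dots> \<longleftrightarrow> preserves_at ((\<phi> \<circ> G) \<circ> \<rho>) z" by (simp add: comp_assoc)
  also have "\<dots> \<longleftrightarrow> (preserves_at (\<phi> \<circ> G) (\<rho> z) \<longleftrightarrow> preserves_at \<rho> z)"
    using preserves_at_compose[OF p chart_compose(1)[OF A U(1) G(1,3,4,5)] _ chart_compose(2,3)[OF A U(1) G(1,3,4,5)]] U(2) G(2) by simp
  also have "preserves_at (\<phi> \<circ> G) (\<rho> z) \<longleftrightarrow> positive_at A G (\<rho> z)"
    using positive_at_chart[OF A G U] by simp
  finally show ?thesis .
qed

lemma positive_at_cong:
  assumes "open W" "z \<in> W" "\<And>x. x \<in> W \<Longrightarrow> G x = G' x"
  shows "positive_at A G z \<longleftrightarrow> positive_at A G' z"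
proof -
  have "preserves_at (\<phi> \<circ> G) z \<longleftrightarrow> preserves_at (\<phi> \<circ> G') z" for \<phi> :: "'a \<Rightarrow> complex"
    by (rule preserves_at_cong[OF assms(1,2)]) (use assms(3) in simp)
  then show ?thesis unfolding positive_at_def using assms by simp
qed

lemma positive_at_locally_constant:
  assumes A: "oriented_atlas S A" and G: "open W" "z \<in> W" "continuous_on W G" "inj_on G W" "G ` W \<subseteq> S"
  shows "\<forall>\<^sub>F w in nhds z. positive_at A G w = positive_at A G z"
proof -
  have "G z \<in> S" using G by blast
  then obtain U \<phi> where U: "(U, \<phi>) \<in> A" "G z \<in> U" by (rule oriented_atlas_cover[OF A])
  note c = chart_compose[OF A U(1) G(1,3,4,5)]
  have "z \<in> W \<inter> G -` U" using G U by simp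
  then obtain r where r: "r > 0" "cball z (3 * r) \<subseteq> W \<inter> G -` U" by (rule open_contains_cball3[OF c(1)])
  have *: "positive_at A G w = positive_at A G z" if w: "w \<in> ball z r" for w
  proof -
    have "w \<in> cball z (3 * r)" using r(1) w by simp
    then have wW: "w \<in> W" "G w \<in> U" using r(2) by auto
    have "preserves_at (\<phi> \<circ> G) w = preserves_at (\<phi> \<circ> G) z"
      using preserves_at_iff[OF c(2,3) r(2,1), of w] preserves_at_iff[OF c(2,3) r(2,1), of z] w r(1) by simp
    then show ?thesis
      using positive_at_chart[OF A G U] positive_at_chart[OF A G(1) wW(1) G(3,4,5) U(1) wW(2)] by simp
  qed
  show ?thesis unfolding eventually_nhds by (intro exI[of _ "ball z r"] conjI ballI *; use r(1) in simp)
qed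

text \<open>\<open>G\<close> has to be injective only locally, which matters for tiles because
  \<open>kap n\<close> covers the punctured disc infinitely often.\<close>

lemma positive_at_constant:
  assumes A: "oriented_atlas S A" and C: "connected C" "z \<in> C" "w \<in> C"
    and G: "\<And>x. x \<in> C \<Longrightarrow> \<exists>W. open W \<and> x \<in> W \<and> continuous_on W G \<and> inj_on G W \<and> G ` W \<subseteq> S"
  shows "positive_at A G z = positive_at A G w"
proof (rule connected_local_const[OF C])
  show "\<forall>a\<in>C. \<forall>\<^sub>F b in at a within C. positive_at A G a = positive_at A G b"
  proof
    fix a assume "a \<in> C"
    then obtain W where "open W" "a \<in> W" "continuous_on W G" "inj_on G W" "G ` W \<subseteq> S" using G by blast
    then have "\<forall>\<^sub>F b in nhds a. positive_at A G b = positive_at A G a" by (rule positive_at_locally_constant[OF A])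
    then have "\<forall>\<^sub>F b in at a within C. positive_at A G b = positive_at A G a"
      unfolding eventually_at_filter by eventually_elim simp
    then show "\<forall>\<^sub>F b in at a within C. positive_at A G a = positive_at A G b"
      by eventually_elim simp
  qed
qed

context ptiling begin

text \<open>Every interior point would do in place of the image of \<open>\<i>\<close>, because a tile is connected.\<close>

definition tile_sign :: "('a set \<times> ('a \<Rightarrow> complex)) set \<Rightarrow> 'a set \<Rightarrow> bool" where
  "tile_sign A T = positive_at A (\<lambda>z. f T (kap n z)) \<i>"

lemma upper_local:
  assumes "T \<in> TT" "Im w > 0"
  shows "\<exists>W. open W \<and> w \<in> W \<and> continuous_on W (\<lambda>z. f T (kap n z)) \<and> inj_on (\<lambda>z. f T (kap n z)) W \<and> (\<lambda>z. f T (kap n z)) ` W \<subseteq> S"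
proof (intro exI conjI)
  let ?W = "{z. Im z > 0} \<inter> ({z. Re z > Re w - 1} \<inter> {z. Re z < Re w + 1})"
  show "open ?W" by (intro open_Int open_halfspace_Re_gt open_halfspace_Re_lt open_halfspace_Im_gt)
  show "w \<in> ?W" using assms by simp
  have b: "kap n z \<in> ball 0 1" if "z \<in> ?W" for z using that kap_in_ball[OF n0] by simp
  show "continuous_on ?W (\<lambda>z. f T (kap n z))"
  proof (rule continuous_on_compose2[OF f_cont[OF assms(1)]])
    show "kap n ` ?W \<subseteq> cball 0 1" using b ball_subset_cball by blast
  qed (intro continuous_intros)
  show "inj_on (\<lambda>z. f T (kap n z)) ?W"
  proof (rule inj_onI)
    fix x y assume xy: "x \<in> ?W" "y \<in> ?W" "f T (kap n x) = f T (kap n y)"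
    then have "kap n x = kap n y" using inj_onD[OF f_ball(2)[OF assms(1)]] b by blast
    then show "x = y" by (rule kap_inj_strip[OF _ n0]) (use xy n3 in auto)
  qed
  show "(\<lambda>z. f T (kap n z)) ` ?W \<subseteq> S"
    using b f_in_tile[OF assms(1)] tile_facts(1)[OF assms(1)] by blast
qed

lemma tile_sign_eq:
  assumes A: "oriented_atlas S A" and "T \<in> TT" "Im w > 0"
  shows "positive_at A (\<lambda>z. f T (kap n z)) w = tile_sign A T"
  unfolding tile_sign_def
proof (rule positive_at_constant[OF A])
  show "connected {z. Im z > 0}" by (intro convex_connected convex_halfspace_Im_gt)
qed (use assms upper_local in auto)

text \<open>The two boundary orientations agree along the edge iff the change of parameter is increasing, and
  tiles of the same sign traverse a common edge in opposite directions.\<close>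

theorem tile_sign_transit:
  assumes A: "oriented_atlas S A"
    and a: "T \<in> TT" "j < n" "T' \<in> TT" "j' < n" "ed T j = ed T' j'" and ne: "(T, j) \<noteq> (T', j')"
  shows "tile_sign A T = tile_sign A T' \<longleftrightarrow> dec_on01 (transit T j T' j')"
proof -
  let ?G = "glue T j T' j'" and ?s = "transit T j T' j'"
  note g = glue_facts[OF a ne]
  have gS: "?G ` open_strip \<subseteq> S"
    unfolding g(3) using f_cball_S[OF a(1)] f_cball_S[OF a(3)] sector_subset_cball[OF n0] by blast
  \<comment> \<open>\<open>?z\<close> lies in the half strip that carries \<open>T\<close> and
    \<open>?w\<close> in the reflected one that carries \<open>T'\<close>; the sign of
    \<open>glue\<close> is constant on the connected strip and links the two.\<close>
  let ?z = "Complex (1/2) (1/2)" and ?w = "Complex (1/2) (-1/2)"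
  have zw: "?z \<in> open_strip" "?w \<in> open_strip" by (auto simp: open_strip_def)
  have 1: "positive_at A ?G ?z = positive_at A ?G ?w"
    by (rule positive_at_constant[OF A convex_connected[OF convex_open_strip] zw])
       (use open_open_strip g(1,2) gS in blast)
  have 2: "positive_at A ?G ?z = tile_sign A T"
  proof -
    let ?\<rho> = "\<lambda>z. of_nat j + z"
    have "positive_at A ?G ?z = positive_at A ((\<lambda>z. f T (kap n z)) \<circ> ?\<rho>) ?z"
    proof (rule positive_at_cong)
      show "open {z. Im z > 0}" by (rule open_halfspace_Im_gt)
    qed (auto simp: glue_def)
    also have "\<dots> = positive_at A (\<lambda>z. f T (kap n z)) (?\<rho> ?z)"
    proof -
      have "Im (?\<rho> ?z) > 0" by simp
      from upper_local[OF a(1) this] obtain W where W: "open W" "?\<rho> ?z \<in> W"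
        "continuous_on W (\<lambda>z. f T (kap n z))" "inj_on (\<lambda>z. f T (kap n z)) W" "(\<lambda>z. f T (kap n z)) ` W \<subseteq> S" by blast
      have "positive_at A ((\<lambda>z. f T (kap n z)) \<circ> ?\<rho>) ?z \<longleftrightarrow> (positive_at A (\<lambda>z. f T (kap n z)) (?\<rho> ?z) \<longleftrightarrow> preserves_at ?\<rho> ?z)"
        by (rule positive_at_compose[where \<rho> = ?\<rho> and z = ?z, OF A W, of UNIV]) (auto intro!: continuous_intros)
      then show ?thesis using preserves_at_translation by simp
    qed
    also have "\<dots> = tile_sign A T" by (rule tile_sign_eq[OF A a(1)]) simp
    finally show ?thesis .
  qed
  have 3: "positive_at A ?G ?w = (tile_sign A T' \<longleftrightarrow> dec_on01 ?s)"
  proof -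
    let ?\<rho> = "reflect_strip (of_nat j') ?s"
    note s = transit_facts[OF a]
    have "positive_at A ?G ?w = positive_at A ((\<lambda>z. f T' (kap n z)) \<circ> ?\<rho>) ?w"
    proof (rule positive_at_cong)
      show "open {z. Im z < 0}" by (rule open_halfspace_Im_lt)
    qed (auto simp: glue_def reflect_strip_def)
    also have "\<dots> = (positive_at A (\<lambda>z. f T' (kap n z)) (?\<rho> ?w) \<longleftrightarrow> preserves_at ?\<rho> ?w)"
    proof -
      have "Im (?\<rho> ?w) > 0" by (simp add: reflect_strip_def)
      from upper_local[OF a(3) this] obtain W where W: "open W" "?\<rho> ?w \<in> W"
        "continuous_on W (\<lambda>z. f T' (kap n z))" "inj_on (\<lambda>z. f T' (kap n z)) W" "(\<lambda>z. f T' (kap n z)) ` W \<subseteq> S" by blast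
      have c: "continuous_on open_strip ?\<rho>" unfolding reflect_strip_def
        by (intro continuous_intros continuous_on_compose2[OF s(1)]) (auto simp: open_strip_def)
      show ?thesis by (rule positive_at_compose[where \<rho> = ?\<rho> and z = ?w, OF A W open_open_strip zw(2) c reflect_strip_inj[OF s(4)]])
    qed
    also have "positive_at A (\<lambda>z. f T' (kap n z)) (?\<rho> ?w) = tile_sign A T'"
      by (rule tile_sign_eq[OF A a(3)]) (simp add: reflect_strip_def)
    also have "preserves_at ?\<rho> ?w \<longleftrightarrow> dec_on01 ?s"
      by (rule preserves_at_reflect_strip[OF s(1) transit_inc_or_dec[OF a] zw(2)])
    finally show ?thesis .
  qed
  show ?thesis using 1 2 3 by blast
qed

text \<open>Orient every edge along the positively oriented tile in which it is used; then each corner of a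
  tile is either a source or a sink, alternately, and this type depends on the vertex only.\<close>

theorem quadrilateral_no_loop:
  assumes n: "n = 4" and A: "oriented_atlas S A"
    and k: "\<And>T. T \<in> TT \<Longrightarrow> k T \<in> {0, 1}"
    and used: "\<And>e. e \<in> E \<Longrightarrow> card {(T, j). T \<in> TT \<and> j \<in> {k T, k T + 2} \<and> ed T j = e} = 1"
    and T: "T \<in> TT" "i < 4"
  shows "cor T i \<noteq> cor T (Suc i)"
proof
  assume eq: "cor T i = cor T (Suc i)"
  \<comment> \<open>As \<open>k T\<close> is \<open>0\<close> or \<open>1\<close>,
    \<open>even (i + k T)\<close> says that side \<open>i\<close> is used; compared with the sign of
    the tile it becomes the source or sink type of corner \<open>i\<close>.\<close>
  define c where "c T i = (even (i + k T) = tile_sign A T)" for T i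
  have usedj: "j \<in> {k U, k U + 2} \<longleftrightarrow> even (j + k U)" if "U \<in> TT" "j < 4" for U j
  proof -
    have "j = 0 \<or> j = 1 \<or> j = 2 \<or> j = 3" using that by auto
    then show ?thesis using k[OF that(1)] by auto
  qed
  have cn: "c U n = c U 0" for U using n by (simp add: c_def)
  have compat: "(inc_on01 (transit T j T' j') \<and> c T j = c T' j' \<and> c T (Suc j) = c T' (Suc j')) \<or>
       (dec_on01 (transit T j T' j') \<and> c T j = c T' (Suc j') \<and> c T (Suc j) = c T' j')"
    if a: "T \<in> TT" "j < n" "T' \<in> TT" "j' < n" "ed T j = ed T' j'" and ne: "(T, j) \<noteq> (T', j')" for T j T' j'
  proof -
    let ?e = "ed T j"
    have eE: "?e \<in> E" using ed_E a by blast
    let ?U = "{(T, j). T \<in> TT \<and> j \<in> {k T, k T + 2} \<and> ed T j = ?e}"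
    have mem: "(U, i) \<in> ?U \<longleftrightarrow> even (i + k U)" if "U \<in> TT" "i < n" "ed U i = ?e" for U i
      using usedj[of U i] that n by auto
    have so: "sides_of ?e = {(T, j), (T', j')}"
      by (rule sides_of_two[OF eE _ _ ne]) (use a in \<open>auto simp: sides_of_def\<close>)
    have "?U \<subseteq> sides_of ?e"
    proof
      fix p assume p: "p \<in> ?U"
      obtain U i where p': "p = (U, i)" by (metis surj_pair)
      have U: "U \<in> TT" "i \<in> {k U, k U + 2}" "ed U i = ?e" using p p' by auto
      then have "i < n" using k[OF U(1)] n by auto
      then show "p \<in> sides_of ?e" using U p' by (simp add: sides_of_def)
    qed
    obtain p where p: "?U = {p}" using used[OF eE] card_1_singletonE by blast
    then have "p \<in> {(T, j), (T', j')}" using \<open>?U \<subseteq> sides_of ?e\<close> so by auto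
    \<comment> \<open>The edge is used once, hence from exactly one of its two sides.\<close>
    then have "((T, j) \<in> ?U \<and> (T', j') \<notin> ?U) \<or> ((T, j) \<notin> ?U \<and> (T', j') \<in> ?U)"
      unfolding p using ne by auto
    then have ev: "even (j + k T) \<noteq> even (j' + k T')"
      using mem[OF a(1,2) refl] mem[OF a(3,4) a(5)[symmetric]] by blast
    have id: "inc_on01 (transit T j T' j') \<or> dec_on01 (transit T j T' j')" by (rule transit_inc_or_dec[OF a])
    show ?thesis
    proof (cases "dec_on01 (transit T j T' j')")
      case True
      then have "tile_sign A T = tile_sign A T'" using tile_sign_transit[OF A a ne] by simp
      then show ?thesis using True ev by (auto simp: c_def)
    next
      case False
      then have "tile_sign A T \<noteq> tile_sign A T'" using tile_sign_transit[OF A a ne] by simp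
      then show ?thesis using id False ev by (auto simp: c_def)
    qed
  qed
  define i' where "i' = (if Suc i = n then 0 else Suc i)"
  have i': "i' < n" "cor T i' = cor T i" "c T i' = c T (Suc i)" "i < n"
  proof -
    show "i < n" using T(2) n by simp
    then show "i' < n" using n0 by (auto simp: i'_def)
    show "cor T i' = cor T i" using eq cor_n[of T] by (auto simp: i'_def)
    show "c T i' = c T (Suc i)" using cn[of T] by (auto simp: i'_def)
  qed
  \<comment> \<open>A loop puts two consecutive corners at one vertex, whereas the type alternates
    along the quadrilateral.\<close>
  have "c T i \<Longrightarrow> c T i'" by (rule vertex_link[OF cn compat T(1) i'(4) T(1) i'(1)]) (use i' in auto)
  moreover have "c T i' \<Longrightarrow> c T i" by (rule vertex_link[OF cn compat T(1) i'(1) T(1) i'(4)]) (use i' in auto)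
  moreover have "c T (Suc i) \<noteq> c T i" by (auto simp: c_def)
  ultimately show False using i'(3) by auto
qed

end

section \<open>From a subdivision to a labelling\<close>

text \<open>The hypotheses say that the sets are separated, so a connected subset of the union stays
  in one of them.\<close>

lemma components_two:
  assumes "connected A" "connected B" "A \<noteq> {}" "B \<noteq> {}" "closure A \<inter> B = {}" "A \<inter> closure B = {}"
  shows "components (A \<union> B) = {A, B}"
proof -
  have dich: "C \<subseteq> A \<or> C \<subseteq> B" if C: "connected C" "C \<subseteq> A \<union> B" for C
  proof -
    have AB: "A \<subseteq> closure A" "B \<subseteq> closure B" by (rule closure_subset)+
    have "C \<subseteq> closure A \<union> closure B" using AB C(2) by auto
    moreover have "closure A \<inter> closure B \<inter> C = {}" using assms(5,6) C(2) by auto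
    ultimately have "closure A \<inter> C = {} \<or> closure B \<inter> C = {}"
      using C(1) unfolding connected_closed using closed_closure by metis
    then show ?thesis using AB C(2) by auto
  qed
  have one: "D = X" if "D \<in> components (A \<union> B)" "D \<subseteq> X" "connected X" "X \<subseteq> A \<union> B" for D X
    using that in_components_maximal[of D "A \<union> B"] by blast
  have "components (A \<union> B) \<subseteq> {A, B}"
  proof
    fix D assume D: "D \<in> components (A \<union> B)"
    then have "D \<subseteq> A \<or> D \<subseteq> B" using dich in_components_connected in_components_subset by metis
    then show "D \<in> {A, B}" using one[OF D, of A] one[OF D, of B] assms(1,2) by auto
  qed
  moreover have "\<Union>(components (A \<union> B)) = A \<union> B" by (rule Union_components)
  moreover have "A \<inter> B = {}" using assms(5) closure_subset[of A] by auto
  ultimately show ?thesis using assms(3,4) by blast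
qed

lemma closure_open_arc:
  fixes g :: "real \<Rightarrow> 'a::t2_space"
  assumes "continuous_on {a..b} g" "a < b"
  shows "closure (g ` {a<..<b}) = g ` {a..b}"
proof
  show "closure (g ` {a<..<b}) \<subseteq> g ` {a..b}"
    using assms(1) by (intro closure_minimal compact_imp_closed compact_continuous_image image_mono) auto
  have "g ` closure {a<..<b} \<subseteq> closure (g ` {a<..<b})"
    by (rule image_closure_subset) (use assms closure_subset in \<open>simp_all\<close>)
  then show "g ` {a..b} \<subseteq> closure (g ` {a<..<b})" using assms(2) by simp
qed

text \<open>The parameter interval is cut at the parameter \<open>s\<close> of \<open>x\<close>. The
  ends \<open>p\<close> and \<open>q\<close> may still coincide; loops are excluded later.\<close>

lemma split_edge:
  assumes G: "embedded_graph S V E" "e \<in> E" and x: "x \<in> e"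
  obtains h1 h2 p q where "components (e - {x}) = {h1, h2}" "h1 \<noteq> h2" "h1 \<union> h2 = e - {x}"
    "closure h1 - h1 = {p, x}" "closure h2 - h2 = {q, x}" "closure e - e = {p, q}" "p \<in> V" "q \<in> V"
proof -
  obtain g where g: "simple_path g" "path_image g \<subseteq> S" "pathstart g \<in> V" "pathfinish g \<in> V"
    "e = g ` {0<..<1}" "closure e = path_image g" "closure e - e = {pathstart g, pathfinish g}"
    using G by (rule embedded_edge)
  have eV: "e \<inter> V = {}" using embedded_edge_facts(4)[OF G] .
  obtain s where s: "0 < s" "s < 1" "x = g s" using x g(5) by auto
  have gi: "u = v" if "0 < u" "u < 1" "0 \<le> v" "v \<le> 1" "g u = g v" for u v
    using g(1) that unfolding simple_path_def loop_free_def by force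
  have cg: "continuous_on {0..1} g" using g(1) by (simp add: simple_path_def path_def)
  let ?h1 = "g ` {0<..<s}" and ?h2 = "g ` {s<..<1}"
  have c1: "closure ?h1 = g ` {0..s}" using s by (intro closure_open_arc continuous_on_subset[OF cg]) auto
  have c2: "closure ?h2 = g ` {s..1}" using s by (intro closure_open_arc continuous_on_subset[OF cg]) auto
  have d1: "closure ?h1 \<inter> ?h2 = {}" unfolding c1
  proof -
    have False if "u \<in> {0..s}" "v \<in> {s<..<1}" "g u = g v" for u v
      using gi[of v u] that s by auto
    then show "g ` {0..s} \<inter> ?h2 = {}" by blast
  qed
  have d2: "?h1 \<inter> closure ?h2 = {}" unfolding c2
  proof -
    have False if "u \<in> {0<..<s}" "v \<in> {s..1}" "g u = g v" for u v
      using gi[of u v] that s by auto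
    then show "?h1 \<inter> g ` {s..1} = {}" by blast
  qed
  have un: "?h1 \<union> ?h2 = e - {x}"
  proof -
    have "e - {x} = g ` ({0<..<1} - {s})"
    proof -
      have "g u \<noteq> x" if "u \<in> {0<..<1}" "u \<noteq> s" for u using gi[of u s] that s by auto
      then show ?thesis unfolding g(5) s(3) using s by auto
    qed
    also have "{0<..<1} - {s} = {0<..<s} \<union> {s<..<1}" using s by auto
    finally show ?thesis by (simp add: image_Un)
  qed
  have con: "connected ?h1" "connected ?h2"
    using s by (auto intro!: connected_continuous_image continuous_on_subset[OF cg])
  have ne: "?h1 \<noteq> {}" "?h2 \<noteq> {}" using s by auto
  have comp: "components (e - {x}) = {?h1, ?h2}"
    using components_two[OF con ne d1 d2] un by simp
  have xn: "x \<notin> ?h1" "x \<notin> ?h2" using un by auto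
  have he: "?h1 \<subseteq> e" "?h2 \<subseteq> e" using un by auto
  have e1: "closure ?h1 - ?h1 = {pathstart g, x}"
  proof -
    have "{0..s} = insert 0 (insert s {0<..<s})" using s by auto
    then have "g ` {0..s} = insert (pathstart g) (insert x ?h1)" using s(3) by (simp add: pathstart_def)
    then show ?thesis unfolding c1 using xn(1) he(1) eV g(3) by auto
  qed
  have e2: "closure ?h2 - ?h2 = {pathfinish g, x}"
  proof -
    have "{s..1} = insert 1 (insert s {s<..<1})" using s by auto
    then have "g ` {s..1} = insert (pathfinish g) (insert x ?h2)" using s(3) by (simp add: pathfinish_def)
    then show ?thesis unfolding c2 using xn(2) he(2) eV g(4) by auto
  qed
  have "?h1 \<inter> ?h2 = {}" using Int_mono[OF closure_subset order_refl, of ?h1 ?h2] unfolding d1 by (simp only: subset_empty)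
  then have "?h1 \<noteq> ?h2" using ne(1) by (metis Int_absorb)
  from comp this un e1 e2 g(7) g(3,4) show ?thesis by (rule that)
qed

lemma edge_ends_at_pair:
  assumes "closure e - e = {p, q}" "p \<noteq> q"
  shows "edge_ends_at e v = (if v = p \<or> v = q then 1 else 0)"
  using assms by (auto simp: edge_ends_at_def)

context ptiling begin

text \<open>Two sides over one edge have the same pair of end points, and with at least three
  distinct corners this pair determines the side.\<close>

lemma corners_distinct_imp_inj:
  assumes T: "T \<in> TT" and c: "inj_on (cor T) {..<n}"
  shows "inj_on (f T) (sphere 0 1)"
proof (rule inj_onI)
  fix z w :: complex assume z: "z \<in> sphere 0 1" "w \<in> sphere 0 1" and eq: "f T z = f T w"
  have cs: False if "k < n" "z = corner n k" "j < n" "w \<in> side n j" "f T z = f T w" for z w k j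
  proof -
    have "f T z \<in> V" using cor_V[OF T, of k] that by (simp add: cor_def)
    moreover have "f T w \<in> ed T j" using that by (simp add: ed_def)
    ultimately show False using edge_V[OF ed_E[OF T that(3)]] that(5) by simp
  qed
  show "z = w"
  proof (rule sphere_cases[OF n0 z(1)]; rule sphere_cases[OF n0 z(2)])
    fix k j assume a: "k < n" "z = corner n k" "j < n" "w = corner n j"
    then have "cor T k = cor T j" using eq by (simp add: cor_def)
    then show "z = w" using c a by (auto dest: inj_onD)
  next
    fix k j assume "k < n" "z = corner n k" "j < n" "w \<in> side n j"
    then show "z = w" using cs eq by blast
  next
    fix k j assume "k < n" "z \<in> side n k" "j < n" "w = corner n j"
    then show "z = w" using cs[of j w k z] eq by simp
  next
    fix k j assume a: "k < n" "z \<in> side n k" "j < n" "w \<in> side n j"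
    have "f T z \<in> ed T k" using a(2) by (simp add: ed_def)
    moreover have "f T z \<in> ed T j" unfolding eq using a(4) by (simp add: ed_def)
    ultimately have ee: "ed T k = ed T j" using edge_unique[OF ed_E[OF T a(1)] ed_E[OF T a(3)]] by simp
    define nx where "nx i = (if Suc i = n then 0 else Suc i)" for i
    have nx: "cor T (Suc i) = cor T (nx i)" "i < n \<Longrightarrow> nx i < n" for i
      using n0 cor_n[of T] by (auto simp: nx_def)
    have "{cor T k, cor T (nx k)} = {cor T j, cor T (nx j)}"
      using ed_closure[OF T a(1)] ed_closure[OF T a(3)] ee nx(1) by simp
    then have "cor T ` {k, nx k} = cor T ` {j, nx j}" by simp
    then have "{k, nx k} = {j, nx j}"
      using inj_on_image_eq_iff[OF c, of "{k, nx k}" "{j, nx j}"] a nx(2) by auto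
    then have "k = j" using n3 a unfolding nx_def doubleton_eq_iff by (auto split: if_splits)
    then show "z = w" using inj_onD[OF side_inj[OF T a(1)] eq] a by simp
  qed
qed

end

text \<open>The witnesses of the subdivision, unpacked. The polygon maps \<open>g\<close> of the
  pentagons are chosen independently of the maps \<open>f\<close> of the quadrilaterals; the two are
  related through the graphs.\<close>

locale pent_subdivision = Q: ptiling S VQ EQ 4 f + P: ptiling S V E 5 g
  for S :: "'a::t2_space set" and VQ EQ f V E g +
  fixes m :: "'a set \<Rightarrow> 'a" and k :: "'a set \<Rightarrow> nat" and c :: "'a set \<Rightarrow> real \<Rightarrow> complex"
    and A :: "('a set \<times> ('a \<Rightarrow> complex)) set"
  assumes atlas: "oriented_atlas S A"
    and deg3: "\<And>v. v \<in> V \<Longrightarrow> vertex_degree E v \<ge> 3"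
    and m_in: "\<And>e. e \<in> EQ \<Longrightarrow> m e \<in> e"
    and kT: "\<And>T. T \<in> Q.TT \<Longrightarrow> k T \<in> {0, 1}"
    and c_arc: "\<And>T. T \<in> Q.TT \<Longrightarrow> arc (c T)"
    and c_ball: "\<And>T. T \<in> Q.TT \<Longrightarrow> c T ` {0<..<1} \<subseteq> ball 0 1"
    and c_start: "\<And>T. T \<in> Q.TT \<Longrightarrow> pathstart (c T) \<in> side 4 (k T)"
      "\<And>T. T \<in> Q.TT \<Longrightarrow> f T (pathstart (c T)) = m (f T ` side 4 (k T))"
    and c_finish: "\<And>T. T \<in> Q.TT \<Longrightarrow> pathfinish (c T) \<in> side 4 (k T + 2)"
      "\<And>T. T \<in> Q.TT \<Longrightarrow> f T (pathfinish (c T)) = m (f T ` side 4 (k T + 2))"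
    and used: "\<And>e. e \<in> EQ \<Longrightarrow> card {(T, j). T \<in> Q.TT \<and> j \<in> {k T, k T + 2} \<and> f T ` side 4 j = e} = 1"
    and V_eq: "V = VQ \<union> m ` EQ"
    and E_eq: "E = (\<Union>e\<in>EQ. components (e - {m e})) \<union> (\<lambda>T. f T ` c T ` {0<..<1}) ` Q.TT"
begin

definition chord :: "'a set \<Rightarrow> 'a set" where
  "chord T = f T ` c T ` {0<..<1}"

lemma m_inj: "e \<in> EQ \<Longrightarrow> e' \<in> EQ \<Longrightarrow> m e = m e' \<Longrightarrow> e = e'"
  using Q.edge_unique m_in by metis

lemma m_not_VQ: "e \<in> EQ \<Longrightarrow> m e \<notin> VQ"
  using Q.edge_V m_in by metis

lemma k_lt: "T \<in> Q.TT \<Longrightarrow> k T < 4 \<and> k T + 2 < 4"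
  using kT[of T] by auto

lemma used_unique:
  assumes "T \<in> Q.TT" "T' \<in> Q.TT" "j \<in> {k T, k T + 2}" "j' \<in> {k T', k T' + 2}" "Q.ed T j = Q.ed T' j'"
  shows "T = T' \<and> j = j'"
proof -
  have "j < 4" using assms(3) k_lt[OF assms(1)] by auto
  then have e: "Q.ed T j \<in> EQ" using Q.ed_E assms(1) by blast
  let ?X = "{(U, i). U \<in> Q.TT \<and> i \<in> {k U, k U + 2} \<and> f U ` side 4 i = Q.ed T j}"
  obtain p where p: "?X = {p}" using used[OF e] card_1_singletonE by blast
  have "(T, j) \<in> ?X" using assms by (simp add: Q.ed_def)
  moreover have "(T', j') \<in> ?X" using assms by (simp add: Q.ed_def)
  ultimately show ?thesis unfolding p by auto
qed

lemma used_exists: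
  assumes "e \<in> EQ"
  obtains T j where "T \<in> Q.TT" "j \<in> {k T, k T + 2}" "Q.ed T j = e"
proof -
  have "{(T, j). T \<in> Q.TT \<and> j \<in> {k T, k T + 2} \<and> f T ` side 4 j = e} \<noteq> {}"
    using used[OF assms] by (metis card.empty zero_neq_one)
  then show ?thesis using that unfolding Q.ed_def by blast
qed

lemma chord_subset: "T \<in> Q.TT \<Longrightarrow> chord T \<subseteq> T"
  unfolding chord_def using c_ball Q.f_in_tile by blast

lemma chord_nonempty: "chord T \<noteq> {}"
  by (simp add: chord_def)

text \<open>The arc runs inside the tile and ends on the graph. Equal end points would make the two
  opposite sides one edge that is used twice.\<close>

lemma chord_ends:
  assumes T: "T \<in> Q.TT"
  shows "closure (chord T) - chord T = {m (Q.ed T (k T)), m (Q.ed T (k T + 2))}"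
    "m (Q.ed T (k T)) \<noteq> m (Q.ed T (k T + 2))"
proof -
  let ?p = "f T \<circ> c T"
  have e: "{0..1::real} = insert 0 (insert 1 {0<..<1})" by auto
  have "c T 0 \<in> cball 0 1" "c T 1 \<in> cball 0 1"
    using subsetD[OF side_subset_sphere c_start(1)[OF T]] subsetD[OF side_subset_sphere c_finish(1)[OF T]]
    by (auto simp: pathstart_def pathfinish_def)
  moreover have "c T ` {0<..<1} \<subseteq> cball 0 1" using c_ball[OF T] ball_subset_cball by blast
  ultimately have im: "c T ` {0..1} \<subseteq> cball 0 1" unfolding e by simp
  have "continuous_on {0..1} (c T)" using c_arc[OF T] by (simp add: arc_def path_def)
  then have cp: "continuous_on {0..1} ?p"
    by (intro continuous_on_compose continuous_on_subset[OF Q.f_cont[OF T] im])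
  have "closure (chord T) = ?p ` {0..1}"
    using closure_open_arc[OF cp] by (simp add: chord_def image_comp)
  also have "\<dots> = insert (?p 0) (insert (?p 1) (chord T))" unfolding e by (simp add: chord_def image_comp)
  finally have cl: "closure (chord T) = insert (?p 0) (insert (?p 1) (chord T))" .
  have ends: "?p 0 = m (Q.ed T (k T))" "?p 1 = m (Q.ed T (k T + 2))"
    using c_start(2)[OF T] c_finish(2)[OF T] by (simp_all add: pathstart_def pathfinish_def Q.ed_def)
  have E: "Q.ed T (k T) \<in> EQ" "Q.ed T (k T + 2) \<in> EQ" using Q.ed_E[OF T] k_lt[OF T] by auto
  have nT: "m e \<notin> T" if "e \<in> EQ" for e using m_in[OF that] that Q.tile_facts(2)[OF T] by blast
  show "closure (chord T) - chord T = {m (Q.ed T (k T)), m (Q.ed T (k T + 2))}"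
    unfolding cl ends using nT[OF E(1)] nT[OF E(2)] chord_subset[OF T] by auto
  show "m (Q.ed T (k T)) \<noteq> m (Q.ed T (k T + 2))"
  proof
    assume "m (Q.ed T (k T)) = m (Q.ed T (k T + 2))"
    then have "Q.ed T (k T) = Q.ed T (k T + 2)" using m_inj E by blast
    then show False using used_unique[OF T T, of "k T" "k T + 2"] by simp
  qed
qed

lemma no_loop:
  assumes "e \<in> EQ" "closure e - e = {p, q}"
  shows "p \<noteq> q"
proof -
  obtain T j where T: "T \<in> Q.TT" "j < 4" "Q.ed T j = e" using assms(1) by (rule Q.sides_of_nonempty)
  have "Q.cor T j \<noteq> Q.cor T (Suc j)"
    by (rule Q.quadrilateral_no_loop[OF refl atlas kT used[folded Q.ed_def] T(1,2)])
  moreover have "{p, q} = {Q.cor T j, Q.cor T (Suc j)}" using Q.ed_closure[OF T(1,2)] assms(2) unfolding T(3) by simp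
  ultimately show ?thesis by (auto simp: doubleton_eq_iff)
qed

lemma halves:
  assumes "e \<in> EQ"
  obtains h1 h2 p q where "components (e - {m e}) = {h1, h2}" "h1 \<noteq> h2" "h1 \<union> h2 = e - {m e}"
    "closure h1 - h1 = {p, m e}" "closure h2 - h2 = {q, m e}" "p \<in> VQ" "q \<in> VQ" "p \<noteq> q"
proof -
  obtain h1 h2 p q where *: "components (e - {m e}) = {h1, h2}" "h1 \<noteq> h2" "h1 \<union> h2 = e - {m e}"
    "closure h1 - h1 = {p, m e}" "closure h2 - h2 = {q, m e}" "closure e - e = {p, q}" "p \<in> VQ" "q \<in> VQ"
    by (rule split_edge[OF Q.graph assms m_in[OF assms]])
  from *(1-5,7,8) no_loop[OF assms *(6)] show ?thesis by (rule that)
qed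

lemma half_end:
  assumes "e \<in> EQ" "h \<in> components (e - {m e})"
  obtains p where "p \<in> VQ" "closure h - h = {p, m e}" "h \<subseteq> e"
proof -
  obtain h1 h2 p q where *: "components (e - {m e}) = {h1, h2}" "h1 \<noteq> h2" "h1 \<union> h2 = e - {m e}"
    "closure h1 - h1 = {p, m e}" "closure h2 - h2 = {q, m e}" "p \<in> VQ" "q \<in> VQ" "p \<noteq> q"
    by (rule halves[OF assms(1)])
  then have "h = h1 \<or> h = h2" using assms(2) by auto
  then show ?thesis using that[of p] that[of q] * by auto
qed

text \<open>Without loops the two halves of an edge end at different vertices, so the bullet end
  distinguishes them.\<close>

lemma half_unique:
  assumes "e \<in> EQ" "h \<in> components (e - {m e})" "h' \<in> components (e - {m e})"
    "closure h - h = {v, m e}" "closure h' - h' = {v, m e}" "v \<in> VQ"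
  shows "h = h'"
proof -
  obtain h1 h2 p q where *: "components (e - {m e}) = {h1, h2}" "h1 \<noteq> h2" "h1 \<union> h2 = e - {m e}"
    "closure h1 - h1 = {p, m e}" "closure h2 - h2 = {q, m e}" "p \<in> VQ" "q \<in> VQ" "p \<noteq> q"
    by (rule halves[OF assms(1)])
  have "v \<noteq> m e" using m_not_VQ assms by blast
  then have "h = h1 \<Longrightarrow> v = p" "h = h2 \<Longrightarrow> v = q" "h' = h1 \<Longrightarrow> v = p" "h' = h2 \<Longrightarrow> v = q"
    using assms(4,5) *(4,5) by (auto simp: doubleton_eq_iff)
  then show ?thesis using assms(2,3) *(1,8) by auto
qed

lemma half_same_end:
  assumes "e \<in> EQ" "h \<in> components (e - {m e})" "h' \<in> components (e - {m e})" "h \<noteq> h'"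
    "closure h - h = {v, m e}" "closure h' - h' = {v', m e}" "v \<in> VQ"
  shows "v \<noteq> v'"
  using half_unique assms by blast

lemma E_cases:
  assumes "h \<in> E"
  obtains (half) e p where "e \<in> EQ" "h \<in> components (e - {m e})" "p \<in> VQ" "closure h - h = {p, m e}" "h \<subseteq> e"
  | (chord) T where "T \<in> Q.TT" "h = chord T"
proof -
  from assms consider e where "e \<in> EQ" "h \<in> components (e - {m e})" | T where "T \<in> Q.TT" "h = chord T"
    unfolding E_eq chord_def by blast
  then show ?thesis
  proof cases
    case (1 e)
    obtain p where "p \<in> VQ" "closure h - h = {p, m e}" "h \<subseteq> e" by (rule half_end[OF 1])
    with 1 show ?thesis using half by blast
  next
    case 2
    then show ?thesis using chord by blast
  qed
qed

text \<open>Two halves meet here, and exactly one arc ends here because the edge is used exactly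
  once; it contributes \<open>1\<close> because its ends differ.\<close>

lemma degree_midpoint:
  assumes e: "e \<in> EQ"
  shows "vertex_degree E (m e) = 3"
proof -
  let ?v = "m e"
  obtain h1 h2 p q where h: "components (e - {m e}) = {h1, h2}" "h1 \<noteq> h2" "h1 \<union> h2 = e - {m e}"
    "closure h1 - h1 = {p, m e}" "closure h2 - h2 = {q, m e}" "p \<in> VQ" "q \<in> VQ" "p \<noteq> q"
    by (rule halves[OF e])
  obtain T j where T: "T \<in> Q.TT" "j \<in> {k T, k T + 2}" "Q.ed T j = e" using e by (rule used_exists)
  have vV: "?v \<notin> VQ" by (rule m_not_VQ[OF e])
  have hE: "h1 \<in> E" "h2 \<in> E" "chord T \<in> E"
    unfolding E_eq chord_def using h(1) e T(1) by blast+
  have ne: "h1 \<noteq> chord T" "h2 \<noteq> chord T"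
  proof -
    have "chord T \<inter> e = {}" using chord_subset[OF T(1)] Q.tile_facts(2)[OF T(1)] e by blast
    then show "h1 \<noteq> chord T" "h2 \<noteq> chord T" using h(3) chord_nonempty[of T] by auto
  qed
  have v1: "edge_ends_at h1 ?v = 1" "edge_ends_at h2 ?v = 1"
  proof -
    have "p \<noteq> m e" "q \<noteq> m e" using h(6,7) vV by auto
    then show "edge_ends_at h1 ?v = 1" "edge_ends_at h2 ?v = 1"
      using edge_ends_at_pair[OF h(4)] edge_ends_at_pair[OF h(5)] by auto
  qed
  have v2: "edge_ends_at (chord T) ?v = 1"
    using edge_ends_at_pair[OF chord_ends[OF T(1)]] T by auto
  have other: "edge_ends_at h' ?v = 0" if h': "h' \<in> E" "h' \<notin> {h1, h2, chord T}" for h'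
    using h'(1)
  proof (cases rule: E_cases)
    case (half e' p')
    have "e' \<noteq> e" using half(2) h'(2) h(1) by auto
    then have "?v \<noteq> m e'" using m_inj half(1) e by blast
    moreover have "?v \<noteq> p'" using half(3) vV by blast
    ultimately show ?thesis using half(4) by (simp add: edge_ends_at_def)
  next
    case (chord T')
    have "T' \<noteq> T" using chord h'(2) by auto
    have "?v \<noteq> m (Q.ed T' j')" if j': "j' \<in> {k T', k T' + 2}" for j'
    proof
      assume eq: "?v = m (Q.ed T' j')"
      have "j' < 4" using j' k_lt[OF chord(1)] by auto
      then have "Q.ed T j = Q.ed T' j'" using m_inj[OF e _ eq] Q.ed_E[OF chord(1)] T(3) by blast
      then show False using used_unique[OF T(1) chord(1) T(2) j'] \<open>T' \<noteq> T\<close> by blast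
    qed
    then have "?v \<noteq> m (Q.ed T' (k T'))" "?v \<noteq> m (Q.ed T' (k T' + 2))" by blast+
    then show ?thesis using chord_ends(1)[OF chord(1)] chord(2) by (simp add: edge_ends_at_def)
  qed
  have "vertex_degree E ?v = (\<Sum>h\<in>{h1, h2, chord T}. edge_ends_at h ?v)"
    unfolding vertex_degree_def
    by (rule sum.mono_neutral_right[OF P.finite_E]) (use hE other in auto)
  also have "\<dots> = 3" using h(2) ne v1 v2 by simp
  finally show ?thesis .
qed

lemma graph_subset: "VQ \<union> \<Union>EQ \<subseteq> V \<union> \<Union>E"
proof -
  have "e \<subseteq> V \<union> \<Union>E" if e: "e \<in> EQ" for e
  proof -
    have "\<Union>(components (e - {m e})) = e - {m e}" by (rule Union_components)
    moreover have "components (e - {m e}) \<subseteq> E" unfolding E_eq using e by blast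
    moreover have "m e \<in> V" unfolding V_eq using e by blast
    ultimately show ?thesis by blast
  qed
  then show ?thesis using V_eq by blast
qed

text \<open>The subdivided graph contains the original one, so a pentagon is a connected subset of
  the complement of the latter.\<close>

lemma tile_in_quad:
  assumes "T' \<in> P.TT"
  obtains T where "T \<in> Q.TT" "T' \<subseteq> T"
proof -
  note t = P.tile_facts[OF assms]
  have "T' \<subseteq> S - (VQ \<union> \<Union>EQ)" using t(1,2) graph_subset by blast
  moreover have "S - (VQ \<union> \<Union>EQ) \<noteq> {}" using calculation t(4) by blast
  ultimately show ?thesis using exists_component_superset[OF _ _ t(3)] that unfolding tiles_def by metis
qed

text \<open>An arc consists of interior points of its quadrilateral, the sides of a pentagon lie in
  the closure of the quadrilateral around it, and an interior point belongs to one closed tile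
  only.\<close>

lemma side_chord_tile:
  assumes "T' \<in> P.TT" "T \<in> Q.TT" "T' \<subseteq> T" "j < 5" "T'' \<in> Q.TT" "P.ed T' j = chord T''"
  shows "T'' = T"
proof -
  obtain x where x: "x \<in> chord T''" using chord_nonempty by blast
  have "x \<in> T''" using x chord_subset[OF assms(5)] by blast
  then have "x \<in> f T'' ` ball 0 1" using Q.f_ball(1)[OF assms(5)] by simp
  then obtain z where z: "z \<in> ball 0 1" "x = f T'' z" by blast
  have "x \<in> P.ed T' j" using x assms(6) by simp
  also have "P.ed T' j \<subseteq> g T' ` cball 0 1"
    unfolding P.ed_def using side_subset_sphere[of 5 j] by (intro image_mono) auto
  also have "\<dots> = closure T'" using P.tile_closure[OF assms(1)] by simp
  also have "\<dots> \<subseteq> closure T" using assms(3) by (rule closure_mono)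
  also have "\<dots> = f T ` cball 0 1" by (rule Q.tile_closure[OF assms(2)])
  finally have "x \<in> f T ` cball 0 1" .
  then obtain w where w: "x = f T w" "w \<in> cball 0 1" by (rule imageE)
  then show ?thesis using Q.f_interior_unique(1)[OF assms(5,2) z(1) w(2)] z(2) by simp
qed

definition bullet :: "'a set \<Rightarrow> nat \<Rightarrow> bool" where
  "bullet T' i \<longleftrightarrow> P.cor T' i \<in> VQ"

lemma side_cases:
  assumes "T' \<in> P.TT" "j < 5"
  obtains (half) e where "e \<in> EQ" "P.ed T' j \<in> components (e - {m e})" "bullet T' j \<noteq> bullet T' (Suc j)"
    "P.cor T' (if bullet T' j then Suc j else j) = m e"
  | (chord) T where "T \<in> Q.TT" "P.ed T' j = chord T" "\<not> bullet T' j" "\<not> bullet T' (Suc j)"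
proof -
  have cl: "closure (P.ed T' j) - P.ed T' j = {P.cor T' j, P.cor T' (Suc j)}"
    using P.ed_closure assms by simp
  have "P.ed T' j \<in> E" using P.ed_E assms by simp
  then show ?thesis
  proof (cases rule: E_cases)
    case (half e p)
    have "{P.cor T' j, P.cor T' (Suc j)} = {p, m e}" using cl half(4) by simp
    then have "(P.cor T' j = p \<and> P.cor T' (Suc j) = m e) \<or> (P.cor T' j = m e \<and> P.cor T' (Suc j) = p)"
      unfolding doubleton_eq_iff by blast
    moreover have "m e \<notin> VQ" using m_not_VQ half(1) .
    ultimately have "bullet T' j \<noteq> bullet T' (Suc j)" "P.cor T' (if bullet T' j then Suc j else j) = m e"
      using half(3) by (auto simp: bullet_def)
    with half(1,2) show ?thesis by (rule that(1))
  next
    case (chord T)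
    have "{P.cor T' j, P.cor T' (Suc j)} = {m (Q.ed T (k T)), m (Q.ed T (k T + 2))}"
      using cl chord chord_ends(1)[OF chord(1)] by simp
    moreover have "Q.ed T (k T) \<in> EQ" "Q.ed T (k T + 2) \<in> EQ" using Q.ed_E[OF chord(1)] k_lt[OF chord(1)] by auto
    ultimately have "\<not> bullet T' j" "\<not> bullet T' (Suc j)"
      using m_not_VQ unfolding bullet_def doubleton_eq_iff by metis+
    with chord show ?thesis by (rule that(2))
  qed
qed

text \<open>Non-adjacency allows at most two bullets among five corners. Fewer would leave at least
  three sides without bullets, all of them the arc of the surrounding quadrilateral, and an edge has
  just two sides.\<close>

lemma bullet_pattern:
  assumes T': "T' \<in> P.TT"
  obtains r where "r < 5" "bullet T' r" "\<not> bullet T' ((r+1) mod 5)" "bullet T' ((r+2) mod 5)" "\<not> bullet T' ((r+3) mod 5)" "\<not> bullet T' ((r+4) mod 5)"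
proof -
  obtain T where T: "T \<in> Q.TT" "T' \<subseteq> T" using T' by (rule tile_in_quad)
  have b5: "bullet T' 5 = bullet T' 0" using P.cor_n[of T'] by (simp add: bullet_def)
  have nadj: "\<not> (bullet T' j \<and> bullet T' (Suc j))" if "j < 5" for j
    using T' that by (cases rule: side_cases) auto
  have chj: "(T', j) \<in> P.sides_of (chord T)" if "j < 5" "\<not> bullet T' j" "\<not> bullet T' (Suc j)" for j
    using T' that(1)
  proof (cases rule: side_cases)
    case (half e)
    then show ?thesis using that by simp
  next
    case (chord T'')
    then have "T'' = T" using side_chord_tile[OF T' T that(1)] by simp
    then show ?thesis using chord T' that(1) by (simp add: P.sides_of_def)
  qed
  let ?b = "bullet T'"
  have three: False if "i < 5" "j < 5" "l < 5" "i \<noteq> j" "j \<noteq> l" "i \<noteq> l" "\<not> ?b i" "\<not> ?b (Suc i)" "\<not> ?b j" "\<not> ?b (Suc j)"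
    "\<not> ?b l" "\<not> ?b (Suc l)" for i j l
  proof -
    have sub: "{(T', i), (T', j), (T', l)} \<subseteq> P.sides_of (chord T)" using chj that by simp
    have "card {(T', i), (T', j), (T', l)} = 3" using that by simp
    then show False using card_mono[OF _ sub] P.sides_of_le_2[of "chord T"] by simp
  qed
  have na: "\<not> (?b 0 \<and> ?b 1)" "\<not> (?b 1 \<and> ?b 2)" "\<not> (?b 2 \<and> ?b 3)" "\<not> (?b 3 \<and> ?b 4)" "\<not> (?b 4 \<and> ?b 0)"
    using nadj[of 0] nadj[of 1] nadj[of 2] nadj[of 3] nadj[of 4] b5 by (simp_all add: numeral_eq_Suc)
  \<comment> \<open>Four consecutive corners without bullet enclose three sides without
    bullets.\<close>
  have t: "\<not> (\<not> ?b 0 \<and> \<not> ?b 1 \<and> \<not> ?b 2 \<and> \<not> ?b 3)" "\<not> (\<not> ?b 1 \<and> \<not> ?b 2 \<and> \<not> ?b 3 \<and> \<not> ?b 4)"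
    "\<not> (\<not> ?b 2 \<and> \<not> ?b 3 \<and> \<not> ?b 4 \<and> \<not> ?b 0)" "\<not> (\<not> ?b 3 \<and> \<not> ?b 4 \<and> \<not> ?b 0 \<and> \<not> ?b 1)"
    "\<not> (\<not> ?b 4 \<and> \<not> ?b 0 \<and> \<not> ?b 1 \<and> \<not> ?b 2)"
    using three[of 0 1 2] three[of 1 2 3] three[of 2 3 4] three[of 3 4 0] three[of 4 0 1] b5
    by (auto simp: numeral_eq_Suc)
  have "(?b 0 \<and> \<not> ?b 1 \<and> ?b 2 \<and> \<not> ?b 3 \<and> \<not> ?b 4) \<or> (?b 1 \<and> \<not> ?b 2 \<and> ?b 3 \<and> \<not> ?b 4 \<and> \<not> ?b 0)
      \<or> (?b 2 \<and> \<not> ?b 3 \<and> ?b 4 \<and> \<not> ?b 0 \<and> \<not> ?b 1) \<or> (?b 3 \<and> \<not> ?b 4 \<and> ?b 0 \<and> \<not> ?b 1 \<and> \<not> ?b 2)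
      \<or> (?b 4 \<and> \<not> ?b 0 \<and> ?b 1 \<and> \<not> ?b 2 \<and> \<not> ?b 3)"
    using na t by blast
  moreover have md: "(0+1) mod 5 = (1::nat)" "(0+2) mod 5 = (2::nat)" "(0+3) mod 5 = (3::nat)" "(0+4) mod 5 = (4::nat)"
    "(1+1) mod 5 = (2::nat)" "(1+2) mod 5 = (3::nat)" "(1+3) mod 5 = (4::nat)" "(1+4) mod 5 = (0::nat)"
    "(2+1) mod 5 = (3::nat)" "(2+2) mod 5 = (4::nat)" "(2+3) mod 5 = (0::nat)" "(2+4) mod 5 = (1::nat)"
    "(3+1) mod 5 = (4::nat)" "(3+2) mod 5 = (0::nat)" "(3+3) mod 5 = (1::nat)" "(3+4) mod 5 = (2::nat)"
    "(4+1) mod 5 = (0::nat)" "(4+2) mod 5 = (1::nat)" "(4+3) mod 5 = (2::nat)" "(4+4) mod 5 = (3::nat)"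
    by simp_all
  have lt: "(0::nat) < 5" "(1::nat) < 5" "(2::nat) < 5" "(3::nat) < 5" "(4::nat) < 5" by simp_all
  ultimately show ?thesis
    using that[of 0, unfolded md, OF lt(1)] that[of 1, unfolded md, OF lt(2)] that[of 2, unfolded md, OF lt(3)]
      that[of 3, unfolded md, OF lt(4)] that[of 4, unfolded md, OF lt(5)] by blast
qed

text \<open>A bullet never equals an unlabelled corner, and corners \<open>3\<close> and
  \<open>4\<close> are the distinct ends of an arc. Any other coincidence would fold two adjacent
  half edges onto each other, which \<open>no_fold\<close> excludes at vertices of degree at least
  \<open>3\<close>.\<close>

lemma nondegenerate:
  assumes T': "T' \<in> P.TT" and b: "bullet T' 0" "\<not> bullet T' 1" "bullet T' 2" "\<not> bullet T' 3" "\<not> bullet T' 4"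
  shows "inj_on (g T') (sphere 0 1)"
proof (rule P.corners_distinct_imp_inj[OF T'])
  let ?c = "P.cor T'"
  have c5: "?c 5 = ?c 0" using P.cor_n[of T'] by simp
  have b5: "bullet T' 5" using c5 b(1) by (simp add: bullet_def)
  have fold: False if "j < 5" "j' = Suc j mod 5" "P.ed T' j = P.ed T' j'" "?c j \<noteq> ?c j'" for j j'
  proof -
    have "vertex_degree E (?c j') < 3" by (rule P.no_fold[OF T' that])
    moreover have "?c j' \<in> V" using P.cor_V[OF T', of j'] that(2) by simp
    ultimately show False using deg3[of "?c j'"] by simp
  qed
  have cl: "closure (P.ed T' j) - P.ed T' j = {?c j, ?c (Suc j)}" if "j < 5" for j
    using P.ed_closure[OF T' that] .
  have cV: "?c j \<in> VQ" if "bullet T' j" for j using that by (simp add: bullet_def)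
  have cN: "?c i \<noteq> ?c j" if "bullet T' i" "\<not> bullet T' j" for i j using that by (auto simp: bullet_def)
  have s0: "\<exists>e. e \<in> EQ \<and> P.ed T' 0 \<in> components (e - {m e}) \<and> ?c 1 = m e"
    using T' zero_less_numeral by (cases rule: side_cases[of T' 0]) (use b in auto)
  have s1: "\<exists>e. e \<in> EQ \<and> P.ed T' 1 \<in> components (e - {m e}) \<and> ?c 1 = m e"
    using T' by (cases rule: side_cases[of T' 1]) (use b in \<open>auto simp: numeral_2_eq_2\<close>)
  have s2: "\<exists>e. e \<in> EQ \<and> P.ed T' 2 \<in> components (e - {m e}) \<and> ?c 3 = m e"
    using T' by (cases rule: side_cases[of T' 2]) (use b in \<open>auto simp: numeral_eq_Suc\<close>)
  have s3: "\<exists>T. T \<in> Q.TT \<and> P.ed T' 3 = chord T"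
    using T' by (cases rule: side_cases[of T' 3]) (use b in \<open>auto simp: numeral_eq_Suc\<close>)
  have s4: "\<exists>e. e \<in> EQ \<and> P.ed T' 4 \<in> components (e - {m e}) \<and> ?c 4 = m e"
    using T' by (cases rule: side_cases[of T' 4]) (use b b5 in \<open>auto simp: numeral_eq_Suc\<close>)
  obtain e1 where e1: "e1 \<in> EQ" "P.ed T' 0 \<in> components (e1 - {m e1})" "?c 1 = m e1" using s0 by blast
  obtain e1' where e1': "e1' \<in> EQ" "P.ed T' 1 \<in> components (e1' - {m e1'})" "?c 1 = m e1'" using s1 by blast
  obtain e2 where e2: "e2 \<in> EQ" "P.ed T' 2 \<in> components (e2 - {m e2})" "?c 3 = m e2" using s2 by blast
  obtain e4 where e4: "e4 \<in> EQ" "P.ed T' 4 \<in> components (e4 - {m e4})" "?c 4 = m e4" using s4 by blast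
  obtain T where T: "T \<in> Q.TT" "P.ed T' 3 = chord T" using s3 by blast
  have "e1' = e1" using m_inj e1 e1' by metis
  note e1' = e1'[unfolded this]
  have k0: "closure (P.ed T' 0) - P.ed T' 0 = {?c 0, m e1}" using cl[of 0] e1(3) by simp
  have k1: "closure (P.ed T' 1) - P.ed T' 1 = {?c 2, m e1}" using cl[of 1] e1(3) by (auto simp: numeral_2_eq_2)
  have k2: "closure (P.ed T' 2) - P.ed T' 2 = {?c 2, m e2}" using cl[of 2] e2(3) by (simp add: numeral_eq_Suc)
  have k3: "closure (P.ed T' 3) - P.ed T' 3 = {?c 3, ?c 4}" using cl[of 3] by (simp add: numeral_eq_Suc)
  have k4: "closure (P.ed T' 4) - P.ed T' 4 = {?c 0, m e4}" using cl[of 4] e4(3) c5 by (auto simp: numeral_eq_Suc)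
  have d34: "?c 3 \<noteq> ?c 4"
    using k3 chord_ends[OF T(1)] unfolding T(2) by (auto simp: doubleton_eq_iff)
  have d02: "?c 0 \<noteq> ?c 2"
  proof (cases "P.ed T' 0 = P.ed T' 1")
    case True
    then show ?thesis using fold[of 0 1] cN[OF b(1,2)] by simp
  next
    case False
    then show ?thesis using half_same_end[OF e1(1,2) e1'(2) _ k0 k1] cV[OF b(1)] by simp
  qed
  have d13: "?c 1 \<noteq> ?c 3"
  proof
    assume "?c 1 = ?c 3"
    then have "e2 = e1" using m_inj[OF e2(1) e1(1)] e1(3) e2(3) by simp
    then have "P.ed T' 1 = P.ed T' 2" using half_unique[OF e1(1) e1'(2) _ k1 _ cV[OF b(3)]] e2 k2 by simp
    then show False using fold[of 1 2] cN[OF b(3,2)] by (simp add: eq_commute)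
  qed
  have d14: "?c 1 \<noteq> ?c 4"
  proof
    assume "?c 1 = ?c 4"
    then have "e4 = e1" using m_inj[OF e4(1) e1(1)] e1(3) e4(3) by simp
    then have "P.ed T' 4 = P.ed T' 0" using half_unique[OF e1(1) _ e1(2) _ k0 cV[OF b(1)]] e4 k4 by simp
    then show False using fold[of 4 0] cN[OF b(1,5)] by (simp add: eq_commute)
  qed
  have five: "{..<5::nat} = {0, 1, 2, 3, 4}" by auto
  have "distinct [?c 0, ?c 1, ?c 2, ?c 3, ?c 4]"
    using d34 d02 d13 d14 cN[OF b(1,2)] cN[OF b(1,4)] cN[OF b(1,5)] cN[OF b(3,2)] cN[OF b(3,4)] cN[OF b(3,5)]
    by auto
  then show "inj_on ?c {..<5}" unfolding five by (auto simp: inj_on_def)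
qed

end

lemma kap_add: "kap n (z + w) = kap n z * kap n w"
  by (simp add: kap_def distrib_left exp_add)

lemma corner_mod: "n > 0 \<Longrightarrow> corner n (i mod n) = corner n i"
proof -
  assume n: "n > 0"
  have "of_nat i = (of_nat (i mod n) :: complex) + of_int (int (i div n)) * of_nat n"
    by (metis add.commute div_mult_mod_eq of_int_of_nat_eq of_nat_add of_nat_mult)
  then show ?thesis unfolding corner_kap using kap_eq_iff[OF n] by metis
qed

lemma corner_rotate: "n > 0 \<Longrightarrow> corner n r * corner n i = corner n ((r + i) mod n)"
  by (simp add: corner_mod) (simp add: corner_kap flip: kap_add)

lemma side_mod: "n > 0 \<Longrightarrow> side n (i mod n) = side n i"
proof -
  assume n: "n > 0"
  have "kap n (of_nat (i mod n) + of_real t) = kap n (of_nat i + of_real t)" for t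
    using corner_mod[OF n, of i] by (simp add: kap_add corner_kap)
  then show ?thesis by (simp add: side_kap01)
qed

lemma side_rotate: "n > 0 \<Longrightarrow> (\<lambda>z. corner n r * z) ` side n i = side n ((r + i) mod n)"
  unfolding side_mod by (simp add: side_kap01 image_image corner_kap add.assoc flip: kap_add)

text \<open>Serves both kinds of symmetry of the model polygon: rotations normalize where the bullet
  pattern starts, reflections reverse a tile.\<close>

lemma polygon_map_reparametrize:
  assumes f: "polygon_map V E n f T"
    and r: "homeomorphism (ball 0 1) (ball 0 1) r r'" "continuous_on UNIV r" "r ` cball 0 1 \<subseteq> cball 0 1" "inj r"
    and k: "\<And>i. i < n \<Longrightarrow> \<exists>i'<n. r (corner n i) = corner n i'" "\<And>i. i < n \<Longrightarrow> \<exists>i'<n. r ` side n i = side n i'"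
  shows "polygon_map V E n (f \<circ> r) T"
proof -
  obtain g where "homeomorphism (ball 0 1) T f g" using f unfolding polygon_map_def by blast
  then have "\<exists>g. homeomorphism (ball 0 1) T (f \<circ> r) g"
    using homeomorphism_compose[OF r(1)] by blast
  moreover have "continuous_on (cball 0 1) (f \<circ> r)"
    using f r(3) by (intro continuous_on_compose continuous_on_subset[OF r(2)]) (auto simp: polygon_map_def intro: continuous_on_subset)
  moreover have "(f \<circ> r) (corner n i) \<in> V \<and> inj_on (f \<circ> r) (side n i) \<and> (f \<circ> r) ` side n i \<in> E" if i: "i < n" for i
  proof -
    obtain a b where ab: "a < n" "r (corner n i) = corner n a" "b < n" "r ` side n i = side n b" using k[OF i] by metis
    have 1: "f (r (corner n i)) \<in> V" using f ab(1) unfolding polygon_map_def ab(2) by blast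
    have 2: "inj_on f (r ` side n i)" "f ` r ` side n i \<in> E"
      using f ab(3) unfolding polygon_map_def ab(4) by blast+
    show ?thesis using 1 2(2) comp_inj_on[OF inj_on_subset[OF r(4) subset_UNIV] 2(1)] by (simp add: image_comp)
  qed
  ultimately show ?thesis unfolding polygon_map_def by blast
qed

lemma polygon_map_rotate:
  assumes "polygon_map V E n f T" "n > 0"
  shows "polygon_map V E n (f \<circ> (\<lambda>z. corner n r * z)) T"
proof (rule polygon_map_reparametrize[OF assms(1)])
  have nr: "norm (corner n r) = 1" by (simp add: corner_def)
  then have c0: "corner n r \<noteq> 0" by auto
  show "homeomorphism (ball 0 1) (ball 0 1) (\<lambda>z. corner n r * z) (\<lambda>z. inverse (corner n r) * z)"
    using c0 nr by (intro homeomorphismI continuous_intros) (auto simp: norm_mult norm_inverse)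
  show "(\<lambda>z. corner n r * z) ` cball 0 1 \<subseteq> cball 0 1" using nr by (auto simp: norm_mult)
  show "inj (\<lambda>z. corner n r * z)" using c0 by (auto simp: inj_on_def)
  show "continuous_on UNIV (\<lambda>z. corner n r * z)" by (intro continuous_intros)
  fix i
  have i: "(r + i) mod n < n" using assms(2) by simp
  show "\<exists>i'<n. corner n r * corner n i = corner n i'" using i corner_rotate[OF assms(2)] by blast
  show "\<exists>i'<n. (\<lambda>z. corner n r * z) ` side n i = side n i'" using i side_rotate[OF assms(2)] by blast
qed

context pent_subdivision begin

lemma tile_type_P1:
  assumes T': "T' \<in> P.TT"
  shows "type_P1 VQ V E T'"
proof -
  obtain r where r: "r < 5" "bullet T' r" "\<not> bullet T' ((r+1) mod 5)" "bullet T' ((r+2) mod 5)" "\<not> bullet T' ((r+3) mod 5)" "\<not> bullet T' ((r+4) mod 5)"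
    using T' by (rule bullet_pattern)
  let ?g = "g T' \<circ> (\<lambda>z. corner 5 r * z)"
  \<comment> \<open>The rotated map lets the pattern start at corner \<open>0\<close>; interpreting
    the locale anew with the changed family makes \<open>nondegenerate\<close> applicable.\<close>
  let ?G = "g(T' := ?g)"
  have pm: "polygon_map V E 5 ?g T'" by (rule polygon_map_rotate[OF P.pm[OF T']]) simp
  interpret R: pent_subdivision S VQ EQ f V E ?G m k c A
  proof unfold_locales
    fix T assume "T \<in> P.TT"
    then show "polygon_map V E 5 (?G T) T" using pm P.pm by auto
  qed ((rule P.surf P.graph P.n3 atlas V_eq E_eq | (rule deg3 m_in kT c_arc c_ball c_start c_finish used, assumption))+)
  have cr: "?g (corner 5 i) = P.cor T' ((r + i) mod 5)" for i
    unfolding P.cor_def using corner_rotate[of 5 r i] by simp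
  have b: "R.bullet T' i = bullet T' ((r + i) mod 5)" for i
    unfolding R.bullet_def bullet_def R.P.cor_def using cr by simp
  have "inj_on (?G T') (sphere 0 1)"
    by (rule R.nondegenerate[OF T']) (use r b in auto)
  then have "inj_on ?g (sphere 0 1)" by simp
  then show ?thesis unfolding type_P1_def using pm cr r
    by (intro exI[of _ ?g] conjI) (simp_all add: bullet_def)
qed

end

theorem subdivision_imp_labelling:
  fixes S :: "'a::t2_space set" and VQ :: "'a set" and EQ :: "'a set set"
  assumes S: "closed_surface S" "orientable_surface S" and P: "pentagonal_tiling S V E"
    and Q: "quadrilateral_tiling S VQ EQ" and sub: "simple_pentagonal_subdivision S VQ EQ V E"
  shows "VQ \<subseteq> V \<and> (\<forall>v\<in>V - VQ. vertex_degree E v = 3) \<and> (\<forall>T\<in>tiles S V E. type_P1 VQ V E T)"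
proof -
  obtain A where A: "oriented_atlas S A" using S(2) unfolding orientable_surface_def oriented_atlas_def by blast
  obtain g where g: "\<And>T. T \<in> tiles S V E \<Longrightarrow> polygon_map V E 5 (g T) T"
    using P unfolding polygonal_tiling_def by metis
  from sub obtain m f k c where sub':
    "\<And>e. e\<in>EQ \<Longrightarrow> m e \<in> e"
    "\<And>T. T\<in>tiles S VQ EQ \<Longrightarrow> polygon_map VQ EQ 4 (f T) T \<and> k T \<in> {0, 1} \<and>
           arc (c T) \<and> c T ` {0<..<1} \<subseteq> ball 0 1 \<and>
           pathstart (c T) \<in> side 4 (k T) \<and>
           f T (pathstart (c T)) = m (f T ` side 4 (k T)) \<and>
           pathfinish (c T) \<in> side 4 (k T + 2) \<and>
           f T (pathfinish (c T)) = m (f T ` side 4 (k T + 2))"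
    "\<And>e. e\<in>EQ \<Longrightarrow> card {(T, j). T \<in> tiles S VQ EQ \<and> j \<in> {k T, k T + 2} \<and> f T ` side 4 j = e} = 1"
    "V = VQ \<union> m ` EQ"
    "E = (\<Union>e\<in>EQ. components (e - {m e})) \<union> (\<lambda>T. f T ` c T ` {0<..<1}) ` tiles S VQ EQ"
    unfolding simple_pentagonal_subdivision_def by blast
  have q: "\<And>T. T\<in>tiles S VQ EQ \<Longrightarrow> polygon_map VQ EQ 4 (f T) T"
    "\<And>T. T\<in>tiles S VQ EQ \<Longrightarrow> k T \<in> {0, 1}"
    "\<And>T. T\<in>tiles S VQ EQ \<Longrightarrow> arc (c T)"
    "\<And>T. T\<in>tiles S VQ EQ \<Longrightarrow> c T ` {0<..<1} \<subseteq> ball 0 1"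
    "\<And>T. T\<in>tiles S VQ EQ \<Longrightarrow> pathstart (c T) \<in> side 4 (k T)"
    "\<And>T. T\<in>tiles S VQ EQ \<Longrightarrow> f T (pathstart (c T)) = m (f T ` side 4 (k T))"
    "\<And>T. T\<in>tiles S VQ EQ \<Longrightarrow> pathfinish (c T) \<in> side 4 (k T + 2)"
    "\<And>T. T\<in>tiles S VQ EQ \<Longrightarrow> f T (pathfinish (c T)) = m (f T ` side 4 (k T + 2))"
    using sub'(2) by blast+
  interpret pent_subdivision S VQ EQ f V E g m k c A
  proof unfold_locales
    show "closed_surface S" by (rule S(1))
    show "embedded_graph S VQ EQ" using Q by (simp add: polygonal_tiling_def tiling_def)
    show "embedded_graph S V E" using P by (simp add: polygonal_tiling_def tiling_def)
    show "\<And>v. v \<in> V \<Longrightarrow> 3 \<le> vertex_degree E v" using P by (simp add: polygonal_tiling_def tiling_def)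
  qed ((rule A sub'(4,5) | (rule g q sub'(1,3), assumption) | simp)+)
  show ?thesis
  proof (intro conjI ballI)
    show "VQ \<subseteq> V" using V_eq by blast
    show "type_P1 VQ V E T" if "T \<in> tiles S V E" for T using that by (rule tile_type_P1)
    fix v assume "v \<in> V - VQ"
    then obtain e where "e \<in> EQ" "v = m e" using V_eq by blast
    then show "vertex_degree E v = 3" using degree_midpoint by simp
  qed
qed

section \<open>From a labelling to the graph of the quadrilateral tiling\<close>

text \<open>The polygon maps witness the type of the tiles, so in every tile corner \<open>1\<close>
  is the vertex between the bullets and side \<open>3\<close> is the only side without
  bullets.\<close>

locale labelled = ptiling S V E 5 f for S :: "'a::t2_space set" and V E f +
  fixes L :: "'a set"
  assumes LV: "L \<subseteq> V"
    and deg3: "\<And>v. v \<in> V - L \<Longrightarrow> vertex_degree E v = 3"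
    and deg_ge: "\<And>v. v \<in> V \<Longrightarrow> vertex_degree E v \<ge> 3"
    and nondeg: "\<And>T. T \<in> TT \<Longrightarrow> inj_on (f T) (sphere 0 1)"
    and lab: "\<And>T. T \<in> TT \<Longrightarrow> cor T 0 \<in> L" "\<And>T. T \<in> TT \<Longrightarrow> cor T 1 \<notin> L" "\<And>T. T \<in> TT \<Longrightarrow> cor T 2 \<in> L"
      "\<And>T. T \<in> TT \<Longrightarrow> cor T 3 \<notin> L" "\<And>T. T \<in> TT \<Longrightarrow> cor T 4 \<notin> L"
begin

text \<open>Edges with exactly one bullet are the half edges of the quadrilateral tiling, the others are the
  arcs inside the quadrilaterals.\<close>

definition half_at :: "'a \<Rightarrow> 'a set set" where
  "half_at u = {h \<in> E. u \<in> closure h - h \<and> closure h \<inter> L \<noteq> {}}"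

definition merged :: "'a \<Rightarrow> 'a set" where
  "merged u = insert u (\<Union>(half_at u))"

definition chords :: "'a set set" where
  "chords = {e \<in> E. closure e \<inter> L = {}}"

lemma cor_neq: "T \<in> TT \<Longrightarrow> i < 5 \<Longrightarrow> j < 5 \<Longrightarrow> i \<noteq> j \<Longrightarrow> cor T i \<noteq> cor T j"
  using inj_onD[OF nondeg, of T "corner 5 i" "corner 5 j"] corner_in_sphere corner_inj unfolding cor_def by metis

lemma f_inj: assumes T: "T \<in> TT" shows "inj_on (f T) (cball 0 1)"
proof (rule inj_onI)
  fix z w :: complex assume a: "z \<in> cball 0 1" "w \<in> cball 0 1" "f T z = f T w"
  consider "z \<in> ball 0 1" | "w \<in> ball 0 1" | "z \<in> sphere 0 1" "w \<in> sphere 0 1" using cball_cases a by blast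
  then show "z = w"
  proof cases
    case 1 then show ?thesis using f_interior_unique(2)[OF T T 1 a(2,3)] by simp
  next
    case 2 then show ?thesis using f_interior_unique(2)[OF T T 2 a(1)] a(3) by simp
  next
    case 3 then show ?thesis using inj_onD[OF nondeg[OF T] a(3)] by simp
  qed
qed

lemma cor5: "cor T 5 = cor T 0"
  using cor_n[of T] by simp

lemma cor_Suc_neq: "T \<in> TT \<Longrightarrow> j < 5 \<Longrightarrow> cor T j \<noteq> cor T (Suc j)"
  using cor_neq[of T j "Suc j"] cor_neq[of T 4 0] cor5[of T]
  by (cases "j = 4") (auto simp: eval_nat_numeral)

lemma ed_ends: "T \<in> TT \<Longrightarrow> j < 5 \<Longrightarrow> closure (ed T j) - ed T j = {cor T j, cor T (Suc j)}"
  by (rule ed_closure)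

lemma ends_at_ed:
  assumes "T \<in> TT" "j < 5"
  shows "edge_ends_at (ed T j) v = of_bool (cor T j = v) + of_bool (cor T (Suc j) = v)"
  unfolding edge_ends_at_pair[OF ed_ends[OF assms] cor_Suc_neq[OF assms]]
  using cor_Suc_neq[OF assms] by auto

lemma ends_at_E: "e \<in> E \<Longrightarrow> edge_ends_at e v = of_bool (v \<in> closure e - e)"
proof -
  assume e: "e \<in> E"
  obtain T j where T: "T \<in> TT" "j < 5" "ed T j = e" using e by (rule sides_of_nonempty)
  show ?thesis
    unfolding T(3)[symmetric] edge_ends_at_pair[OF ed_ends[OF T(1,2)] cor_Suc_neq[OF T(1,2)]] ed_ends[OF T(1,2)]
    by simp
qed

lemma ed_L: "T \<in> TT \<Longrightarrow> j < 5 \<Longrightarrow> closure (ed T j) \<inter> L = {cor T j, cor T (Suc j)} \<inter> L"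
  using ed_ends[of T j] edge_V[OF ed_E[of T j]] LV by blast

lemma ed_V: "T \<in> TT \<Longrightarrow> j < 5 \<Longrightarrow> ed T j \<inter> V = {}"
  using edge_V[OF ed_E[of T j]] by blast

lemma less5: "j < 5 \<Longrightarrow> j = 0 \<or> j = 1 \<or> j = 2 \<or> j = 3 \<or> j = (4::nat)"
  by auto

lemma ed_chord: 
  assumes "T \<in> TT" "j < 5"
  shows "ed T j \<in> chords \<longleftrightarrow> j = 3"
proof -
  have "ed T j \<in> chords \<longleftrightarrow> cor T j \<notin> L \<and> cor T (Suc j) \<notin> L"
    unfolding chords_def using ed_E[OF assms] ed_L[OF assms] by auto
  then show ?thesis using less5[OF assms(2)] lab[OF assms(1)] cor5[of T] by (auto simp: eval_nat_numeral)
qed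

lemma chords_E: "chords \<subseteq> E" by (auto simp: chords_def)

text \<open>The factor \<open>2\<close> is \<open>card_sides_of\<close>.\<close>

lemma double_count:
  assumes F: "F \<subseteq> E"
  shows "2 * (\<Sum>e\<in>F. edge_ends_at e u) = (\<Sum>p\<in>{p \<in> TT \<times> {..<5}. ed (fst p) (snd p) \<in> F}. edge_ends_at (ed (fst p) (snd p)) u)"
proof -
  let ?S = "{p \<in> TT \<times> {..<5}. ed (fst p) (snd p) \<in> F}"
  let ?h = "\<lambda>p. edge_ends_at (ed (fst p) (snd p)) u"
  have fin: "finite ?S" using finite_tiles by simp
  have "sum ?h ?S = (\<Sum>e\<in>F. sum ?h {p \<in> ?S. ed (fst p) (snd p) = e})"
    by (rule sum.group[symmetric, OF fin finite_subset[OF F finite_E]]) auto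
  also have "\<dots> = (\<Sum>e\<in>F. 2 * edge_ends_at e u)"
  proof (rule sum.cong[OF refl])
    fix e assume e: "e \<in> F"
    have "{p \<in> ?S. ed (fst p) (snd p) = e} = sides_of e" using e by (auto simp: sides_of_def)
    moreover have "sum ?h (sides_of e) = (\<Sum>p\<in>sides_of e. edge_ends_at e u)"
      by (rule sum.cong) (auto simp: sides_of_def)
    moreover have "e \<in> E" using e F by blast
    ultimately show "sum ?h {p \<in> ?S. ed (fst p) (snd p) = e} = 2 * edge_ends_at e u"
      using card_sides_of by simp
  qed
  finally show ?thesis by (simp add: sum_distrib_left)
qed

lemma sum5: "(\<Sum>j<5. h j) = h 0 + h 1 + h 2 + h 3 + (h (4::nat) :: nat)"
  by (simp add: eval_nat_numeral lessThan_Suc)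

definition apex_count :: "'a \<Rightarrow> nat" where "apex_count u = (\<Sum>T\<in>TT. of_bool (cor T 1 = u))"
definition base_count :: "'a \<Rightarrow> nat" where "base_count u = (\<Sum>T\<in>TT. of_bool (cor T 3 = u) + of_bool (cor T 4 = u))"

text \<open>Each tile corner at \<open>u\<close> contributes two edge ends to the sum over all
  sides, which balances the double count of edges. Corners \<open>0\<close> and \<open>2\<close> are
  bullets and cannot be \<open>u\<close>.\<close>

lemma count_deg:
  assumes "u \<in> V - L"
  shows "apex_count u + base_count u = 3"
proof -
  have "{p \<in> TT \<times> {..<5}. ed (fst p) (snd p) \<in> E} = TT \<times> {..<5}" using ed_E by auto
  then have "2 * vertex_degree E u = (\<Sum>p\<in>TT \<times> {..<5}. edge_ends_at (ed (fst p) (snd p)) u)"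
    unfolding vertex_degree_def using double_count[of E u] by simp
  also have "\<dots> = (\<Sum>T\<in>TT. \<Sum>j<5. edge_ends_at (ed T j) u)"
    by (simp add: sum.cartesian_product case_prod_unfold)
  also have "\<dots> = (\<Sum>T\<in>TT. 2 * (of_bool (cor T 1 = u) + (of_bool (cor T 3 = u) + of_bool (cor T 4 = u))))"
  proof (rule sum.cong[OF refl])
    fix T assume T: "T \<in> TT"
    have ne: "cor T 0 \<noteq> u" "cor T 2 \<noteq> u" "cor T 5 \<noteq> u" using lab[OF T] assms cor5[of T] by auto
    have e: "edge_ends_at (ed T 0) u = of_bool (cor T 0 = u) + of_bool (cor T 1 = u)"
      "edge_ends_at (ed T 1) u = of_bool (cor T 1 = u) + of_bool (cor T 2 = u)"
      "edge_ends_at (ed T 2) u = of_bool (cor T 2 = u) + of_bool (cor T 3 = u)"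
      "edge_ends_at (ed T 3) u = of_bool (cor T 3 = u) + of_bool (cor T 4 = u)"
      "edge_ends_at (ed T 4) u = of_bool (cor T 4 = u) + of_bool (cor T 5 = u)"
      using ends_at_ed[OF T, of 0 u] ends_at_ed[OF T, of 1 u] ends_at_ed[OF T, of 2 u] ends_at_ed[OF T, of 3 u] ends_at_ed[OF T, of 4 u]
      by (simp_all add: eval_nat_numeral)
    show "(\<Sum>j<5. edge_ends_at (ed T j) u) = 2 * (of_bool (cor T 1 = u) + (of_bool (cor T 3 = u) + of_bool (cor T 4 = u)))"
      unfolding sum5 e using ne by simp
  qed
  also have "\<dots> = 2 * (apex_count u + base_count u)" by (simp add: apex_count_def base_count_def sum_distrib_left sum.distrib)
  finally show ?thesis using deg3[OF assms] by simp
qed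

text \<open>The edges without bullets are the sides \<open>3\<close>, with ends at corners
  \<open>3\<close> and \<open>4\<close>. The factor \<open>2\<close> supplies the parity of
  \<open>base_count\<close>.\<close>

lemma count_chords: "2 * (\<Sum>e\<in>chords. edge_ends_at e u) = base_count u"
proof -
  have "{p \<in> TT \<times> {..<5}. ed (fst p) (snd p) \<in> chords} = (\<lambda>T. (T, 3)) ` TT"
    using ed_chord by auto
  then have "2 * (\<Sum>e\<in>chords. edge_ends_at e u) = (\<Sum>p\<in>(\<lambda>T. (T, 3)) ` TT. edge_ends_at (ed (fst p) (snd p)) u)"
    using double_count[OF chords_E, of u] by simp
  also have "\<dots> = (\<Sum>T\<in>TT. edge_ends_at (ed T 3) u)"
    by (subst sum.reindex) (auto simp: inj_on_def)
  also have "\<dots> = base_count u" unfolding base_count_def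
  proof (rule sum.cong[OF refl])
    fix T assume "T \<in> TT"
    then show "edge_ends_at (ed T 3) u = of_bool (cor T 3 = u) + of_bool (cor T 4 = u)"
      using ends_at_ed[of T 3 u] by (simp add: eval_nat_numeral)
  qed
  finally show ?thesis .
qed

lemma cor_U: "T \<in> TT \<Longrightarrow> cor T 1 \<in> V - L" "T \<in> TT \<Longrightarrow> cor T 3 \<in> V - L" "T \<in> TT \<Longrightarrow> cor T 4 \<in> V - L"
  using lab cor_V by auto

lemma sum_of_bool_one:
  assumes "finite A" "x \<in> A"
  shows "(\<Sum>u\<in>A. of_bool (x = u)) = (1::nat)"
proof -
  have "A \<inter> {u. x = u} = {x}" using assms(2) by auto
  then show ?thesis using assms(1) by (simp add: sum_of_bool_eq)
qed

text \<open>\<open>base_count u\<close> is even, so \<open>apex_count u + base_count u = 3\<close> leaves \<open>(1, 2)\<close> and \<open>(3, 0)\<close>; the latter is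
  excluded because both sides of \<open>base_count u \<le> 2 * apex_count u\<close> have the same sum.\<close>

lemma counts:
  assumes u: "u \<in> V - L"
  shows "apex_count u = 1" "base_count u = 2"
proof -
  have fin: "finite (V - L)" using finite_V by simp
  have le: "base_count v \<le> 2 * apex_count v" if "v \<in> V - L" for v
    using count_deg[OF that] count_chords[of v] by presburger
  have 1: "(\<Sum>v\<in>V - L. apex_count v) = card TT"
  proof -
    have "(\<Sum>v\<in>V - L. apex_count v) = (\<Sum>T\<in>TT. \<Sum>v\<in>V - L. of_bool (cor T 1 = v))"
      unfolding apex_count_def by (rule sum.swap)
    also have "\<dots> = (\<Sum>T\<in>TT. 1)" by (rule sum.cong[OF refl sum_of_bool_one[OF fin cor_U(1)]])
    finally show ?thesis by simp
  qed
  have 2: "(\<Sum>v\<in>V - L. base_count v) = 2 * card TT"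
  proof -
    have "(\<Sum>v\<in>V - L. base_count v) = (\<Sum>T\<in>TT. \<Sum>v\<in>V - L. of_bool (cor T 3 = v) + of_bool (cor T 4 = v))"
      unfolding base_count_def by (rule sum.swap)
    also have "\<dots> = (\<Sum>T\<in>TT. 1 + 1)"
      unfolding sum.distrib
      by (rule arg_cong2[where f = "(+)", OF sum.cong[OF refl sum_of_bool_one[OF fin cor_U(2)]] sum.cong[OF refl sum_of_bool_one[OF fin cor_U(3)]]])
    finally show ?thesis by simp
  qed
  have "(\<Sum>v\<in>V - L. base_count v) = (\<Sum>v\<in>V - L. 2 * apex_count v)" using 1 2 by (simp flip: sum_distrib_left)
  \<comment> \<open>A termwise inequality between finite sums of equal value is an equality in each
    term.\<close>
  then have "base_count u = 2 * apex_count u" by (rule sum_mono_inv[OF _ le u fin])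
  then show "apex_count u = 1" "base_count u = 2" using count_deg[OF u] by linarith+
qed

lemma tile_of:
  assumes "u \<in> V - L"
  obtains T where "T \<in> TT" "cor T 1 = u"
proof -
  have "(\<Sum>T\<in>TT. of_bool (cor T 1 = u)) \<noteq> (0::nat)" using counts(1)[OF assms] by (simp add: apex_count_def)
  then obtain T where "T \<in> TT" "of_bool (cor T 1 = u) \<noteq> (0::nat)" by (meson sum.neutral)
  then show ?thesis using that[of T] by (cases "cor T 1 = u") auto
qed

lemma tile_of_unique:
  assumes "T \<in> TT" "T' \<in> TT" "cor T 1 = cor T' 1"
  shows "T = T'"
proof -
  have "card (TT \<inter> {U. cor U 1 = cor T 1}) = 1"
    using counts(1)[OF cor_U(1)[OF assms(1)]] finite_tiles by (simp add: apex_count_def sum_of_bool_eq)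
  then obtain X where "TT \<inter> {U. cor U 1 = cor T 1} = {X}" by (rule card_1_singletonE)
  moreover have "T \<in> TT \<inter> {U. cor U 1 = cor T 1}" "T' \<in> TT \<inter> {U. cor U 1 = cor T 1}" using assms by auto
  ultimately show ?thesis by auto
qed

text \<open>By \<open>count_chords\<close>, \<open>base_count u = 2\<close> leaves a single end of
  an arc at \<open>u\<close>.\<close>

lemma chord_unique:
  assumes "e \<in> chords" "e' \<in> chords" "u \<in> closure e - e" "u \<in> closure e' - e'" "u \<in> V - L"
  shows "e = e'"
proof -
  have fin: "finite chords" using finite_subset[OF chords_E finite_E] .
  have "(\<Sum>e\<in>chords. edge_ends_at e u) = 1" using count_chords[of u] counts(2)[OF assms(5)] by simp
  moreover have "(\<Sum>e\<in>chords. edge_ends_at e u) = (\<Sum>e\<in>chords. of_bool (u \<in> closure e - e))"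
    by (rule sum.cong[OF refl]) (use ends_at_E chords_E in blast)
  ultimately have "card (chords \<inter> {e. u \<in> closure e - e}) = 1" using fin by (simp add: sum_of_bool_eq)
  then obtain X where "chords \<inter> {e. u \<in> closure e - e} = {X}" by (rule card_1_singletonE)
  moreover have "e \<in> chords \<inter> {e. u \<in> closure e - e}" "e' \<in> chords \<inter> {e. u \<in> closure e - e}" using assms by auto
  ultimately show ?thesis by auto
qed

text \<open>Of the three edge ends at an unlabelled vertex one belongs to an arc, so two half edges
  remain; sides \<open>0\<close> and \<open>1\<close> of the tile are two such, different because
  the tile is non-degenerate.\<close>

lemma half_at_tile:
  assumes T: "T \<in> TT"
  shows "half_at (cor T 1) = {ed T 0, ed T 1}" "ed T 0 \<noteq> ed T 1"
proof -
  let ?u = "cor T 1"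
  have u: "?u \<in> V - L" by (rule cor_U(1)[OF T])
  have c0: "closure (ed T 0) - ed T 0 = {cor T 0, cor T 1}" using ed_ends[OF T, of 0] by simp
  have c1: "closure (ed T 1) - ed T 1 = {cor T 1, cor T 2}" using ed_ends[OF T, of 1] by (simp add: eval_nat_numeral)
  show ne: "ed T 0 \<noteq> ed T 1"
  proof
    assume "ed T 0 = ed T 1"
    then have "{cor T 0, cor T 1} = {cor T 1, cor T 2}" using c0 c1 by simp
    then show False using cor_neq[OF T, of 0 2] cor_neq[OF T, of 0 1] by (auto simp: doubleton_eq_iff)
  qed
  have fin: "finite (E - chords)" using finite_E by simp
  have "vertex_degree E ?u = (\<Sum>e\<in>chords. edge_ends_at e ?u) + (\<Sum>e\<in>E - chords. edge_ends_at e ?u)"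
    unfolding vertex_degree_def using sum.subset_diff[OF chords_E finite_E] by (simp add: add.commute)
  then have "(\<Sum>e\<in>E - chords. edge_ends_at e ?u) = 2"
    using deg3[OF u] count_chords[of ?u] counts(2)[OF u] by simp
  moreover have "(\<Sum>e\<in>E - chords. edge_ends_at e ?u) = (\<Sum>e\<in>E - chords. of_bool (?u \<in> closure e - e))"
    by (rule sum.cong[OF refl]) (use ends_at_E in blast)
  ultimately have c: "card ((E - chords) \<inter> {e. ?u \<in> closure e - e}) = 2" using fin by (simp add: sum_of_bool_eq)
  have h: "half_at ?u = (E - chords) \<inter> {e. ?u \<in> closure e - e}"
    unfolding half_at_def chords_def by blast
  have "ed T 0 \<in> half_at ?u" "ed T 1 \<in> half_at ?u"
    unfolding h using ed_E[OF T] ed_chord[OF T] c0 c1 by auto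
  then have "{ed T 0, ed T 1} \<subseteq> half_at ?u" by simp
  moreover have "card {ed T 0, ed T 1} = card (half_at ?u)" using c h ne by simp
  moreover have "finite (half_at ?u)" unfolding half_at_def using finite_E by simp
  ultimately show "half_at ?u = {ed T 0, ed T 1}" by (metis card_subset_eq)
qed

lemma half_at_ed:
  assumes "T \<in> TT" "j < 5" "j \<noteq> 3" "u \<in> V - L" "u = cor T j \<or> u = cor T (Suc j)"
  shows "ed T j \<in> half_at u"
proof -
  have "closure (ed T j) \<inter> L \<noteq> {}" using ed_chord[OF assms(1,2)] ed_E[OF assms(1,2)] assms(3) by (auto simp: chords_def)
  then show ?thesis unfolding half_at_def using ed_E[OF assms(1,2)] ed_ends[OF assms(1,2)] assms(5) by auto
qed

lemma merged_tile:
  assumes T: "T \<in> TT"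
  shows "merged (cor T 1) = f T ` (\<lambda>t. kap 5 (of_real t)) ` {0<..<2}"
proof -
  have "{0<..<2::real} = {0<..<1} \<union> {1} \<union> {1<..<2}" by auto
  then have "f T ` (\<lambda>t. kap 5 (of_real t)) ` {0<..<2} = ed T 0 \<union> {cor T 1} \<union> ed T 1"
    by (simp only: image_Un ed_def side_kap cor_def corner_kap) simp
  then show ?thesis unfolding merged_def half_at_tile(1)[OF T] by auto
qed

definition quad_edges :: "'a set set" where
  "quad_edges = merged ` (V - L)"

lemma merged_subset: "u \<in> V - L \<Longrightarrow> merged u \<inter> L = {}"
proof -
  assume u: "u \<in> V - L"
  obtain T where T: "T \<in> TT" "cor T 1 = u" using u by (rule tile_of)
  have "ed T 0 \<inter> V = {}" "ed T 1 \<inter> V = {}" using ed_V[OF T(1)] by auto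
  then show ?thesis unfolding merged_def T(2)[symmetric] half_at_tile(1)[OF T(1)] using cor_U(1)[OF T(1)] LV by auto
qed

lemma merged_V: "u \<in> V - L \<Longrightarrow> merged u \<inter> V = {u}"
proof -
  assume u: "u \<in> V - L"
  obtain T where T: "T \<in> TT" "cor T 1 = u" using u by (rule tile_of)
  have "ed T 0 \<inter> V = {}" "ed T 1 \<inter> V = {}" using ed_V[OF T(1)] by auto
  then show ?thesis unfolding merged_def T(2)[symmetric] half_at_tile(1)[OF T(1)] using cor_U(1)[OF T(1)] by auto
qed

lemma merged_inj: "u \<in> V - L \<Longrightarrow> u' \<in> V - L \<Longrightarrow> merged u = merged u' \<Longrightarrow> u = u'"
  using merged_V by (metis singleton_inject)

text \<open>The other end of a half edge is a bullet.\<close>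

lemma half_one_end:
  assumes "h \<in> half_at u" "h \<in> half_at u'" "u \<in> V - L" "u' \<in> V - L"
  shows "u = u'"
proof -
  obtain T where T: "T \<in> TT" "cor T 1 = u" using assms(3) by (rule tile_of)
  have h: "h = ed T 0 \<or> h = ed T 1" using assms(1) half_at_tile(1)[OF T(1)] T(2) by auto
  have "closure h - h = {cor T 0, cor T 1} \<or> closure h - h = {cor T 1, cor T 2}"
    using h ed_ends[OF T(1), of 0] ed_ends[OF T(1), of 1] by (auto simp: eval_nat_numeral)
  moreover have "u' \<in> closure h - h" using assms(2) by (simp add: half_at_def)
  ultimately have "u' \<in> {cor T 0, cor T 1} \<or> u' \<in> {cor T 1, cor T 2}" by metis
  then show ?thesis using lab[OF T(1)] assms(4) T(2) by auto
qed

lemma merged_disjoint: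
  assumes "u \<in> V - L" "u' \<in> V - L" "x \<in> merged u" "x \<in> merged u'"
  shows "u = u'"
proof (cases "x \<in> V")
  case True
  then show ?thesis using merged_V[OF assms(1)] merged_V[OF assms(2)] assms(3,4) by auto
next
  case False
  then obtain h h' where h: "h \<in> half_at u" "x \<in> h" "h' \<in> half_at u'" "x \<in> h'"
    using assms unfolding merged_def by auto
  then have "h = h'" using edge_unique[of h h' x] by (simp add: half_at_def)
  then show ?thesis using half_one_end h assms(1,2) by blast
qed

text \<open>The whole merged edge is on the boundary of one tile, from corner \<open>0\<close> to
  corner \<open>2\<close>. Non-degeneracy makes this boundary path an arc; the factor
  \<open>2\<close> rescales it to the unit interval.\<close>

lemma merged_path:
  assumes T: "T \<in> TT"
  obtains p where "arc p" "path_image p \<subseteq> S" "pathstart p = cor T 0" "pathfinish p = cor T 2" "merged (cor T 1) = p ` {0<..<1}"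
proof -
  let ?p = "\<lambda>t. f T (kap 5 (of_real (2 * t)))"
  have k: "kap 5 (of_real x) \<in> cball 0 1" for x using kap_in_cball[of 5 "of_real x"] by simp
  have "continuous_on {0..1} ?p"
  proof (rule continuous_on_compose2[OF f_cont[OF T]])
    show "(\<lambda>t. kap 5 (of_real (2 * t))) ` {0..1} \<subseteq> cball 0 1" using k by blast
  qed (intro continuous_intros)
  moreover have "inj_on ?p {0..1}"
  proof (rule inj_onI)
    fix x y :: real assume xy: "x \<in> {0..1}" "y \<in> {0..1}" "?p x = ?p y"
    have "kap 5 (of_real (2 * x)) = kap 5 (of_real (2 * y))"
      using inj_onD[OF f_inj[OF T] xy(3) k k] .
    then have "complex_of_real (2 * x) = of_real (2 * y)"
      by (rule kap_inj_strip) (use xy in auto)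
    then show "x = y" by simp
  qed
  ultimately have "arc ?p" by (simp add: arc_def path_def)
  moreover have "path_image ?p \<subseteq> S" unfolding path_image_def
  proof
    fix y assume "y \<in> ?p ` {0..1}"
    then obtain x where "y = f T (kap 5 (of_real (2 * x)))" by blast
    then show "y \<in> S" using f_cball_S[OF T] k[of "2 * x"] by blast
  qed
  moreover have "pathstart ?p = cor T 0" "pathfinish ?p = cor T 2"
    by (simp_all add: pathstart_def pathfinish_def cor_def corner_kap)
  moreover have "merged (cor T 1) = ?p ` {0<..<1}"
  proof -
    have "{0<..<2} = (\<lambda>t. 2 * t) ` {0<..<1::real}"
      by (auto intro!: image_eqI[of _ _ "x / 2" for x])
    then show ?thesis unfolding merged_tile[OF T] by (simp add: image_image)
  qed
  ultimately show ?thesis by (rule that)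
qed

lemma merged_closure:
  assumes T: "T \<in> TT"
  shows "closure (merged (cor T 1)) - merged (cor T 1) = {cor T 0, cor T 2}"
proof -
  obtain p where p: "arc p" "path_image p \<subseteq> S" "pathstart p = cor T 0" "pathfinish p = cor T 2" "merged (cor T 1) = p ` {0<..<1}"
    using T by (rule merged_path)
  have "closure (merged (cor T 1)) = p ` {0..1}"
    unfolding p(5) using p(1) by (intro closure_open_arc) (auto simp: arc_def path_def)
  also have "{0..1::real} = insert 0 (insert 1 {0<..<1})" by auto
  finally have "closure (merged (cor T 1)) = insert (cor T 0) (insert (cor T 2) (merged (cor T 1)))"
    using p(3-5) by (simp add: pathstart_def pathfinish_def)
  moreover have "cor T 0 \<notin> merged (cor T 1)" "cor T 2 \<notin> merged (cor T 1)"
    using merged_subset[OF cor_U(1)[OF T]] lab[OF T] by auto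
  ultimately show ?thesis by auto
qed

lemma quad_graph: "embedded_graph S L quad_edges"
  unfolding embedded_graph_def
proof (intro conjI ballI)
  show "finite L" using LV finite_V by (rule finite_subset)
  show "L \<subseteq> S" using LV graph by (auto simp: embedded_graph_def)
  show "finite quad_edges" unfolding quad_edges_def using finite_V by simp
  show "pairwise disjnt quad_edges"
  proof (rule pairwiseI)
    fix e e' assume "e \<in> quad_edges" "e' \<in> quad_edges" "e \<noteq> e'"
    then obtain u u' where "u \<in> V - L" "u' \<in> V - L" "e = merged u" "e' = merged u'" "u \<noteq> u'"
      unfolding quad_edges_def by blast
    then show "disjnt e e'" using merged_disjoint unfolding disjnt_iff by blast
  qed
  fix e assume "e \<in> quad_edges"
  then obtain u where u: "u \<in> V - L" "e = merged u" unfolding quad_edges_def by blast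
  obtain T where T: "T \<in> TT" "cor T 1 = u" using u(1) by (rule tile_of)
  obtain p where p: "arc p" "path_image p \<subseteq> S" "pathstart p = cor T 0" "pathfinish p = cor T 2" "merged (cor T 1) = p ` {0<..<1}"
    using T(1) by (rule merged_path)
  show "graph_edge S L e" unfolding graph_edge_def
  proof (intro exI conjI)
    show "simple_path p" using p(1) by (rule arc_imp_simple_path)
    show "e = p ` {0<..<1}" using u T p(5) by simp
    show "e \<inter> L = {}" using u merged_subset by simp
  qed (use p lab[OF T(1)] in auto)
qed

lemma tile_bij: "bij_betw (\<lambda>T. cor T 1) TT (V - L)"
  unfolding bij_betw_def
proof
  show "inj_on (\<lambda>T. cor T 1) TT" using tile_of_unique by (auto intro: inj_onI)
  show "(\<lambda>T. cor T 1) ` TT = V - L" using tile_of cor_U(1) by blast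
qed

text \<open>A half edge has one unlabelled end, and it is side \<open>0\<close> or \<open>1\<close>
  of the tile whose corner \<open>1\<close> is that end. In particular this accounts for the half
  edges met as sides \<open>2\<close> and \<open>4\<close>.\<close>

lemma halves_bij: "bij_betw (\<lambda>p. ed (fst p) (snd p)) (TT \<times> {0, 1}) (E - chords)"
  unfolding bij_betw_def
proof
  show "inj_on (\<lambda>p. ed (fst p) (snd p)) (TT \<times> {0, 1})"
  proof (rule inj_onI)
    fix p q assume a: "p \<in> TT \<times> {0, 1}" "q \<in> TT \<times> {0::nat, 1}" "ed (fst p) (snd p) = ed (fst q) (snd q)"
    obtain T i T' i' where pq: "p = (T, i)" "q = (T', i')" by (metis surj_pair)
    have b: "T \<in> TT" "i = 0 \<or> i = 1" "T' \<in> TT" "i' = 0 \<or> i' = 1" "ed T i = ed T' i'" using a pq by auto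
    have "ed T i \<in> half_at (cor T 1)" "ed T i \<in> half_at (cor T' 1)"
      unfolding half_at_tile(1)[OF b(1)] half_at_tile(1)[OF b(3)] using b by auto
    then have "cor T 1 = cor T' 1" using half_one_end cor_U(1) b by blast
    then have "T = T'" using tile_of_unique b by blast
    moreover then have "i = i'" using b half_at_tile(2)[OF b(1)] by auto
    ultimately show "p = q" using pq by simp
  qed
  show "(\<lambda>p. ed (fst p) (snd p)) ` (TT \<times> {0, 1}) = E - chords"
  proof (intro equalityI subsetI)
    fix h assume "h \<in> (\<lambda>p. ed (fst p) (snd p)) ` (TT \<times> {0, 1})"
    then obtain p where p: "p \<in> TT \<times> {0, 1}" "h = ed (fst p) (snd p)" by blast
    obtain T i where Ti: "p = (T, i)" by (metis surj_pair)
    have "T \<in> TT" "i = 0 \<or> i = (1::nat)" "h = ed T i" using p Ti by auto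
    then show "h \<in> E - chords" using ed_E ed_chord by auto
  next
    fix h assume h: "h \<in> E - chords"
    then have "h \<in> E" by simp
    then obtain T j where T: "T \<in> TT" "j < 5" "ed T j = h" by (rule sides_of_nonempty)
    have j3: "j \<noteq> 3" using ed_chord[OF T(1,2)] T(3) h by auto
    have "\<exists>u. u \<in> V - L \<and> (u = cor T j \<or> u = cor T (Suc j))"
      using less5[OF T(2)] j3 cor_U[OF T(1)] by (auto simp: eval_nat_numeral)
    then obtain u where u: "u \<in> V - L" "u = cor T j \<or> u = cor T (Suc j)" by blast
    have hu: "h \<in> half_at u" using half_at_ed[OF T(1,2) j3 u] T(3) by simp
    obtain T' where T': "T' \<in> TT" "cor T' 1 = u" using u(1) by (rule tile_of)
    then have "h = ed T' 0 \<or> h = ed T' 1" using hu half_at_tile(1)[OF T'(1)] by auto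
    then show "h \<in> (\<lambda>p. ed (fst p) (snd p)) ` (TT \<times> {0, 1})" using T'(1) by force
  qed
qed

text \<open>The ends of a merged edge are the bullet ends of its two halves, and edges without
  bullets contribute nothing at a bullet.\<close>

lemma quad_degree:
  assumes v: "v \<in> L"
  shows "vertex_degree quad_edges v = vertex_degree E v"
proof -
  have "vertex_degree quad_edges v = (\<Sum>u\<in>V - L. edge_ends_at (merged u) v)"
    unfolding vertex_degree_def quad_edges_def using merged_inj by (subst sum.reindex) (auto simp: inj_on_def)
  also have "\<dots> = (\<Sum>T\<in>TT. edge_ends_at (merged (cor T 1)) v)"
    by (rule sum.reindex_bij_betw[OF tile_bij, symmetric])
  also have "\<dots> = (\<Sum>T\<in>TT. \<Sum>i\<in>{0, 1}. edge_ends_at (ed T i) v)"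
  proof (rule sum.cong[OF refl])
    fix T assume T: "T \<in> TT"
    have "cor T 1 \<noteq> v" using lab(2)[OF T] v by auto
    moreover have "edge_ends_at (merged (cor T 1)) v = of_bool (cor T 0 = v) + of_bool (cor T 2 = v)"
      using edge_ends_at_pair[OF merged_closure[OF T]] cor_neq[OF T, of 0 2] by auto
    ultimately show "edge_ends_at (merged (cor T 1)) v = (\<Sum>i\<in>{0, 1}. edge_ends_at (ed T i) v)"
      using ends_at_ed[OF T, of 0 v] ends_at_ed[OF T, of 1 v] by (simp add: eval_nat_numeral)
  qed
  also have "\<dots> = (\<Sum>p\<in>TT \<times> {0, 1}. edge_ends_at (ed (fst p) (snd p)) v)"
    by (simp only: sum.cartesian_product case_prod_unfold)
  also have "\<dots> = (\<Sum>h\<in>E - chords. edge_ends_at h v)"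
    by (rule sum.reindex_bij_betw[OF halves_bij])
  also have "\<dots> = (\<Sum>h\<in>E. edge_ends_at h v)"
  proof (rule sum.mono_neutral_left[OF finite_E])
    show "\<forall>i\<in>E - (E - chords). edge_ends_at i v = 0"
      using v by (auto simp: chords_def edge_ends_at_def)
  qed simp
  finally show ?thesis by (simp add: vertex_degree_def)
qed

lemma half_components:
  assumes u: "u \<in> V - L"
  shows "components (merged u - {u}) = half_at u"
proof -
  obtain T where T: "T \<in> TT" "cor T 1 = u" using u by (rule tile_of)
  have E: "ed T 0 \<in> E" "ed T 1 \<in> E" using ed_E[OF T(1)] by auto
  have "u \<notin> ed T 0" "u \<notin> ed T 1" using edge_V E u by blast+
  then have "merged u - {u} = ed T 0 \<union> ed T 1"
    unfolding merged_def T(2)[symmetric] half_at_tile(1)[OF T(1)] by auto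
  moreover have "components (ed T 0 \<union> ed T 1) = {ed T 0, ed T 1}"
  proof (rule components_two)
    have ne: "ed T 0 \<noteq> ed T 1" by (rule half_at_tile(2)[OF T(1)])
    show "closure (ed T 0) \<inter> ed T 1 = {}" using embedded_edge_closure_disjoint[OF graph E(2,1)] ne by auto
    show "ed T 0 \<inter> closure (ed T 1) = {}" using embedded_edge_closure_disjoint[OF graph E(1,2)] ne by auto
  qed (use embedded_edge_facts(2,3)[OF graph] E in auto)
  ultimately show ?thesis using half_at_tile(1)[OF T(1)] T(2) by simp
qed

lemma E_halves: "(\<Union>u\<in>V - L. half_at u) = E - chords"
proof (intro equalityI subsetI)
  fix h assume "h \<in> (\<Union>u\<in>V - L. half_at u)"
  then show "h \<in> E - chords" by (auto simp: half_at_def chords_def)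
next
  fix h assume "h \<in> E - chords"
  then have "h \<in> (\<lambda>p. ed (fst p) (snd p)) ` (TT \<times> {0, 1})" using halves_bij by (simp add: bij_betw_def)
  then obtain p where p: "p \<in> TT \<times> {0, 1}" "h = ed (fst p) (snd p)" by blast
  obtain T i where Ti: "p = (T, i)" by (metis surj_pair)
  have T: "T \<in> TT" "i = 0 \<or> i = (1::nat)" "h = ed T i" using p Ti by auto
  then have "h \<in> half_at (cor T 1)" using half_at_tile(1)[OF T(1)] by auto
  then show "h \<in> (\<Union>u\<in>V - L. half_at u)" using cor_U(1)[OF T(1)] by blast
qed

lemma quad_graph_union: "L \<union> \<Union>quad_edges = V \<union> \<Union>(E - chords)"
proof -
  have "\<Union>quad_edges = (V - L) \<union> \<Union>(\<Union>u\<in>V - L. half_at u)" unfolding quad_edges_def merged_def by auto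
  then show ?thesis unfolding E_halves using LV by auto
qed

lemma merged_two_sides:
  assumes u: "u \<in> V - L" and h: "h \<in> half_at u" "h' \<in> half_at u" "h \<noteq> h'"
  shows "merged u = h \<union> {u} \<union> h'"
proof -
  obtain T where T: "T \<in> TT" "cor T 1 = u" using u by (rule tile_of)
  have "half_at u = {ed T 0, ed T 1}" using half_at_tile(1)[OF T(1)] T(2) by simp
  then have "half_at u = {h, h'}" using h by auto
  then show ?thesis unfolding merged_def by auto
qed

text \<open>A half edge at \<open>u\<close> is already a side of the tile whose middle vertex is \<open>u\<close>; this leaves only one
  more side for it.\<close>

lemma half_sides_distinct:
  assumes u: "u \<in> V - L" and a: "T \<in> TT" "j \<in> {2, 4}" "T' \<in> TT" "j' \<in> {2, 4}" "(T, j) \<noteq> (T', j')"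
    and h: "ed T j \<in> half_at u"
  shows "ed T j \<noteq> ed T' j'"
proof
  assume e: "ed T j = ed T' j'"
  obtain T3 where T3: "T3 \<in> TT" "cor T3 1 = u" using u by (rule tile_of)
  then have "ed T j = ed T3 0 \<or> ed T j = ed T3 1" using h half_at_tile(1)[OF T3(1)] by auto
  then obtain i where i: "i = 0 \<or> i = (1::nat)" "ed T j = ed T3 i" by auto
  have "{(T3, i), (T, j), (T', j')} \<subseteq> sides_of (ed T j)"
    using T3 i a e by (auto simp: sides_of_def)
  moreover have "(T3, i) \<noteq> (T, j)" "(T3, i) \<noteq> (T', j')" using a i by auto
  then have "card {(T3, i), (T, j), (T', j')} = 3" using a(5) by (simp only: card_insert_if finite.intros) simp
  ultimately show False using card_mono[of "sides_of (ed T j)" "{(T3, i), (T, j), (T', j')}"] sides_of_le_2[of "ed T j"] by simp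
qed

text \<open>The second side over an edge without bullets is again a side \<open>3\<close>; a tile
  has one such side, so it belongs to another tile.\<close>

lemma partner:
  assumes T: "T \<in> TT"
  obtains T' where "T' \<in> TT" "T' \<noteq> T" "ed T' 3 = ed T 3" "\<forall>U\<in>TT. ed U 3 = ed T 3 \<longrightarrow> U = T \<or> U = T'"
proof -
  have eE: "ed T 3 \<in> E" using ed_E[OF T] by simp
  have TS: "(T, 3) \<in> sides_of (ed T 3)" using T by (simp add: sides_of_def)
  obtain p q where pq: "sides_of (ed T 3) = {p, q}" "p \<noteq> q" using card_sides_of[OF eE] by (auto simp: card_2_iff)
  then obtain r where r: "r \<in> sides_of (ed T 3)" "r \<noteq> (T, 3)" by (metis insert_iff)
  obtain T' j where T'j: "r = (T', j)" by (metis surj_pair)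
  have T': "T' \<in> TT" "j < 5" "ed T' j = ed T 3" using r T'j by (auto simp: sides_of_def)
  have "j = 3" using ed_chord[OF T'(1,2)] ed_chord[OF T, of 3] T'(3) by simp
  have so: "sides_of (ed T 3) = {(T, 3), (T', 3)}"
    using sides_of_two[OF eE TS r(1)] r(2) T'j \<open>j = 3\<close> by auto
  show ?thesis
  proof (rule that[of T'])
    show "T' \<noteq> T" using r(2) T'j \<open>j = 3\<close> by auto
    show "ed T' 3 = ed T 3" using T'(3) \<open>j = 3\<close> by simp
    show "\<forall>U\<in>TT. ed U 3 = ed T 3 \<longrightarrow> U = T \<or> U = T'"
    proof (intro ballI impI)
      fix U assume "U \<in> TT" "ed U 3 = ed T 3"
      then have "(U, 3) \<in> sides_of (ed T 3)" by (simp add: sides_of_def)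
      then show "U = T \<or> U = T'" unfolding so by auto
    qed
  qed (rule T')
qed

end

section \<open>Gluing two pentagons along a side\<close>

definition half_disc :: "complex set" where
  "half_disc = {z. norm z \<le> 1 \<and> 0 \<le> Im z}"

text \<open>Every vertical chord of the upper half disc is stretched to the full chord of the disc.\<close>

definition stretch :: "complex \<Rightarrow> complex" where
  "stretch z = Complex (Re z) (2 * Im z - sqrt (1 - (Re z)\<^sup>2))"

lemma norm_le_1_iff: "norm z \<le> 1 \<longleftrightarrow> (Im z)\<^sup>2 \<le> 1 - (Re z)\<^sup>2"
  by (simp add: cmod_def algebra_simps)

lemma norm_eq_1_iff: "norm z = 1 \<longleftrightarrow> (Im z)\<^sup>2 = 1 - (Re z)\<^sup>2"
  by (auto simp: cmod_def algebra_simps)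

lemma norm_le_1_Re: "norm (z::complex) \<le> 1 \<Longrightarrow> (Re z)\<^sup>2 \<le> 1 \<and> -1 \<le> Re z \<and> Re z \<le> 1"
  using abs_Re_le_cmod[of z] by (auto simp: abs_le_iff power2_le_iff_abs_le abs_square_le_1)

lemma continuous_on_stretch: "continuous_on A stretch"
  unfolding stretch_def by (intro continuous_intros)

lemma inj_stretch: "inj_on stretch A"
  by (rule inj_onI) (auto simp: stretch_def complex_eq_iff)

lemma stretch_half_disc: "stretch ` half_disc = cball 0 1"
proof (intro equalityI subsetI)
  fix w assume "w \<in> stretch ` half_disc"
  then obtain z where z: "norm z \<le> 1" "0 \<le> Im z" "w = stretch z" by (auto simp: half_disc_def)
  let ?s = "sqrt (1 - (Re z)\<^sup>2)"
  have s: "?s\<^sup>2 = 1 - (Re z)\<^sup>2" "?s \<ge> 0" using norm_le_1_Re[OF z(1)] by auto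
  have "Im z \<le> ?s" using z(1) unfolding norm_le_1_iff by (rule real_le_rsqrt)
  then have "\<bar>2 * Im z - ?s\<bar> \<le> ?s" using z(2) by auto
  then have "(2 * Im z - ?s)\<^sup>2 \<le> ?s\<^sup>2" by (rule abs_le_square_iff[THEN iffD1, OF order_trans]) simp
  then have "norm w \<le> 1" unfolding norm_le_1_iff z(3) using s(1) by (simp add: stretch_def)
  then show "w \<in> cball 0 1" by simp
next
  fix w :: complex assume "w \<in> cball 0 1"
  then have w: "norm w \<le> 1" by simp
  let ?s = "sqrt (1 - (Re w)\<^sup>2)"
  have s: "?s\<^sup>2 = 1 - (Re w)\<^sup>2" "?s \<ge> 0" using norm_le_1_Re[OF w] by auto
  have "\<bar>Im w\<bar> \<le> ?s" using w unfolding norm_le_1_iff by (simp add: real_le_rsqrt)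
  then have a: "- ?s \<le> Im w" "Im w \<le> ?s" by auto
  let ?z = "Complex (Re w) ((Im w + ?s) / 2)"
  have "((Im w + ?s) / 2)\<^sup>2 \<le> ?s\<^sup>2" using a by (intro power_mono) auto
  then have "norm ?z \<le> 1" unfolding norm_le_1_iff using s(1) by simp
  then have "?z \<in> half_disc" using a by (simp add: half_disc_def)
  moreover have "stretch ?z = w" by (simp add: stretch_def complex_eq_iff add_divide_distrib)
  ultimately show "w \<in> stretch ` half_disc" by (metis image_eqI)
qed

text \<open>With \<open>?s\<close> half the length of the vertical chord,
  \<open>2 * Im z - ?s\<close> is \<open>-?s\<close> or \<open>?s\<close> exactly at the two ends of
  the upper half chord.\<close>

lemma stretch_sphere_iff:
  assumes "z \<in> half_disc"
  shows "norm (stretch z) = 1 \<longleftrightarrow> Im z = 0 \<or> norm z = 1"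
proof -
  let ?s = "sqrt (1 - (Re z)\<^sup>2)"
  have z: "norm z \<le> 1" "0 \<le> Im z" using assms by (auto simp: half_disc_def)
  have s: "?s\<^sup>2 = 1 - (Re z)\<^sup>2" "?s \<ge> 0" using norm_le_1_Re[OF z(1)] by auto
  have "norm (stretch z) = 1 \<longleftrightarrow> (2 * Im z - ?s)\<^sup>2 = ?s\<^sup>2"
    unfolding norm_eq_1_iff using s(1) by (simp add: stretch_def)
  also have "\<dots> \<longleftrightarrow> Im z = 0 \<or> Im z = ?s" by (auto simp: power2_eq_iff)
  also have "Im z = ?s \<longleftrightarrow> (Im z)\<^sup>2 = ?s\<^sup>2" by (rule power2_eq_iff_nonneg[OF z(2) s(2), symmetric])
  finally show ?thesis unfolding norm_eq_1_iff s(1) .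
qed

lemma stretch_circle: "norm z = 1 \<Longrightarrow> 0 \<le> Im z \<Longrightarrow> stretch z = z"
proof -
  assume "norm z = 1" "0 \<le> Im z"
  then have "sqrt (1 - (Re z)\<^sup>2) = Im z" unfolding norm_eq_1_iff by (metis real_sqrt_unique)
  then show ?thesis by (simp add: stretch_def complex_eq_iff)
qed

text \<open>Alexander's trick: the cone over a map of the circle.\<close>

definition radial :: "(complex \<Rightarrow> complex) \<Rightarrow> complex \<Rightarrow> complex" where
  "radial \<beta> z = of_real (norm z) * \<beta> (sgn z)"

lemma norm_radial:
  assumes "\<forall>w\<in>sphere 0 1. norm (\<beta> w) = 1"
  shows "norm (radial \<beta> z) = norm z"
  using bspec[OF assms, of "sgn z"] by (cases "z = 0") (auto simp: radial_def norm_mult norm_sgn)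

lemma radial_circle: "norm z = 1 \<Longrightarrow> radial \<beta> z = \<beta> z"
  by (simp add: radial_def sgn_eq)

text \<open>Away from \<open>0\<close> the map is composed of continuous ones; at \<open>0\<close>
  continuity comes from preservation of the norm.\<close>

lemma continuous_radial:
  assumes c: "continuous_on (sphere 0 1) \<beta>" and n: "\<forall>w\<in>sphere 0 1. norm (\<beta> w) = 1"
  shows "continuous_on A (radial \<beta>)"
proof -
  have "isCont (radial \<beta>) z" for z
  proof (cases "z = 0")
    case True
    have "((\<lambda>w::complex. norm w) \<longlongrightarrow> 0) (at 0)" using tendsto_norm_zero[OF tendsto_ident_at] .
    then have "(radial \<beta> \<longlongrightarrow> 0) (at 0)"
      by (rule Lim_null_comparison[rotated]) (simp add: norm_radial[OF n])
    then show ?thesis using True by (simp add: isCont_def radial_def)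
  next
    case False
    have "continuous_on (-{0}) (radial \<beta>)" unfolding radial_def sgn_eq
      by (intro continuous_intros continuous_on_compose2[OF c]) (auto simp: norm_divide split: if_splits)
    then show ?thesis using False by (simp add: continuous_on_eq_continuous_at open_Compl)
  qed
  then show ?thesis by (simp add: continuous_at_imp_continuous_on)
qed

lemma inj_radial:
  assumes i: "inj_on \<beta> (sphere 0 1)" and n: "\<forall>w\<in>sphere 0 1. norm (\<beta> w) = 1"
  shows "inj_on (radial \<beta>) A"
proof (rule inj_onI)
  fix z w assume e: "radial \<beta> z = radial \<beta> w"
  then have nn: "norm z = norm w" using norm_radial[OF n] by metis
  show "z = w"
  proof (cases "z = 0")
    case True then show ?thesis using nn by simp
  next
    case False
    then have wz: "w \<noteq> 0" using nn by auto
    have "\<beta> (sgn z) = \<beta> (sgn w)" using e nn False wz by (simp add: radial_def)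
    then have "sgn z = sgn w" using inj_onD[OF i] False wz by (simp add: norm_sgn)
    moreover have "z = of_real (norm z) * sgn z" "w = of_real (norm w) * sgn w"
      using False wz by (simp_all add: sgn_eq)
    ultimately show ?thesis using nn by metis
  qed
qed

lemma radial_surj:
  assumes s: "\<beta> ` sphere 0 1 = sphere 0 1" and w: "w \<noteq> 0"
  obtains z where "radial \<beta> z = w"
proof -
  have "sgn w \<in> \<beta> ` sphere 0 1" unfolding s using w by (simp add: norm_sgn)
  then obtain v where v: "v \<in> sphere 0 1" "\<beta> v = sgn w" by (metis imageE)
  have "norm v = 1" using v by simp
  then have "sgn (of_real (norm w) * v) = v" using w by (simp add: sgn_eq norm_mult)
  then have "radial \<beta> (of_real (norm w) * v) = w"
    using v w by (simp add: radial_def norm_mult sgn_eq)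
  then show ?thesis by (rule that)
qed

lemma radial_image:
  assumes n: "\<forall>w\<in>sphere 0 1. norm (\<beta> w) = 1" and s: "\<beta> ` sphere 0 1 = sphere 0 1"
  shows "radial \<beta> ` cball 0 1 = cball 0 1" "radial \<beta> ` ball 0 1 = ball 0 1"
proof -
  have ex: "\<exists>z. radial \<beta> z = w \<and> norm z = norm w" for w
  proof (cases "w = 0")
    case True then show ?thesis by (intro exI[of _ 0]) (simp add: radial_def)
  next
    case False
    then obtain z where "radial \<beta> z = w" by (rule radial_surj[OF s])
    then show ?thesis using norm_radial[OF n] by metis
  qed
  show "radial \<beta> ` cball 0 1 = cball 0 1"
  proof (intro equalityI subsetI)
    fix w :: complex assume "w \<in> cball 0 1"
    moreover obtain z where "radial \<beta> z = w" "norm z = norm w" using ex by blast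
    ultimately show "w \<in> radial \<beta> ` cball 0 1" by (intro image_eqI[of _ _ z]) auto
  qed (use norm_radial[OF n] in auto)
  show "radial \<beta> ` ball 0 1 = ball 0 1"
  proof (intro equalityI subsetI)
    fix w :: complex assume "w \<in> ball 0 1"
    moreover obtain z where "radial \<beta> z = w" "norm z = norm w" using ex by blast
    ultimately show "w \<in> radial \<beta> ` ball 0 1" by (intro image_eqI[of _ _ z]) auto
  qed (use norm_radial[OF n] in auto)
qed

text \<open>Positions on the boundary circle in units of sides, with the corners at the
  integers.\<close>

definition kr :: "nat \<Rightarrow> real \<Rightarrow> complex" where
  "kr n t = kap n (of_real t)"

lemma kr_norm [simp]: "norm (kr n t) = 1"
  by (simp add: norm_kap kr_def)

lemma kr_period: "n > 0 \<Longrightarrow> kr n (t + real n) = kr n t"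
  using kap_shift[of n "of_real t"] by (simp add: kr_def)

lemma kr_inj: "kr n s = kr n t \<Longrightarrow> n > 0 \<Longrightarrow> \<bar>s - t\<bar> < real n \<Longrightarrow> s = t"
  using kap_inj_strip[of n "of_real s" "of_real t"] by (simp add: kr_def)

lemma kr_eqD:
  assumes "kr n s = kr n t" "n > 0"
  obtains m :: int where "s = t + of_int m * real n"
proof -
  obtain m :: int where "complex_of_real s = of_real t + of_int m * of_nat n"
    using assms kap_eq_iff[OF assms(2)] by (auto simp: kr_def)
  then have "s = t + of_int m * real n" by (simp add: complex_eq_iff)
  then show ?thesis by (rule that)
qed

lemma continuous_on_kr [continuous_intros]:
  "continuous_on A g \<Longrightarrow> continuous_on A (\<lambda>x. kr n (g x))"
  unfolding kr_def by (intro continuous_intros)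

lemma unit_cis:
  assumes "norm w = 1" "0 \<le> Im w"
  shows "w = cis (arccos (Re w))"
proof -
  have r: "-1 \<le> Re w" "Re w \<le> 1" using norm_le_1_Re[of w] assms by auto
  have "sin (arccos (Re w)) = sqrt (1 - (Re w)\<^sup>2)" using r by (intro sin_arccos) auto
  also have "\<dots> = Im w" using assms unfolding norm_eq_1_iff by (metis real_sqrt_unique)
  finally show ?thesis using r by (simp add: complex_eq_iff)
qed

text \<open>The inverse of \<open>f\<close> turns the wanted boundary map \<open>b\<close> into a
  homeomorphism \<open>\<beta>\<close> of the circle, which is coned to the disc;
  \<open>stretch\<close> has moved the diameter to the lower half circle before. The parametrization
  \<open>\<alpha>\<close> of side \<open>3\<close> is left free, so that two pentagons can be given
  matching diameters.\<close>

lemma half_filling: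
  fixes f :: "complex \<Rightarrow> 'a::t2_space"
  assumes f: "continuous_on (cball 0 1) f" "inj_on f (cball 0 1)"
    and a: "continuous_on {-1..1} \<alpha>" "inj_on \<alpha> {-1..1}" "\<alpha> ` {-1..1} = f ` kr 5 ` {3..4}"
      "\<alpha> 1 = f (kr 5 4)" "\<alpha> (-1) = f (kr 5 3)"
  obtains G where "continuous_on half_disc G" "inj_on G half_disc" "G ` half_disc = f ` cball 0 1"
    "G ` {z. norm z < 1 \<and> 0 < Im z} = f ` ball 0 1"
    "\<And>x. -1 \<le> x \<Longrightarrow> x \<le> 1 \<Longrightarrow> G (of_real x) = \<alpha> x"
    "\<And>\<phi>. 0 \<le> \<phi> \<Longrightarrow> \<phi> \<le> pi \<Longrightarrow> G (cis \<phi>) = f (kr 5 (4 + 4 * \<phi> / pi))"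
proof -
  let ?S = "sphere (0::complex) 1"
  \<comment> \<open>The upper half circle runs through the four sides from position \<open>4\<close>
    to position \<open>8\<close> at constant speed, the lower one carries \<open>\<alpha>\<close>.
    They agree at \<open>1\<close> and \<open>-1\<close> because position \<open>8\<close> is corner
    \<open>3\<close>.\<close>
  define b where "b w = (if 0 \<le> Im w then f (kr 5 (4 + 4 * arccos (Re w) / pi)) else \<alpha> (Re w))" for w
  have kS: "kr 5 t \<in> cball 0 1" for t using kr_norm[of 5 t] by simp
  have SRe: "-1 \<le> Re w" "Re w \<le> 1" if "w \<in> ?S" for w using norm_le_1_Re[of w] that by auto
  have low: "b w = \<alpha> (Re w)" if "w \<in> ?S" "Im w \<le> 0" for w
  proof (cases "Im w = 0")
    case True
    then have "(Re w)\<^sup>2 = 1" using that norm_eq_1_iff[of w] by simp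
    then have "Re w = 1 \<or> Re w = -1" by (simp add: power2_eq_1_iff)
    then show ?thesis
    proof
      assume "Re w = 1"
      then show ?thesis using a(4) True by (simp add: b_def)
    next
      assume "Re w = -1"
      moreover have "kr 5 (4 + 4) = kr 5 3" using kr_period[of 5 3] by simp
      ultimately show ?thesis using a(5) True by (simp add: b_def)
    qed
  qed (use that in \<open>simp add: b_def\<close>)
  have c1: "continuous_on (?S \<inter> {w. 0 \<le> Im w}) (\<lambda>w. f (kr 5 (4 + 4 * arccos (Re w) / pi)))"
  proof (rule continuous_on_compose2[OF f(1)])
    show "continuous_on (?S \<inter> {w. 0 \<le> Im w}) (\<lambda>w. kr 5 (4 + 4 * arccos (Re w) / pi))"
      using SRe by (intro continuous_intros) auto
  qed (use kS in blast)
  have c2: "continuous_on (?S \<inter> {w. Im w \<le> 0}) (\<lambda>w. \<alpha> (Re w))"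
    by (rule continuous_on_compose2[OF a(1)]) (use SRe in \<open>auto intro!: continuous_intros\<close>)
  have cb: "continuous_on ?S b"
  proof -
    have cl: "closedin (top_of_set ?S) (?S \<inter> {w. 0 \<le> Im w})" "closedin (top_of_set ?S) (?S \<inter> {w. Im w \<le> 0})"
      using closed_halfspace_Im_ge[of 0] closed_halfspace_Im_le[of 0] closedin_closed_Int by blast+
    have un: "(?S \<inter> {w. 0 \<le> Im w}) \<union> (?S \<inter> {w. Im w \<le> 0}) = ?S" by auto
    have "continuous_on ((?S \<inter> {w. 0 \<le> Im w}) \<union> (?S \<inter> {w. Im w \<le> 0}))
        (\<lambda>w. if 0 \<le> Im w then f (kr 5 (4 + 4 * arccos (Re w) / pi)) else \<alpha> (Re w))"
    proof (rule continuous_on_cases_local[OF _ _ c1 c2])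
      fix w assume "w \<in> ?S \<inter> {w. 0 \<le> Im w} \<and> \<not> 0 \<le> Im w \<or> w \<in> ?S \<inter> {w. Im w \<le> 0} \<and> 0 \<le> Im w"
      then have "w \<in> ?S" "Im w \<le> 0" "0 \<le> Im w" by auto
      then show "f (kr 5 (4 + 4 * arccos (Re w) / pi)) = \<alpha> (Re w)" using low[of w] by (simp add: b_def)
    qed (use cl un in simp_all)
    then show ?thesis unfolding un b_def .
  qed
  have acc: "0 \<le> arccos (Re w) / pi" "arccos (Re w) / pi \<le> 1" if "w \<in> ?S" for w
    using arccos_bounded[OF SRe[OF that]] by auto
  \<comment> \<open>Positions between \<open>4\<close> and \<open>8\<close> agree modulo
    \<open>5\<close> with positions between \<open>3\<close> and \<open>4\<close> only at corners
    \<open>3\<close> and \<open>4\<close>, which \<open>\<alpha>\<close> takes at the ends of the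
    diameter.\<close>
  have cross: False if "w \<in> ?S" "0 \<le> Im w" "w' \<in> ?S" "Im w' < 0" "b w = b w'" for w w'
  proof -
    define s where "s = arccos (Re w) / pi"
    have s: "0 \<le> s" "s \<le> 1" using acc[OF that(1)] by (auto simp: s_def)
    have e: "f (kr 5 (4 + 4 * s)) = \<alpha> (Re w')" using that(2,4,5) by (simp add: b_def s_def)
    have r: "Re w' \<in> {-1..1}" using SRe[OF that(3)] by simp
    then have "\<alpha> (Re w') \<in> f ` kr 5 ` {3..4}" using a(3) by blast
    then obtain t where t: "3 \<le> t" "t \<le> 4" "\<alpha> (Re w') = f (kr 5 t)" by auto
    have "kr 5 (4 + 4 * s) = kr 5 t" using inj_onD[OF f(2) _ kS kS] e t(3) by simp
    then obtain m :: int where "4 + 4 * s = t + of_int m * real 5" by (rule kr_eqD) simp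
    then have m: "4 + 4 * s = t + of_int m * 5" by simp
    then have "-1 < m" "m < 2" using s t by linarith+
    then have "m = 0 \<or> m = 1" by auto
    then have "t = 4 \<or> t = 3" using m s t by auto
    then have "\<alpha> (Re w') = \<alpha> 1 \<or> \<alpha> (Re w') = \<alpha> (-1)" using t(3) a(4,5) by auto
    then have "Re w' = 1 \<or> Re w' = -1" using inj_onD[OF a(2)] r by auto
    then have "(Im w')\<^sup>2 = 0" using that(3) norm_eq_1_iff[of w'] by auto
    then show False using that(4) by simp
  qed
  have ib: "inj_on b ?S"
  proof (rule inj_onI)
    fix w w' assume w: "w \<in> ?S" "w' \<in> ?S" "b w = b w'"
    have n1: "(Im w)\<^sup>2 = 1 - (Re w)\<^sup>2" "(Im w')\<^sup>2 = 1 - (Re w')\<^sup>2" using w norm_eq_1_iff by auto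
    consider "0 \<le> Im w" "0 \<le> Im w'" | "Im w < 0" "Im w' < 0" | "0 \<le> Im w" "Im w' < 0" | "0 \<le> Im w'" "Im w < 0"
      by linarith
    then show "w = w'"
    proof cases
      case 1
      then have "kr 5 (4 + 4 * arccos (Re w) / pi) = kr 5 (4 + 4 * arccos (Re w') / pi)"
        using inj_onD[OF f(2) _ kS kS] w(3) by (simp add: b_def)
      then have "4 + 4 * arccos (Re w) / pi = 4 + 4 * arccos (Re w') / pi"
      proof (rule kr_inj)
        have "\<bar>4 + 4 * u - (4 + 4 * v)\<bar> < real 5" if "0 \<le> u" "u \<le> 1" "0 \<le> v" "v \<le> 1" for u v :: real
          using that by auto
        from this[OF acc[OF w(1)] acc[OF w(2)]]
        show "\<bar>4 + 4 * arccos (Re w) / pi - (4 + 4 * arccos (Re w') / pi)\<bar> < real 5" by simp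
      qed simp
      then have "arccos (Re w) = arccos (Re w')" by simp
      then show ?thesis using unit_cis[of w] unit_cis[of w'] 1 w(1,2) by simp
    next
      case 2
      then have "\<alpha> (Re w) = \<alpha> (Re w')" using w by (simp add: b_def)
      then have "Re w = Re w'" using inj_onD[OF a(2)] SRe w by auto
      moreover have "Im w = Im w'"
      proof -
        have "(Im w)\<^sup>2 = (Im w')\<^sup>2" using n1 calculation by simp
        then have "Im w = Im w' \<or> Im w = - Im w'" by (simp add: power2_eq_iff)
        then show ?thesis using 2 by linarith
      qed
      ultimately show ?thesis by (simp add: complex_eq_iff)
    next
      case 3 then show ?thesis using cross w by blast
    next
      case 4 then show ?thesis using cross[of w' w] w by simp
    qed
  qed
  have imb: "b ` ?S = f ` ?S"
  proof (intro equalityI subsetI)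
    fix y assume "y \<in> b ` ?S"
    then obtain w where w: "w \<in> ?S" "y = b w" by blast
    show "y \<in> f ` ?S"
    proof (cases "0 \<le> Im w")
      case True
      then show ?thesis using w(2) kr_norm by (auto simp: b_def intro!: imageI)
    next
      case False
      then have "y \<in> \<alpha> ` {-1..1}" using w SRe by (auto simp: b_def)
      then show ?thesis unfolding a(3) using kr_norm by auto
    qed
  next
    fix y assume "y \<in> f ` ?S"
    then obtain z where z: "z \<in> ?S" "y = f z" by blast
    then obtain x where x: "kap 5 x = z" "0 \<le> Re x" "Re x < real 5" by (metis kap_surj dist_0_norm mem_sphere norm_zero zero_less_numeral zero_neq_one)
    have "Im x = 0" using z x kap_in_sphere[of 5 x] by simp
    then have xr: "x = of_real (Re x)" by (simp add: complex_eq_iff)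
    \<comment> \<open>Adding the period moves the position to the range from \<open>3\<close> to
      \<open>8\<close>: first side \<open>3\<close>, then the four other sides.\<close>
    define t where "t = (if Re x < 3 then Re x + 5 else Re x)"
    have "kr 5 (Re x) = z" unfolding kr_def using x(1) xr by simp
    then have "kr 5 t = z" using kr_period[of 5 "Re x"] by (simp add: t_def)
    then have yt: "y = f (kr 5 t)" using z by simp
    have t: "3 \<le> t" "t \<le> 8" using x by (auto simp: t_def)
    show "y \<in> b ` ?S"
    proof (cases "t \<le> 4")
      case True
      then have "y \<in> \<alpha> ` {-1..1}" unfolding a(3) using t yt by auto
      then obtain r where r: "-1 \<le> r" "r \<le> 1" "y = \<alpha> r" by auto
      let ?w = "Complex r (- sqrt (1 - r\<^sup>2))"
      have "r\<^sup>2 \<le> 1" using r by (simp add: abs_square_le_1 abs_le_iff)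
      then have "?w \<in> ?S" "Im ?w \<le> 0" using norm_eq_1_iff[of ?w] by auto
      then have "b ?w = y" using low[of ?w] r by simp
      then show ?thesis using \<open>?w \<in> ?S\<close> by blast
    next
      case False
      define p where "p = (t - 4) * pi / 4"
      have p: "0 \<le> p" "p \<le> pi" using False t by (auto simp: p_def field_simps)
      have "0 \<le> Im (cis p)" using p by (simp add: sin_ge_zero)
      then have "b (cis p) = f (kr 5 (4 + 4 * p / pi))" using p by (simp add: b_def arccos_cos)
      also have "4 + 4 * p / pi = t" by (simp add: p_def)
      finally have "b (cis p) = y" using yt by simp
      then show ?thesis by (metis image_eqI norm_cis mem_sphere dist_0_norm)
    qed
  qed
  let ?i = "inv_into (cball 0 1) f"
  obtain g where g: "homeomorphism (cball 0 1) (f ` cball 0 1) f g"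
    using homeomorphism_compact[OF _ f(1) refl f(2)] by auto
  define \<beta> where "\<beta> = g \<circ> b"
  have Sc: "?S \<subseteq> cball 0 1" by auto
  have bS: "b ` ?S \<subseteq> f ` cball 0 1" unfolding imb using Sc by blast
  have \<beta>c: "continuous_on ?S \<beta>" unfolding \<beta>_def
    by (rule continuous_on_compose[OF cb continuous_on_subset[OF homeomorphism_cont2[OF g] bS]])
  have gi: "inj_on g (f ` cball 0 1)" using homeomorphism_apply2[OF g] by (rule inj_on_inverseI)
  have \<beta>i: "inj_on \<beta> ?S" unfolding \<beta>_def by (rule comp_inj_on[OF ib inj_on_subset[OF gi bS]])
  have \<beta>s: "\<beta> ` ?S = ?S"
  proof -
    have "\<beta> ` ?S = g ` f ` ?S" unfolding \<beta>_def image_comp[symmetric] imb ..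
    also have "\<dots> = (\<lambda>z. z) ` ?S" unfolding image_image
      by (rule image_cong[OF refl]) (rule homeomorphism_apply1[OF g], use Sc in blast)
    finally show ?thesis by simp
  qed
  have \<beta>n: "\<forall>w\<in>?S. norm (\<beta> w) = 1"
  proof
    fix w assume "w \<in> ?S"
    then have "\<beta> w \<in> ?S" using \<beta>s by blast
    then show "norm (\<beta> w) = 1" by simp
  qed
  have f\<beta>: "f (\<beta> w) = b w" if "w \<in> ?S" for w
    unfolding \<beta>_def comp_def by (rule homeomorphism_apply2[OF g]) (use bS that in blast)
  define G where "G = f \<circ> (radial \<beta> \<circ> stretch)"
  have im: "(radial \<beta> \<circ> stretch) ` half_disc = cball 0 1"
    unfolding image_comp[symmetric] stretch_half_disc by (rule radial_image(1)[OF \<beta>n \<beta>s])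
  have str_ball: "stretch ` {z. norm z < 1 \<and> 0 < Im z} = ball 0 1"
  proof (intro equalityI subsetI)
    fix w assume "w \<in> stretch ` {z. norm z < 1 \<and> 0 < Im z}"
    then obtain z where z: "norm z < 1" "0 < Im z" "w = stretch z" by blast
    then have h: "z \<in> half_disc" by (simp add: half_disc_def)
    then have "w \<in> cball 0 1" using stretch_half_disc z(3) by blast
    moreover have "norm w \<noteq> 1" using stretch_sphere_iff[OF h] z by simp
    ultimately show "w \<in> ball 0 1" by simp
  next
    fix w :: complex assume w: "w \<in> ball 0 1"
    then have "w \<in> stretch ` half_disc" unfolding stretch_half_disc by simp
    then obtain z where z: "z \<in> half_disc" "w = stretch z" by blast
    have "norm (stretch z) \<noteq> 1" using w z by simp
    then have "Im z \<noteq> 0" "norm z \<noteq> 1" using stretch_sphere_iff[OF z(1)] by auto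
    then have "z \<in> {z. norm z < 1 \<and> 0 < Im z}" using z(1) by (auto simp: half_disc_def)
    then show "w \<in> stretch ` {z. norm z < 1 \<and> 0 < Im z}" using z(2) by blast
  qed
  show ?thesis
  proof (rule that[of G])
    show "continuous_on half_disc G" unfolding G_def
    proof (rule continuous_on_compose)
      show "continuous_on half_disc (radial \<beta> \<circ> stretch)"
        by (rule continuous_on_compose[OF continuous_on_stretch continuous_radial[OF \<beta>c \<beta>n]])
      show "continuous_on ((radial \<beta> \<circ> stretch) ` half_disc) f" unfolding im by (rule f(1))
    qed
    show "inj_on G half_disc" unfolding G_def
    proof (rule comp_inj_on)
      show "inj_on (radial \<beta> \<circ> stretch) half_disc"
        by (rule comp_inj_on[OF inj_stretch inj_radial[OF \<beta>i \<beta>n]])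
      show "inj_on f ((radial \<beta> \<circ> stretch) ` half_disc)" unfolding im by (rule f(2))
    qed
    show "G ` half_disc = f ` cball 0 1" unfolding G_def image_comp[symmetric] im[unfolded image_comp[symmetric]] ..
    show "G ` {z. norm z < 1 \<and> 0 < Im z} = f ` ball 0 1"
      unfolding G_def image_comp[symmetric] str_ball radial_image(2)[OF \<beta>n \<beta>s] ..
    show "G (of_real x) = \<alpha> x" if x: "-1 \<le> x" "x \<le> 1" for x
    proof -
      have "x\<^sup>2 \<le> 1" using x by (simp add: abs_square_le_1 abs_le_iff)
      have hd: "complex_of_real x \<in> half_disc" using x by (simp add: half_disc_def abs_le_iff)
      then have n: "norm (stretch (of_real x)) = 1" using stretch_sphere_iff by simp
      have "G (of_real x) = b (stretch (of_real x))"
        unfolding G_def using f\<beta> n radial_circle[OF n] by simp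
      also have "\<dots> = \<alpha> x" using low[of "stretch (of_real x)"] n \<open>x\<^sup>2 \<le> 1\<close> by (simp add: stretch_def)
      finally show ?thesis .
    qed
    show "G (cis \<phi>) = f (kr 5 (4 + 4 * \<phi> / pi))" if p: "0 \<le> \<phi>" "\<phi> \<le> pi" for \<phi>
    proof -
      have im0: "0 \<le> Im (cis \<phi>)" using p by (simp add: sin_ge_zero)
      have "stretch (cis \<phi>) = cis \<phi>" by (rule stretch_circle) (use im0 in auto)
      then have "G (cis \<phi>) = b (cis \<phi>)" unfolding G_def using f\<beta>[of "cis \<phi>"] radial_circle[of "cis \<phi>" \<beta>] by simp
      then show ?thesis using im0 p by (simp add: b_def arccos_cos)
    qed
  qed
qed

text \<open>The common side becomes the diameter through \<open>kr 4 (1/2)\<close>, the middle of side \<open>0\<close> of the model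
  square; the remaining four sides of each pentagon fill one of the two half circles, of length \<open>2\<close> in
  units of sides of the square.\<close>

lemma glue_pentagons:
  fixes f1 f2 :: "complex \<Rightarrow> 'a::t2_space"
  assumes f1: "continuous_on (cball 0 1) f1" "inj_on f1 (cball 0 1)"
    and f2: "continuous_on (cball 0 1) f2" "inj_on f2 (cball 0 1)"
    and disj: "f1 ` ball 0 1 \<inter> f2 ` cball 0 1 = {}" "f1 ` cball 0 1 \<inter> f2 ` ball 0 1 = {}"
    and arcs: "f1 ` kr 5 ` {3..4} = f2 ` kr 5 ` {3..4}" "f1 (kr 5 3) = f2 (kr 5 4)" "f1 (kr 5 4) = f2 (kr 5 3)"
  obtains F where "continuous_on (cball 0 1) F" "inj_on F (ball 0 1)"
    "F ` ball 0 1 = f1 ` ball 0 1 \<union> f1 ` kr 5 ` {3<..<4} \<union> f2 ` ball 0 1"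
    "\<forall>t. 1/2 \<le> t \<and> t \<le> 5/2 \<longrightarrow> F (kr 4 t) = f1 (kr 5 (3 + 2 * t))"
    "\<forall>t. 5/2 \<le> t \<and> t \<le> 9/2 \<longrightarrow> F (kr 4 t) = f2 (kr 5 (2 * t - 1))"
    "\<forall>x. -1 \<le> x \<and> x \<le> 1 \<longrightarrow> F (of_real x * kr 4 (1/2)) = f1 (kr 5 (3 + (1 + x) / 2))"
proof -
  \<comment> \<open>The diameter follows the common side from corner \<open>3\<close> of the first
    pentagon at \<open>-1\<close> to its corner \<open>4\<close> at \<open>1\<close>.\<close>
  define \<alpha> where "\<alpha> x = f1 (kr 5 (3 + (1 + x) / 2))" for x
  have kS: "kr 5 t \<in> cball 0 1" for t using kr_norm[of 5 t] by simp
  have ac: "continuous_on {-1..1} \<alpha>" unfolding \<alpha>_def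
    by (rule continuous_on_compose2[OF f1(1)]) (use kS in \<open>auto intro!: continuous_intros\<close>)
  have ai: "inj_on \<alpha> {-1..1}"
  proof (rule inj_onI)
    fix x y assume xy: "x \<in> {-1..1}" "y \<in> {-1..1}" "\<alpha> x = \<alpha> y"
    then have "kr 5 (3 + (1 + x) / 2) = kr 5 (3 + (1 + y) / 2)" using inj_onD[OF f1(2) _ kS kS] by (simp add: \<alpha>_def)
    then have "3 + (1 + x) / 2 = 3 + (1 + y) / 2"
      by (rule kr_inj) (use xy in \<open>auto simp: abs_if field_simps\<close>)
    then show "x = y" by simp
  qed
  have aimg: "\<alpha> ` A = f1 ` kr 5 ` ((\<lambda>x. 3 + (1 + x) / 2) ` A)" for A unfolding \<alpha>_def by (simp add: image_image)
  have i34: "(\<lambda>x::real. 3 + (1 + x) / 2) ` {-1..1} = {3..4}"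
    by (auto simp: image_iff diff_divide_distrib intro!: bexI[of _ "2 * (x - 3) - 1" for x])
  have i34': "(\<lambda>x::real. 3 + (1 + x) / 2) ` {-1<..<1} = {3<..<4}"
    by (auto simp: image_iff diff_divide_distrib intro!: bexI[of _ "2 * (x - 3) - 1" for x])
  obtain G1 where G1: "continuous_on half_disc G1" "inj_on G1 half_disc" "G1 ` half_disc = f1 ` cball 0 1"
    "G1 ` {z. norm z < 1 \<and> 0 < Im z} = f1 ` ball 0 1"
    "\<And>x. -1 \<le> x \<Longrightarrow> x \<le> 1 \<Longrightarrow> G1 (of_real x) = \<alpha> x"
    "\<And>\<phi>. 0 \<le> \<phi> \<Longrightarrow> \<phi> \<le> pi \<Longrightarrow> G1 (cis \<phi>) = f1 (kr 5 (4 + 4 * \<phi> / pi))"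
    by (rule half_filling[OF f1 ac ai]) (simp_all add: aimg i34, simp_all add: \<alpha>_def)
  have neg: "uminus ` {-1..1::real} = {-1..1}" by (auto simp: image_iff intro!: bexI[of _ "-x" for x])
  have a'c: "continuous_on {-1..1} (\<lambda>x. \<alpha> (- x))"
    by (rule continuous_on_compose2[OF ac]) (auto intro!: continuous_intros)
  have a'i: "inj_on (\<lambda>x. \<alpha> (- x)) {-1..1}"
  proof (rule inj_onI)
    fix x y assume "x \<in> {-1..1}" "y \<in> {-1..1}" "\<alpha> (- x) = \<alpha> (- y)"
    then show "x = y" using inj_onD[OF ai, of "-x" "-y"] by simp
  qed
  have a'img: "(\<lambda>x. \<alpha> (- x)) ` {-1..1} = f2 ` kr 5 ` {3..4}"
  proof -
    have "(\<lambda>x. \<alpha> (- x)) ` {-1..1} = \<alpha> ` uminus ` {-1..1}" by (simp only: image_image)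
    then show ?thesis unfolding neg aimg i34 arcs(1) .
  qed
  obtain G2 where G2: "continuous_on half_disc G2" "inj_on G2 half_disc" "G2 ` half_disc = f2 ` cball 0 1"
    "G2 ` {z. norm z < 1 \<and> 0 < Im z} = f2 ` ball 0 1"
    "\<And>x. -1 \<le> x \<Longrightarrow> x \<le> 1 \<Longrightarrow> G2 (of_real x) = \<alpha> (- x)"
    "\<And>\<phi>. 0 \<le> \<phi> \<Longrightarrow> \<phi> \<le> pi \<Longrightarrow> G2 (cis \<phi>) = f2 (kr 5 (4 + 4 * \<phi> / pi))"
    by (rule half_filling[OF f2 a'c a'i a'img]) (use arcs(2,3) in \<open>simp_all add: \<alpha>_def\<close>)
  let ?D = "cball (0::complex) 1"
  let ?U = "?D \<inter> {z. 0 \<le> Im z}" and ?W = "?D \<inter> {z. Im z \<le> 0}"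
  \<comment> \<open>A half turn places the second pentagon below. It reverses the diameter, so
    \<open>G2\<close> was built with \<open>\<alpha> (- x)\<close>, in accordance with the opposite
    direction of the common side in \<open>f2\<close>.\<close>
  define F0 where "F0 z = (if 0 \<le> Im z then G1 z else G2 (- z))" for z
  have mid: "G1 z = G2 (- z)" if "z \<in> ?D" "Im z = 0" for z
  proof -
    have z: "z = of_real (Re z)" using that by (simp add: complex_eq_iff)
    have r: "-1 \<le> Re z" "Re z \<le> 1" using norm_le_1_Re[of z] that by auto
    have "G1 z = \<alpha> (Re z)" using G1(5)[OF r] z by simp
    moreover have "G2 (- z) = \<alpha> (Re z)"
    proof -
      have "- z = of_real (- Re z)" using z by simp
      then show ?thesis using G2(5)[of "- Re z"] r by simp
    qed
    ultimately show ?thesis by simp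
  qed
  have F0c: "continuous_on ?D F0"
  proof -
    have "closedin (top_of_set ?D) ?U" "closedin (top_of_set ?D) ?W"
      using closed_halfspace_Im_ge[of 0] closed_halfspace_Im_le[of 0] closedin_closed_Int by blast+
    moreover have un: "?U \<union> ?W = ?D" by auto
    moreover have "continuous_on ?U G1" by (rule continuous_on_subset[OF G1(1)]) (auto simp: half_disc_def)
    moreover have "continuous_on ?W (\<lambda>z. G2 (- z))"
      by (rule continuous_on_compose2[OF G2(1)]) (auto simp: half_disc_def intro!: continuous_intros)
    ultimately have "continuous_on (?U \<union> ?W) (\<lambda>z. if 0 \<le> Im z then G1 z else G2 (- z))"
      using mid by (intro continuous_on_cases_local) auto
    then show ?thesis unfolding un F0_def .
  qed
  have hd: "z \<in> half_disc" if "norm z < 1" "0 \<le> Im z" for z using that by (simp add: half_disc_def)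
  have crs: False if "norm z < 1" "norm w < 1" "0 \<le> Im z" "Im w < 0" "F0 z = F0 w" for z w
  proof -
    have "F0 z \<in> f1 ` cball 0 1" using that(3) hd[OF that(1,3)] G1(3) by (auto simp: F0_def)
    moreover have "F0 w \<in> f2 ` ball 0 1" using that(2,4) by (simp add: F0_def flip: G2(4))
    ultimately show False using disj(2) that(5) by auto
  qed
  have F0i: "inj_on F0 (ball 0 1)"
  proof (rule inj_onI)
    fix z w :: complex assume a: "z \<in> ball 0 1" "w \<in> ball 0 1" "F0 z = F0 w"
    then have n: "norm z < 1" "norm w < 1" by auto
    consider "0 \<le> Im z" "0 \<le> Im w" | "Im z < 0" "Im w < 0" | "0 \<le> Im z" "Im w < 0" | "0 \<le> Im w" "Im z < 0" by linarith
    then show "z = w"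
    proof cases
      case 1
      then show ?thesis using inj_onD[OF G1(2) _ hd[OF n(1)] hd[OF n(2)]] a(3) by (simp add: F0_def)
    next
      case 2
      then have "- z = - w" using inj_onD[OF G2(2), of "-z" "-w"] hd[of "-z"] hd[of "-w"] n a(3) by (simp add: F0_def)
      then show ?thesis by simp
    next
      case 3 then show ?thesis using crs n a(3) by blast
    next
      case 4 then show ?thesis using crs[of w z] n a(3) by simp
    qed
  qed
  have F0img: "F0 ` ball 0 1 = f1 ` ball 0 1 \<union> f1 ` kr 5 ` {3<..<4} \<union> f2 ` ball 0 1"
  proof -
    have d: "ball (0::complex) 1 = {z. norm z < 1 \<and> 0 < Im z} \<union> of_real ` {-1<..<1} \<union> uminus ` {z. norm z < 1 \<and> 0 < Im z}"
    proof (intro equalityI subsetI)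
      fix z :: complex assume z: "z \<in> ball 0 1"
      consider "0 < Im z" | "Im z = 0" | "Im z < 0" by linarith
      then show "z \<in> {z. norm z < 1 \<and> 0 < Im z} \<union> of_real ` {-1<..<1} \<union> uminus ` {z. norm z < 1 \<and> 0 < Im z}"
      proof cases
        case 2
        then have "z = of_real (Re z)" by (simp add: complex_eq_iff)
        moreover then have "\<bar>Re z\<bar> < 1" using z by (metis mem_ball_0 norm_of_real)
        then have "Re z \<in> {-1<..<1}" by (auto simp: abs_less_iff)
        ultimately show ?thesis by blast
      next
        case 3
        then have "- z \<in> {z. norm z < 1 \<and> 0 < Im z}" using z by simp
        then have "z \<in> uminus ` {z. norm z < 1 \<and> 0 < Im z}" by (metis imageI minus_minus)
        then show ?thesis by blast
      qed (use z in auto)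
    qed auto
    have "F0 ` {z. norm z < 1 \<and> 0 < Im z} = f1 ` ball 0 1"
      unfolding G1(4)[symmetric] by (rule image_cong[OF refl]) (simp add: F0_def)
    moreover have "F0 ` of_real ` {-1<..<1} = \<alpha> ` {-1<..<1}"
      unfolding image_image by (rule image_cong[OF refl]) (simp add: F0_def G1(5))
    moreover have "F0 ` uminus ` {z. norm z < 1 \<and> 0 < Im z} = f2 ` ball 0 1"
      unfolding G2(4)[symmetric] image_image by (rule image_cong[OF refl]) (simp add: F0_def)
    ultimately show ?thesis unfolding d image_Un aimg[of "{-1<..<1}"] i34' by simp
  qed
  \<comment> \<open>Dividing by \<open>d\<close> turns the model so that the end \<open>1\<close> of
    the diameter comes to the middle of side \<open>0\<close>.\<close>
  define d where "d = kr 4 (1/2)"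
  have nd: "norm d = 1" by (simp add: d_def)
  then have d0: "d \<noteq> 0" by auto
  have F0p: "F0 (cis p) = f1 (kr 5 (4 + 4 * p / pi))" if "0 \<le> p" "p \<le> pi" for p
    using G1(6)[OF that] sin_ge_zero[OF that] by (simp add: F0_def)
  have F0q: "F0 (- cis p) = f2 (kr 5 (4 + 4 * p / pi))" if "0 \<le> p" "p \<le> pi" for p
  proof (cases "sin p = 0")
    case True
    have "F0 (- cis p) = G1 (- cis p)" using True by (simp add: F0_def)
    also have "\<dots> = G2 (cis p)" using mid[of "- cis p"] True by simp
    finally show ?thesis using G2(6)[OF that] by simp
  next
    case False
    then have "Im (- cis p) < 0" using sin_ge_zero[OF that] by simp
    then show ?thesis using G2(6)[OF that] by (simp add: F0_def)
  qed
  have kd: "kr 4 t / d = cis (pi / 2 * (t - 1/2))" for t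
  proof -
    have "kr 4 t = cis (pi / 2 * (t - 1/2)) * d"
      unfolding d_def kr_def kap_of_real cis_mult by (simp add: algebra_simps)
    then show ?thesis using d0 by simp
  qed
  have div: "(\<lambda>z. z / d) ` ball 0 1 = ball 0 1" "(\<lambda>z. z / d) ` cball 0 1 \<subseteq> cball 0 1"
  proof -
    show "(\<lambda>z. z / d) ` cball 0 1 \<subseteq> cball 0 1" using nd by (auto simp: norm_divide)
    show "(\<lambda>z. z / d) ` ball 0 1 = ball 0 1"
    proof (intro equalityI subsetI)
      fix z :: complex assume "z \<in> ball 0 1"
      then have "z = z * d / d" "z * d \<in> ball 0 1" using nd d0 by (auto simp: norm_mult)
      then show "z \<in> (\<lambda>z. z / d) ` ball 0 1" by blast
    qed (use nd in \<open>auto simp: norm_divide\<close>)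
  qed
  show ?thesis
  proof (rule that[of "\<lambda>z. F0 (z / d)"])
    show "continuous_on (cball 0 1) (\<lambda>z. F0 (z / d))"
      by (rule continuous_on_compose2[OF F0c _ div(2)]) (intro continuous_intros, use d0 in auto)
    show "inj_on (\<lambda>z. F0 (z / d)) (ball 0 1)"
    proof (rule inj_onI)
      fix z w :: complex assume "z \<in> ball 0 1" "w \<in> ball 0 1" "F0 (z / d) = F0 (w / d)"
      then have "z / d = w / d" using inj_onD[OF F0i] div(1) by blast
      then show "z = w" using d0 by simp
    qed
    show "(\<lambda>z. F0 (z / d)) ` ball 0 1 = f1 ` ball 0 1 \<union> f1 ` kr 5 ` {3<..<4} \<union> f2 ` ball 0 1"
      unfolding F0img[symmetric] by (metis div(1) image_image)
    show "\<forall>t. 1/2 \<le> t \<and> t \<le> 5/2 \<longrightarrow> F0 (kr 4 t / d) = f1 (kr 5 (3 + 2 * t))"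
    proof (intro allI impI)
      fix t :: real assume t: "1/2 \<le> t \<and> t \<le> 5/2"
      have "0 \<le> pi / 2 * (t - 1/2)" "pi / 2 * (t - 1/2) \<le> pi" using t by (auto simp: field_simps)
      then have "F0 (kr 4 t / d) = f1 (kr 5 (4 + 4 * (pi / 2 * (t - 1/2)) / pi))" unfolding kd by (rule F0p)
      also have "4 + 4 * (pi / 2 * (t - 1/2)) / pi = 3 + 2 * t" by (simp add: field_simps)
      finally show "F0 (kr 4 t / d) = f1 (kr 5 (3 + 2 * t))" .
    qed
    show "\<forall>t. 5/2 \<le> t \<and> t \<le> 9/2 \<longrightarrow> F0 (kr 4 t / d) = f2 (kr 5 (2 * t - 1))"
    proof (intro allI impI)
      fix t :: real assume t: "5/2 \<le> t \<and> t \<le> 9/2"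
      have "cis (pi / 2 * (t - 1/2)) = cis (pi / 2 * (t - 5/2)) * cis pi"
        unfolding cis_mult by (simp add: algebra_simps)
      then have kd': "kr 4 t / d = - cis (pi / 2 * (t - 5/2))" unfolding kd by simp
      have "0 \<le> pi / 2 * (t - 5/2)" "pi / 2 * (t - 5/2) \<le> pi" using t by (auto simp: field_simps)
      then have "F0 (kr 4 t / d) = f2 (kr 5 (4 + 4 * (pi / 2 * (t - 5/2)) / pi))" unfolding kd' by (rule F0q)
      also have "4 + 4 * (pi / 2 * (t - 5/2)) / pi = 2 * t - 1" by (simp add: field_simps)
      finally show "F0 (kr 4 t / d) = f2 (kr 5 (2 * t - 1))" .
    qed
    show "\<forall>x. -1 \<le> x \<and> x \<le> 1 \<longrightarrow> F0 (of_real x * kr 4 (1/2) / d) = f1 (kr 5 (3 + (1 + x) / 2))"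
    proof (intro allI impI)
      fix x :: real assume x: "-1 \<le> x \<and> x \<le> 1"
      have "of_real x * kr 4 (1/2) / d = of_real x" using d0 by (simp add: d_def)
      then show "F0 (of_real x * kr 4 (1/2) / d) = f1 (kr 5 (3 + (1 + x) / 2))"
        using G1(5)[of x] x by (simp add: F0_def \<alpha>_def)
    qed
  qed
qed

lemma kr_add: "kr n (s + t) = kr n s * kr n t"
  by (simp add: kr_def kap_add)

lemma corner_kr: "corner n k = kr n (real k)"
  by (simp add: kr_def corner_kap)

lemma side_kr: "side n k = kr n ` {real k<..<real k + 1}"
  by (simp add: side_kap kr_def)

lemma cnj_kr: "cnj (kr n t) = kr n (- t)"
  unfolding kr_def kap_of_real by (simp add: cis_cnj)

text \<open>Modulo \<open>n\<close> this reflection sends position \<open>t\<close> to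
  \<open>2 - t\<close>. It fixes corner \<open>1\<close>, exchanges corners \<open>0\<close> and
  \<open>2\<close> and, for \<open>n = 5\<close>, corners \<open>3\<close> and \<open>4\<close>, so
  the pattern of labels survives.\<close>

lemma reflect_kr:
  assumes "n > 0"
  shows "corner n 2 * cnj (kr n t) = kr n (real n + 2 - t)"
proof -
  have "corner n 2 * cnj (kr n t) = kr n (2 + - t)" unfolding cnj_kr corner_kr kr_add by simp
  also have "\<dots> = kr n (2 + - t + real n)" using kr_period[OF assms] by simp
  finally show ?thesis by (simp add: algebra_simps)
qed

lemma corner_reflect:
  assumes "n > 0" "i < n"
  shows "corner n 2 * cnj (corner n i) = corner n ((n + 2 - i) mod n)"
proof -
  have "real (n + 2 - i) = real n + 2 - real i" using assms(2) by (simp add: of_nat_diff)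
  then show ?thesis
    unfolding corner_mod[OF assms(1)] corner_kr[of n i] reflect_kr[OF assms(1)] corner_kr[of n "n + 2 - i"] by simp
qed

lemma side_reflect:
  assumes "n > 0" "i < n"
  shows "(\<lambda>z. corner n 2 * cnj z) ` side n i = side n ((n + 1 - i) mod n)"
proof -
  have "(\<lambda>z. corner n 2 * cnj z) ` side n i = kr n ` (\<lambda>t. real n + 2 - t) ` {real i<..<real i + 1}"
    unfolding side_kr image_image using reflect_kr[OF assms(1)] by simp
  also have "(\<lambda>t. real n + 2 - t) ` {real i<..<real i + 1} = {real n + 1 - real i<..<real n + 1 - real i + 1}"
    by (auto simp: image_iff intro!: bexI[of _ "real n + 2 - x" for x])
  also have "real n + 1 - real i = real (n + 1 - i)" using assms by (simp add: of_nat_diff)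
  finally show ?thesis unfolding side_mod[OF assms(1)] side_kr[of n "n + 1 - i"] .
qed

lemma polygon_map_reflect:
  assumes "polygon_map V E n f T" "n > 0"
  shows "polygon_map V E n (f \<circ> (\<lambda>z. corner n 2 * cnj z)) T"
proof (rule polygon_map_reparametrize[OF assms(1)])
  let ?r = "\<lambda>z. corner n 2 * cnj z"
  have nr: "norm (corner n 2) = 1" by (simp add: corner_def)
  then have c0: "corner n 2 \<noteq> 0" by auto
  show "homeomorphism (ball 0 1) (ball 0 1) ?r (\<lambda>z. cnj (inverse (corner n 2) * z))"
    using c0 nr by (intro homeomorphismI continuous_intros) (auto simp: norm_mult norm_inverse)
  show "?r ` cball 0 1 \<subseteq> cball 0 1" using nr by (auto simp: norm_mult)
  show "inj ?r" using c0 by (auto simp: inj_on_def)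
  show "continuous_on UNIV ?r" by (intro continuous_intros)
  fix i assume i: "i < n"
  have m: "(n + 2 - i) mod n < n" "(n + 1 - i) mod n < n" using assms(2) by simp_all
  show "\<exists>i'<n. ?r (corner n i) = corner n i'" using m(1) corner_reflect[OF assms(2) i] by blast
  show "\<exists>i'<n. ?r ` side n i = side n i'" using m(2) side_reflect[OF assms(2) i] by blast
qed

text \<open>A piece that meets a component lies in it by maximality; there it is open, and closed as
  well because the other open pieces cover the rest.\<close>

lemma components_partition:
  assumes un: "\<Union>\<D> = X" and D: "\<And>D. D \<in> \<D> \<Longrightarrow> connected D \<and> D \<noteq> {} \<and> openin (top_of_set X) D"
    and dj: "\<And>D D' x. D \<in> \<D> \<Longrightarrow> D' \<in> \<D> \<Longrightarrow> x \<in> D \<Longrightarrow> x \<in> D' \<Longrightarrow> D = D'"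
  shows "components X = \<D>"
proof -
  have eq: "C = D" if C: "C \<in> components X" and DD: "D \<in> \<D>" and x: "x \<in> C" "x \<in> D" for C D x
  proof -
    have CX: "C \<subseteq> X" using C by (rule in_components_subset)
    have "D \<subseteq> C" using components_maximal[OF C, of D] D[OF DD] un DD x by blast
    have 1: "openin (top_of_set C) D" using D[OF DD] \<open>D \<subseteq> C\<close> CX by (meson openin_subset_trans)
    have "openin (top_of_set X) (\<Union>(\<D> - {D}))" using D by (intro openin_Union) auto
    then obtain W where W: "open W" "\<Union>(\<D> - {D}) = X \<inter> W" unfolding openin_open by blast
    then have "C \<inter> \<Union>(\<D> - {D}) = C \<inter> W" using CX by blast
    then have "openin (top_of_set C) (C \<inter> \<Union>(\<D> - {D}))" using W(1) by (simp add: openin_open_Int)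
    moreover have "C \<inter> \<Union>(\<D> - {D}) = C - D"
    proof (intro equalityI subsetI)
      fix y assume "y \<in> C \<inter> \<Union>(\<D> - {D})"
      then obtain D' where "y \<in> C" "D' \<in> \<D>" "D' \<noteq> D" "y \<in> D'" by blast
      then show "y \<in> C - D" using dj[OF DD, of D' y] by blast
    next
      fix y assume y: "y \<in> C - D"
      then have "y \<in> \<Union>\<D>" using CX un by blast
      then show "y \<in> C \<inter> \<Union>(\<D> - {D})" using y by blast
    qed
    ultimately have "openin (top_of_set C) (C - D)" by simp
    then have "closedin (top_of_set C) D" using \<open>D \<subseteq> C\<close> by (simp add: closedin_def)
    then show ?thesis using 1 in_components_connected[OF C] x unfolding connected_clopen by blast
  qed
  show ?thesis
  proof (intro equalityI subsetI)
    fix C assume C: "C \<in> components X"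
    then obtain x where x: "x \<in> C" using in_components_nonempty by blast
    then have "x \<in> \<Union>\<D>" using in_components_subset[OF C] un by blast
    then obtain D' where "D' \<in> \<D>" "x \<in> D'" by blast
    then show "C \<in> \<D>" using eq[OF C _ x] by simp
  next
    fix D' assume D': "D' \<in> \<D>"
    then obtain x where x: "x \<in> D'" using D by blast
    then have "x \<in> \<Union>(components X)" unfolding Union_components using D' un by blast
    then obtain C where "C \<in> components X" "x \<in> C" by blast
    then show "D' \<in> components X" using eq[OF _ D' _ x] by metis
  qed
qed

lemma inj_on_UnI:
  assumes "inj_on f A" "inj_on f B" "f ` A \<inter> f ` B = {}"
  shows "inj_on f (A \<union> B)"
proof (rule inj_onI)
  fix x y assume xy: "x \<in> A \<union> B" "y \<in> A \<union> B" "f x = f y"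
  have "\<not> (x \<in> A \<and> y \<in> B)" "\<not> (x \<in> B \<and> y \<in> A)" using assms(3) xy(3) by (metis disjoint_iff imageI)+
  then show "x = y" using xy assms(1,2) by (auto dest: inj_onD)
qed

lemma two_pieces:
  fixes q :: "real \<Rightarrow> 'b"
  assumes "inj_on (\<lambda>s. q (s / 2)) {0<..<1}" "inj_on (\<lambda>s. q (1/2 + s / 2)) {0<..<1}"
    and "(\<lambda>s. q (s / 2)) ` {0<..<1} = A" "(\<lambda>s. q (1/2 + s / 2)) ` {0<..<1} = B" "q (1/2) = u"
    and "A \<inter> B = {}" "u \<notin> A" "u \<notin> B"
  shows "inj_on q {0<..<1} \<and> q ` {0<..<1} = A \<union> {u} \<union> B"
proof -
  have s: "{0<..<1} = (\<lambda>s. s / 2) ` {0<..<1} \<union> {1/2} \<union> (\<lambda>s. 1/2 + s / 2) ` {0<..<1::real}"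
  proof (intro equalityI subsetI)
    fix t :: real assume t: "t \<in> {0<..<1}"
    consider "t < 1/2" | "t = 1/2" | "t > 1/2" by linarith
    then show "t \<in> (\<lambda>s. s / 2) ` {0<..<1} \<union> {1/2} \<union> (\<lambda>s. 1/2 + s / 2) ` {0<..<1}"
    proof cases
      case 1
      then have "t = (2 * t) / 2" "2 * t \<in> {0<..<1}" using t by auto
      then show ?thesis by blast
    next
      case 3
      then have "t = 1/2 + (2 * t - 1) / 2" "2 * t - 1 \<in> {0<..<1}" using t by (auto simp: field_simps)
      then show ?thesis by blast
    qed simp
  qed (auto simp: field_simps)
  have im: "q ` (\<lambda>s. s / 2) ` {0<..<1} = A" "q ` (\<lambda>s. 1/2 + s / 2) ` {0<..<1} = B"
    using assms(3,4) by (simp_all add: image_image)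
  have i1: "inj_on q ((\<lambda>s. s / 2) ` {0<..<1})"
    using assms(1) by (auto simp: inj_on_def)
  have i2: "inj_on q ((\<lambda>s. 1/2 + s / 2) ` {0<..<1})"
    using assms(2) by (auto simp: inj_on_def)
  have i: "inj_on q ((\<lambda>s. s / 2) ` {0<..<1} \<union> {1/2} \<union> (\<lambda>s. 1/2 + s / 2) ` {0<..<1})"
  proof (intro inj_on_UnI i1 i2)
    show "q ` (\<lambda>s. s / 2) ` {0<..<1} \<inter> q ` {1/2} = {}" unfolding im using assms(5,7) by simp
    show "q ` ((\<lambda>s. s / 2) ` {0<..<1} \<union> {1/2}) \<inter> q ` (\<lambda>s. 1/2 + s / 2) ` {0<..<1} = {}"
      unfolding image_Un im using assms(5,6,8) by auto
  qed simp
  have "inj_on q {0<..<1}" using i unfolding s[symmetric] .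
  moreover have "q ` {0<..<1} = A \<union> {u} \<union> B"
    by (subst s) (simp only: image_Un im image_insert image_empty assms(5))
  ultimately show ?thesis ..
qed

section \<open>The tiles of the quadrilateral graph\<close>

context labelled begin

lemma par_kr: "par T j x = f T (kr 5 (real j + x))"
  by (simp add: par_def kr_def)

lemma cor_kr: "cor T j = f T (kr 5 (real j))"
  by (simp add: cor_def corner_kr)

lemma kr5: "kr 5 (5 + x) = kr 5 x"
  using kr_period[of 5 x] by (simp add: add.commute)

text \<open>One side of the square carries two sides of pentagons, hence the factors
  \<open>1/2\<close>; the unlabelled vertex \<open>u\<close> sits in its middle.\<close>

lemma side_piece:
  assumes U: "U \<in> TT" "j < 5" "U' \<in> TT" "j' < 5" and u: "u \<in> V - L"
    and h: "ed U j \<in> half_at u" "ed U' j' \<in> half_at u" "ed U j \<noteq> ed U' j'"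
    and F: "\<And>s. s \<in> {0<..<1} \<Longrightarrow> F (kr 4 (real i + s / 2)) = par U j s" "F (kr 4 (real i + 1/2)) = u"
      "\<And>s. s \<in> {0<..<1} \<Longrightarrow> F (kr 4 (real i + (1/2 + s / 2))) = par U' j' s"
  shows "inj_on F (side 4 i)" "F ` side 4 i = merged u"
proof -
  let ?q = "\<lambda>t. F (kr 4 (real i + t))"
  have side: "side 4 i = (\<lambda>t. kr 4 (real i + t)) ` {0<..<1}"
    by (simp add: side_kap01 kr_def)
  have E: "ed U j \<in> E" "ed U' j' \<in> E" using ed_E U by auto
  have nu: "u \<notin> ed U j" "u \<notin> ed U' j'" using edge_V E u by blast+
  have dj: "ed U j \<inter> ed U' j' = {}" using edge_unique[OF E] h(3) by blast
  have q: "inj_on ?q {0<..<1} \<and> ?q ` {0<..<1} = ed U j \<union> {u} \<union> ed U' j'"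
  proof (rule two_pieces)
    show "inj_on (\<lambda>s. ?q (s / 2)) {0<..<1}" using par_inj[OF U(1,2)] inj_on_cong[of "{0<..<1}" "\<lambda>s. ?q (s / 2)" "par U j"] F(1) by blast
    show "inj_on (\<lambda>s. ?q (1/2 + s / 2)) {0<..<1}" using par_inj[OF U(3,4)] inj_on_cong[of "{0<..<1}" "\<lambda>s. ?q (1/2 + s / 2)" "par U' j'"] F(3) by blast
    show "(\<lambda>s. ?q (s / 2)) ` {0<..<1} = ed U j" unfolding par_ed[symmetric] by (rule image_cong[OF refl F(1)])
    show "(\<lambda>s. ?q (1/2 + s / 2)) ` {0<..<1} = ed U' j'" unfolding par_ed[symmetric] by (rule image_cong[OF refl F(3)])
  qed (use F(2) dj nu in auto)
  then have "inj_on (F \<circ> (\<lambda>t. kr 4 (real i + t))) {0<..<1}" by (simp add: comp_def)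
  then show "inj_on F (side 4 i)" unfolding side by (rule inj_on_imageI)
  show "F ` side 4 i = merged u"
    unfolding side image_image merged_two_sides[OF u h] using q by simp
qed

lemma closed_chord: "T \<in> TT \<Longrightarrow> f T ` kr 5 ` {3..4} = closure (ed T 3)"
proof -
  assume T: "T \<in> TT"
  have "closure (ed T 3) = par T 3 ` {0..1}"
    unfolding par_ed[symmetric] by (rule closure_open_arc[OF par_cont[OF T]]) simp
  also have "\<dots> = f T ` kr 5 ` (\<lambda>x. 3 + x) ` {0..1}"
    unfolding image_image by (rule image_cong[OF refl]) (simp add: par_kr)
  also have "(\<lambda>x::real. 3 + x) ` {0..1} = {3..4}" by (simp add: image_add_atLeastAtMost)
  finally show ?thesis ..
qed

lemma quad_region_disjoint:
  assumes "T \<in> TT" "T' \<in> TT" 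
  shows "(T \<union> ed T 3 \<union> T') \<inter> (L \<union> \<Union>quad_edges) = {}"
proof -
  have c: "ed T 3 \<in> chords" using ed_chord[OF assms(1)] by simp
  have "ed T 3 \<inter> V = {}" using ed_V[OF assms(1)] by simp
  moreover have "ed T 3 \<inter> \<Union>(E - chords) = {}"
  proof (rule ccontr)
    assume "\<not> ?thesis"
    then obtain x e where "x \<in> ed T 3" "e \<in> E" "e \<notin> chords" "x \<in> e" by blast
    then show False using edge_unique[of "ed T 3" e x] c chords_E by blast
  qed
  ultimately show ?thesis unfolding quad_graph_union
    using tile_facts(2)[OF assms(1)] tile_facts(2)[OF assms(2)] by blast
qed

lemma tile_cball_disjoint:
  assumes "T \<in> TT" "T' \<in> TT" "T \<noteq> T'"
  shows "f T ` ball 0 1 \<inter> f T' ` cball 0 1 = {}"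
proof (rule ccontr)
  assume "\<not> ?thesis"
  then obtain z w where "z \<in> ball 0 1" "w \<in> cball 0 1" "f T z = f T' w" by blast
  then show False using f_interior_unique(1)[OF assms(1,2)] assms(3) by blast
qed

text \<open>The polygon map of the quadrilateral whose arc \<open>ed T 3\<close> joins the middle points of sides \<open>0\<close> and \<open>2\<close>.\<close>

definition quad_frame :: "(complex \<Rightarrow> 'a) \<Rightarrow> 'a set \<Rightarrow> 'a set \<Rightarrow> bool" where
  "quad_frame F T D \<longleftrightarrow> polygon_map L quad_edges 4 F D
    \<and> F ` side 4 0 = merged (cor T 4) \<and> F ` side 4 2 = merged (cor T 3)
    \<and> F (kr 4 (1/2)) = cor T 4 \<and> F (- kr 4 (1/2)) = cor T 3
    \<and> F ` linepath (kr 4 (1/2)) (- kr 4 (1/2)) ` {0<..<1} = ed T 3"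

text \<open>\<open>al\<close> means that the two polygon maps run through the common edge in
  opposite directions, as \<open>glue_pentagons\<close> requires. The sides of the square become, in
  order: side \<open>2\<close> of \<open>T'\<close> and \<open>4\<close> of \<open>T\<close>; sides
  \<open>0\<close> and \<open>1\<close> of \<open>T\<close>; side \<open>2\<close> of
  \<open>T\<close> and \<open>4\<close> of \<open>T'\<close>; sides \<open>0\<close> and
  \<open>1\<close> of \<open>T'\<close>.\<close>

lemma quad_map_aligned:
  assumes T: "T \<in> TT" and T': "T' \<in> TT" "T' \<noteq> T" and e3: "ed T' 3 = ed T 3" and al: "cor T 3 = cor T' 4"
  shows "\<exists>F. quad_frame F T (T \<union> ed T 3 \<union> T')"
proof -
  have "{cor T 3, cor T 4} = {cor T' 3, cor T' 4}"
    using ed_ends[OF T, of 3] ed_ends[OF T'(1), of 3] e3 by (simp add: eval_nat_numeral)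
  then have al': "cor T 4 = cor T' 3" using al cor_neq[OF T, of 3 4] by (auto simp: doubleton_eq_iff)
  have disj: "f T ` ball 0 1 \<inter> f T' ` cball 0 1 = {}" "f T ` cball 0 1 \<inter> f T' ` ball 0 1 = {}"
    using tile_cball_disjoint[OF T T'(1)] tile_cball_disjoint[OF T'(1) T] T'(2) by auto
  have arcs: "f T ` kr 5 ` {3..4} = f T' ` kr 5 ` {3..4}"
    using closed_chord[OF T] closed_chord[OF T'(1)] e3 by simp
  have ends: "f T (kr 5 3) = f T' (kr 5 4)" "f T (kr 5 4) = f T' (kr 5 3)"
    using al al' cor_kr[of _ 3] cor_kr[of _ 4] by simp_all
  obtain F where Fo: "continuous_on (cball 0 1) F" "inj_on F (ball 0 1)"
    "F ` ball 0 1 = f T ` ball 0 1 \<union> f T ` kr 5 ` {3<..<4} \<union> f T' ` ball 0 1"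
    "\<forall>t. 1/2 \<le> t \<and> t \<le> 5/2 \<longrightarrow> F (kr 4 t) = f T (kr 5 (3 + 2 * t))"
    "\<forall>t. 5/2 \<le> t \<and> t \<le> 9/2 \<longrightarrow> F (kr 4 t) = f T' (kr 5 (2 * t - 1))"
    "\<forall>x. -1 \<le> x \<and> x \<le> 1 \<longrightarrow> F (of_real x * kr 4 (1/2)) = f T (kr 5 (3 + (1 + x) / 2))"
    by (rule glue_pentagons[OF f_cont[OF T] f_inj[OF T] f_cont[OF T'(1)] f_inj[OF T'(1)] disj arcs ends])
  note F = Fo(1-3) Fo(4)[rule_format, OF conjI] Fo(5)[rule_format, OF conjI] Fo(6)[rule_format, OF conjI]
  let ?D = "T \<union> ed T 3 \<union> T'"
  have s3: "f T ` kr 5 ` {3<..<4} = ed T 3" unfolding ed_def side_kr by simp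
  have FD: "F ` ball 0 1 = ?D" unfolding F(3) f_ball(1)[OF T] f_ball(1)[OF T'(1)] s3 ..
  have h: "ed T 0 \<in> half_at (cor T 1)" "ed T 1 \<in> half_at (cor T 1)" "ed T' 0 \<in> half_at (cor T' 1)" "ed T' 1 \<in> half_at (cor T' 1)"
    using half_at_tile(1)[OF T] half_at_tile(1)[OF T'(1)] by auto
  have h3: "ed T 2 \<in> half_at (cor T 3)" "ed T' 4 \<in> half_at (cor T 3)"
    by (rule half_at_ed[OF T _ _ cor_U(2)[OF T]]; simp add: eval_nat_numeral)
       (rule half_at_ed[OF T'(1) _ _ cor_U(2)[OF T]]; simp add: al)
  have h4: "ed T' 2 \<in> half_at (cor T 4)" "ed T 4 \<in> half_at (cor T 4)"
    unfolding al'
    by (rule half_at_ed[OF T'(1) _ _ cor_U(2)[OF T'(1)]]; simp add: eval_nat_numeral)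
       (rule half_at_ed[OF T _ _ cor_U(2)[OF T'(1)]]; simp flip: al')
  have ne3: "ed T 2 \<noteq> ed T' 4" by (rule half_sides_distinct[OF cor_U(2)[OF T] T _ T'(1) _ _ h3(1)]) auto
  have ne4: "ed T' 2 \<noteq> ed T 4" by (rule half_sides_distinct[OF cor_U(3)[OF T] T'(1) _ T _ _ h4(1)]) auto
  have k: "kr 5 (7 + s) = kr 5 (2 + s)" "kr 5 (6 + s) = kr 5 (1 + s)" "kr 5 (8 + s) = kr 5 (3 + s)" for s
    using kr5[of "2 + s"] kr5[of "1 + s"] kr5[of "3 + s"] by (simp_all add: add.assoc[symmetric])
  have S0: "inj_on F (side 4 0)" "F ` side 4 0 = merged (cor T 4)"
  proof -
    have 1: "F (kr 4 (real 0 + s / 2)) = par T' 2 s" if "s \<in> {0<..<1}" for s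
    proof -
      \<comment> \<open>This half of side \<open>0\<close> belongs to \<open>T'\<close>, described
        by positions from \<open>5/2\<close> to \<open>9/2\<close>, so a period is added.\<close>
      have "kr 4 (real 0 + s / 2) = kr 4 (4 + s / 2)" using kr_period[of 4 "s / 2"] by (simp add: add.commute)
      also have "F \<dots> = f T' (kr 5 (2 * (4 + s / 2) - 1))" using that by (intro F(5)) auto
      also have "2 * (4 + s / 2) - 1 = 7 + s" by simp
      finally show ?thesis using k(1) by (simp add: par_kr)
    qed
    have 2: "F (kr 4 (real 0 + 1/2)) = cor T 4" using F(4)[of "1/2"] by (simp add: cor_kr)
    have 3: "F (kr 4 (real 0 + (1/2 + s / 2))) = par T 4 s" if "s \<in> {0<..<1}" for s
      using F(4)[of "1/2 + s / 2"] that by (simp add: par_kr)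
    show "inj_on F (side 4 0)" "F ` side 4 0 = merged (cor T 4)"
      by (rule side_piece[OF T'(1) _ T _ cor_U(3)[OF T] h4 ne4 1 2 3]; simp)+
  qed
  have S1: "inj_on F (side 4 1)" "F ` side 4 1 = merged (cor T 1)"
  proof -
    have 1: "F (kr 4 (real 1 + s / 2)) = par T 0 s" if "s \<in> {0<..<1}" for s
      using F(4)[of "1 + s / 2"] that kr5[of s] by (simp add: par_kr)
    have 2: "F (kr 4 (real 1 + 1/2)) = cor T 1" using F(4)[of "3/2"] k(2)[of 0] by (simp add: cor_kr)
    have 3: "F (kr 4 (real 1 + (1/2 + s / 2))) = par T 1 s" if "s \<in> {0<..<1}" for s
      using F(4)[of "1 + (1/2 + s / 2)"] that k(2)[of s] by (simp add: par_kr)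
    show "inj_on F (side 4 1)" "F ` side 4 1 = merged (cor T 1)"
      by (rule side_piece[OF T _ T _ cor_U(1)[OF T] h(1,2) half_at_tile(2)[OF T] 1 2 3]; simp)+
  qed
  have S2: "inj_on F (side 4 2)" "F ` side 4 2 = merged (cor T 3)"
  proof -
    have 1: "F (kr 4 (real 2 + s / 2)) = par T 2 s" if "s \<in> {0<..<1}" for s
      using F(4)[of "2 + s / 2"] that k(1)[of s] by (simp add: par_kr)
    have 2: "F (kr 4 (real 2 + 1/2)) = cor T 3" using F(4)[of "5/2"] k(3)[of 0] by (simp add: cor_kr)
    have 3: "F (kr 4 (real 2 + (1/2 + s / 2))) = par T' 4 s" if "s \<in> {0<..<1}" for s
      using F(5)[of "2 + (1/2 + s / 2)"] that by (simp add: par_kr)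
    show "inj_on F (side 4 2)" "F ` side 4 2 = merged (cor T 3)"
      by (rule side_piece[OF T _ T'(1) _ cor_U(2)[OF T] h3 ne3 1 2 3]; simp)+
  qed
  have S3: "inj_on F (side 4 3)" "F ` side 4 3 = merged (cor T' 1)"
  proof -
    have 1: "F (kr 4 (real 3 + s / 2)) = par T' 0 s" if "s \<in> {0<..<1}" for s
      using F(5)[of "3 + s / 2"] that kr5[of s] by (simp add: par_kr)
    have 2: "F (kr 4 (real 3 + 1/2)) = cor T' 1" using F(5)[of "7/2"] k(2)[of 0] by (simp add: cor_kr)
    have 3: "F (kr 4 (real 3 + (1/2 + s / 2))) = par T' 1 s" if "s \<in> {0<..<1}" for s
      using F(5)[of "3 + (1/2 + s / 2)"] that k(2)[of s] by (simp add: par_kr)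
    show "inj_on F (side 4 3)" "F ` side 4 3 = merged (cor T' 1)"
      by (rule side_piece[OF T'(1) _ T'(1) _ cor_U(1)[OF T'(1)] h(3,4) half_at_tile(2)[OF T'(1)] 1 2 3]; simp)+
  qed
  have C0: "F (corner 4 0) = cor T' 2"
    using F(5)[of 4] kr_period[of 4 0] k(1)[of 0] by (simp add: corner_kr cor_kr)
  have C1: "F (corner 4 1) = cor T 0" using F(4)[of 1] kr5[of 0] by (simp add: corner_kr cor_kr)
  have C2: "F (corner 4 2) = cor T 2" using F(4)[of 2] k(1)[of 0] by (simp add: corner_kr cor_kr)
  have C3: "F (corner 4 3) = cor T' 0" using F(5)[of 3] kr5[of 0] by (simp add: corner_kr cor_kr)
  have M: "merged (cor T 4) \<in> quad_edges" "merged (cor T 1) \<in> quad_edges" "merged (cor T 3) \<in> quad_edges" "merged (cor T' 1) \<in> quad_edges"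
    unfolding quad_edges_def using cor_U[OF T] cor_U[OF T'(1)] by blast+
  have sides: "F (corner 4 k) \<in> L \<and> inj_on F (side 4 k) \<and> F ` side 4 k \<in> quad_edges" if "k < 4" for k
  proof -
    have "k = 0 \<or> k = 1 \<or> k = 2 \<or> k = 3" using that by auto
    then show ?thesis
      using S0 S1 S2 S3 C0 C1 C2 C3 M lab[OF T] lab[OF T'(1)] by (elim disjE) simp_all
  qed
  have Fsph: "F z \<in> L \<union> \<Union>quad_edges" if "z \<in> sphere 0 1" for z
  proof (rule sphere_cases[of 4 z])
    fix k assume "k < 4" "z = corner 4 k"
    then show ?thesis using sides by simp
  next
    fix k assume k: "k < 4" "z \<in> side 4 k"
    then have "F z \<in> F ` side 4 k" by blast
    then show ?thesis using sides[OF k(1)] by blast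
  qed (use that in auto)
  have "homeomorphism (ball 0 1) (F ` ball 0 1) F (inv_into (ball 0 1) F)"
  proof (rule homeomorphism_saturated[OF _ F(1) _ F(2)])
    fix z :: complex assume z: "z \<in> cball 0 1" "F z \<in> F ` ball 0 1"
    show "z \<in> ball 0 1"
    proof (rule ccontr)
      assume "z \<notin> ball 0 1"
      then have "F z \<in> L \<union> \<Union>quad_edges" using Fsph cball_cases[OF z(1)] by blast
      then show False using z(2) quad_region_disjoint[OF T T'(1)] unfolding FD by blast
    qed
  qed auto
  then have pm: "polygon_map L quad_edges 4 F ?D" unfolding polygon_map_def FD using F(1) sides by blast
  have lp: "linepath (kr 4 (1/2)) (- kr 4 (1/2)) t = of_real (1 - 2 * t) * kr 4 (1/2)" for t
    by (simp add: linepath_def scaleR_conv_of_real algebra_simps)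
  have "F ` linepath (kr 4 (1/2)) (- kr 4 (1/2)) ` {0<..<1} = f T ` kr 5 ` (\<lambda>t. 4 - t) ` {0<..<1}"
    unfolding image_image lp
  proof (rule image_cong[OF refl])
    fix t :: real assume t: "t \<in> {0<..<1}"
    have "F (of_real (1 - 2 * t) * kr 4 (1/2)) = f T (kr 5 (3 + (1 + (1 - 2 * t)) / 2))"
      using t by (intro F(6)) auto
    also have "3 + (1 + (1 - 2 * t)) / 2 = 4 - t" by (simp add: field_simps)
    finally show "F (of_real (1 - 2 * t) * kr 4 (1/2)) = f T (kr 5 (4 - t))" .
  qed
  also have "(\<lambda>t::real. 4 - t) ` {0<..<1} = {3<..<4}"
    by (auto simp: image_iff intro!: bexI[of _ "4 - x" for x])
  finally have ch: "F ` linepath (kr 4 (1/2)) (- kr 4 (1/2)) ` {0<..<1} = ed T 3" unfolding s3 .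
  have d: "F (kr 4 (1/2)) = cor T 4" "F (- kr 4 (1/2)) = cor T 3"
    using F(6)[of 1] F(6)[of "-1"] by (simp_all add: cor_kr)
  show ?thesis unfolding quad_frame_def using pm S0(2) S2(2) d ch by blast
qed

text \<open>The chosen polygon maps may run through the common edge in the same direction. Then the
  map of \<open>T'\<close> is replaced by its reflection, which keeps the pattern of labels and side
  \<open>3\<close>, and the aligned case applies to the changed family; the data of \<open>T\<close>
  are unaffected.\<close>

lemma quad_map:
  assumes T: "T \<in> TT"
  shows "\<exists>T' F. T' \<in> TT \<and> ed T' 3 = ed T 3 \<and> (\<forall>U\<in>TT. ed U 3 = ed T 3 \<longrightarrow> U = T \<or> U = T')
    \<and> quad_frame F T (T \<union> ed T 3 \<union> T')"
proof -
  obtain T' where T': "T' \<in> TT" "T' \<noteq> T" "ed T' 3 = ed T 3" "\<forall>U\<in>TT. ed U 3 = ed T 3 \<longrightarrow> U = T \<or> U = T'"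
    using T by (rule partner)
  have "{cor T 3, cor T 4} = {cor T' 3, cor T' 4}"
    using ed_ends[OF T, of 3] ed_ends[OF T'(1), of 3] T'(3) by (simp add: eval_nat_numeral)
  then have "cor T 3 = cor T' 4 \<or> cor T 3 = cor T' 3" by (auto simp: doubleton_eq_iff)
  then have "\<exists>F. quad_frame F T (T \<union> ed T 3 \<union> T')"
  proof
    assume "cor T 3 = cor T' 4"
    then show ?thesis by (rule quad_map_aligned[OF T T'(1-3)])
  next
    assume al: "cor T 3 = cor T' 3"
    let ?r = "\<lambda>z. corner 5 2 * cnj z"
    let ?G = "f(T' := f T' \<circ> ?r)"
    have pmG: "polygon_map V E 5 (?G U) U" if "U \<in> TT" for U
      using polygon_map_reflect[OF pm[OF T'(1)]] pm[OF that] by simp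
    interpret R0: ptiling S V E 5 ?G
      by unfold_locales (rule surf graph n3 | (rule pmG, assumption))+
    have cr: "R0.cor T' i = cor T' ((7 - i) mod 5)" if "i < 5" for i
      using corner_reflect[of 5 i] that by (simp add: R0.cor_def cor_def)
    have co: "R0.cor U i = cor U i" if "U \<noteq> T'" for U i using that by (simp add: R0.cor_def cor_def)
    have lb: "R0.cor U 0 \<in> L \<and> R0.cor U 1 \<notin> L \<and> R0.cor U 2 \<in> L \<and> R0.cor U 3 \<notin> L \<and> R0.cor U 4 \<notin> L" if U: "U \<in> TT" for U
    proof (cases "U = T'")
      case True
      then show ?thesis using lab[OF T'(1)] cr[of 0] cr[of 1] cr[of 2] cr[of 3] cr[of 4] by simp
    next
      case False
      then show ?thesis using lab[OF U] co by simp
    qed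
    have inj: "inj_on (?G U) (sphere 0 1)" if U: "U \<in> TT" for U
    proof (cases "U = T'")
      case True
      have "norm (corner 5 2) = 1" by (simp add: corner_def)
      then have "corner 5 2 \<noteq> 0" "?r ` sphere 0 1 \<subseteq> sphere 0 1" by (auto simp: norm_mult)
      then have "inj_on (f T' \<circ> ?r) (sphere 0 1)"
        by (intro comp_inj_on inj_on_subset[OF nondeg[OF T'(1)]]) (auto simp: inj_on_def)
      then show ?thesis using True by simp
    next
      case False
      then show ?thesis using nondeg[OF U] by simp
    qed
    interpret R: labelled S V E ?G L
    proof unfold_locales
      show "L \<subseteq> V" by (rule LV)
      show "\<And>v. v \<in> V - L \<Longrightarrow> vertex_degree E v = 3" by (rule deg3)
      show "\<And>v. v \<in> V \<Longrightarrow> 3 \<le> vertex_degree E v" by (rule deg_ge)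
      show "\<And>T. T \<in> TT \<Longrightarrow> inj_on (?G T) (sphere 0 1)" by (rule inj)
    qed (use lb in blast)+
    have eo: "R0.ed U j = ed U j" if "U \<noteq> T'" for U j using that by (simp add: R0.ed_def ed_def)
    have er: "R0.ed T' 3 = ed T' 3"
    proof -
      have "R0.ed T' 3 = f T' ` ?r ` side 5 3" by (simp add: R0.ed_def image_comp)
      then show ?thesis using side_reflect[of 5 3] by (simp add: ed_def)
    qed
    have TT': "T \<noteq> T'" using T'(2) by simp
    have "R0.ed T' 3 = R0.ed T 3" using er eo[OF TT'] T'(3) by simp
    moreover have "R0.cor T 3 = R0.cor T' 4" using cr[of 4] co[OF TT'] al by simp
    ultimately show ?thesis using R.quad_map_aligned[OF T T'(1,2)] eo[OF TT'] co[OF TT']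
      by (simp add: quad_frame_def R.quad_frame_def)
  qed
  then show ?thesis using T' by blast
qed

text \<open>Indexed by the edge without bullets rather than by a tile, since both tiles along it
  yield the same quadrilateral.\<close>

definition quad :: "'a set \<Rightarrow> 'a set" where
  "quad a = a \<union> \<Union>{U \<in> TT. ed U 3 = a}"

definition quad_data :: "'a set \<Rightarrow> 'a set \<Rightarrow> (complex \<Rightarrow> 'a) \<Rightarrow> bool" where
  "quad_data D T F \<longleftrightarrow> T \<in> TT \<and> D = quad (ed T 3) \<and> quad_frame F T D"

lemma chord_tile:
  assumes "a \<in> chords"
  obtains T where "T \<in> TT" "ed T 3 = a"
proof -
  have "a \<in> E" using assms chords_E by blast
  then obtain T j where T: "T \<in> TT" "j < 5" "ed T j = a" by (rule sides_of_nonempty)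
  then have "j = 3" using ed_chord assms by metis
  then show ?thesis using that T by blast
qed

lemma quad_exists:
  assumes "a \<in> chords"
  obtains T F where "ed T 3 = a" "quad_data (quad a) T F" "quad a \<subseteq> S - (L \<union> \<Union>quad_edges)"
proof -
  obtain T where T: "T \<in> TT" "ed T 3 = a" using assms by (rule chord_tile)
  obtain T' F where T': "T' \<in> TT" "ed T' 3 = ed T 3" "\<forall>U\<in>TT. ed U 3 = ed T 3 \<longrightarrow> U = T \<or> U = T'"
    "quad_frame F T (T \<union> ed T 3 \<union> T')"
    using quad_map[OF T(1)] by blast
  have "{U \<in> TT. ed U 3 = ed T 3} = {T, T'}" using T T' by blast
  then have D: "quad a = T \<union> ed T 3 \<union> T'" unfolding quad_def T(2)[symmetric] by auto
  have "ed T 3 \<subseteq> S" using embedded_edge_facts(1)[OF graph ed_E[OF T(1)]] by simp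
  then have "quad a \<subseteq> S - (L \<union> \<Union>quad_edges)"
    using quad_region_disjoint[OF T(1) T'(1)] tile_facts(1)[OF T(1)] tile_facts(1)[OF T'(1)] unfolding D by blast
  moreover have "quad_data (quad a) T F" unfolding quad_data_def using T T' D by simp
  ultimately show ?thesis using that T(2) by blast
qed

lemma quad_disjoint:
  assumes "a \<in> chords" "b \<in> chords" "x \<in> quad a" "x \<in> quad b"
  shows "a = b"
proof -
  have nt: False if "U \<in> TT" "x \<in> U" "e \<in> chords" "x \<in> e" for U e
    using tile_facts(2)[OF that(1)] that chords_E by blast
  have "x \<in> a \<or> (\<exists>U\<in>TT. ed U 3 = a \<and> x \<in> U)" "x \<in> b \<or> (\<exists>U\<in>TT. ed U 3 = b \<and> x \<in> U)"
    using assms(3,4) by (auto simp: quad_def)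
  then show ?thesis
    using nt assms(1,2) edge_unique[of a b x] chords_E tile_unique[of _ _ x] by (metis subsetD)
qed

lemma quad_nonempty: "a \<in> chords \<Longrightarrow> quad a \<noteq> {}"
  unfolding quad_def using embedded_edge_facts(2)[OF graph, of a] chords_E by auto

text \<open>The pieces partition the complement of the quadrilateral graph, and each is open by
  invariance of domain, being an injective image of the open disc.\<close>

lemma quad_tiles: "tiles S L quad_edges = quad ` chords"
  unfolding tiles_def
proof (rule components_partition)
  let ?X = "S - (L \<union> \<Union>quad_edges)"
  show "\<Union>(quad ` chords) = ?X"
  proof (intro equalityI subsetI)
    fix x assume "x \<in> \<Union>(quad ` chords)"
    then obtain a where a: "a \<in> chords" "x \<in> quad a" by blast
    obtain T F where "ed T 3 = a" "quad_data (quad a) T F" "quad a \<subseteq> ?X" using a(1) by (rule quad_exists)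
    then show "x \<in> ?X" using a(2) by blast
  next
    fix x assume x: "x \<in> ?X"
    then have x': "x \<in> S" "x \<notin> V" "x \<notin> \<Union>(E - chords)" unfolding quad_graph_union by auto
    show "x \<in> \<Union>(quad ` chords)"
    proof (cases "x \<in> \<Union>E")
      case True
      then obtain e where "e \<in> E" "x \<in> e" by blast
      then have "e \<in> chords" using x'(3) by blast
      then show ?thesis using \<open>x \<in> e\<close> by (auto simp: quad_def)
    next
      case False
      then obtain T where T: "T \<in> TT" "x \<in> T" by (rule not_graph_in_tile[OF x'(1,2)])
      then have "x \<in> quad (ed T 3)" by (auto simp: quad_def)
      moreover have "ed T 3 \<in> chords" using ed_chord[OF T(1)] by simp
      ultimately show ?thesis by blast
    qed
  qed
  fix D assume "D \<in> quad ` chords"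
  then obtain a where a: "a \<in> chords" "D = quad a" by blast
  obtain T F where TF: "ed T 3 = a" "quad_data (quad a) T F" "quad a \<subseteq> ?X" using a(1) by (rule quad_exists)
  then have "polygon_map L quad_edges 4 F D" using a(2) by (simp add: quad_data_def quad_frame_def)
  then obtain g where hom: "homeomorphism (ball 0 1) D F g" unfolding polygon_map_def by blast
  have im: "F ` ball 0 1 = D" using hom by (rule homeomorphism_image1)
  have c: "continuous_on (ball 0 1) F" using hom by (rule homeomorphism_cont1)
  have i: "inj_on F (ball 0 1)" using homeomorphism_apply1[OF hom] by (rule inj_on_inverseI)
  have DX: "D \<subseteq> ?X" using TF(3) a(2) by simp
  have "openin (top_of_set S) (F ` ball 0 1)"
    by (rule surface_image_open[OF surf open_ball c i]) (use im DX in blast)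
  then have "openin (top_of_set S) D" unfolding im .
  then have "openin (top_of_set ?X) D" using DX by (rule openin_subset_trans) blast
  moreover have "connected D" unfolding im[symmetric] by (rule connected_continuous_image[OF c]) simp
  moreover have "D \<noteq> {}" using quad_nonempty a by simp
  ultimately show "connected D \<and> D \<noteq> {} \<and> openin (top_of_set ?X) D" by blast
next
  fix D D' x assume "D \<in> quad ` chords" "D' \<in> quad ` chords" "x \<in> D" "x \<in> D'"
  then show "D = D'" using quad_disjoint by blast
qed

lemma quad_inj: "a \<in> chords \<Longrightarrow> b \<in> chords \<Longrightarrow> quad a = quad b \<Longrightarrow> a = b"
  using quad_nonempty quad_disjoint by blast

lemma chord_at:
  assumes "u \<in> V - L"
  obtains T where "T \<in> TT" "cor T 3 = u \<or> cor T 4 = u"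
proof -
  have "(\<Sum>T\<in>TT. of_bool (cor T 3 = u) + of_bool (cor T 4 = u)) \<noteq> (0::nat)"
    using counts(2)[OF assms] by (simp add: base_count_def)
  then obtain T where "T \<in> TT" "of_bool (cor T 3 = u) + of_bool (cor T 4 = u) \<noteq> (0::nat)" by (meson sum.neutral)
  then show ?thesis using that[of T] by (cases "cor T 3 = u"; cases "cor T 4 = u") auto
qed

theorem labelling_subdivision:
  "quadrilateral_tiling S L quad_edges \<and> simple_pentagonal_subdivision S L quad_edges V E"
proof
  have ex: "\<exists>T F. quad_data D T F" if D: "D \<in> tiles S L quad_edges" for D
  proof -
    obtain a where a: "a \<in> chords" "D = quad a" using D unfolding quad_tiles by blast
    obtain T F where "ed T 3 = a" "quad_data (quad a) T F" "quad a \<subseteq> S - (L \<union> \<Union>quad_edges)" using a(1) by (rule quad_exists)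
    then show ?thesis using a(2) by blast
  qed
  have pm4: "\<exists>F. polygon_map L quad_edges 4 F D" if "D \<in> tiles S L quad_edges" for D
    using ex[OF that] unfolding quad_data_def quad_frame_def by blast
  show "quadrilateral_tiling S L quad_edges"
    unfolding polygonal_tiling_def tiling_def
  proof (intro conjI ballI)
    show "embedded_graph S L quad_edges" by (rule quad_graph)
    show "3 \<le> vertex_degree quad_edges v" if "v \<in> L" for v using quad_degree[OF that] deg_ge[of v] LV that by auto
    fix D assume D: "D \<in> tiles S L quad_edges"
    show "\<exists>F. polygon_map L quad_edges 4 F D" by (rule pm4[OF D])
    then show "\<exists>n\<ge>3. \<exists>F. polygon_map L quad_edges n F D" by (intro exI[of _ 4]) simp
  qed
  have "\<exists>\<tau> \<Phi>. \<forall>D\<in>tiles S L quad_edges. quad_data D (\<tau> D) (\<Phi> D)" using ex by metis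
  then obtain \<tau> \<Phi> where Q: "\<And>D. D \<in> tiles S L quad_edges \<Longrightarrow> quad_data D (\<tau> D) (\<Phi> D)" by blast
  let ?d = "kr 4 (1/2)"
  \<comment> \<open>By \<open>merged_V\<close> a merged edge contains a single vertex of the
    pentagonal tiling.\<close>
  define m where "m e = (THE u. u \<in> e \<inter> V)" for e
  have m: "m (merged u) = u" if "u \<in> V - L" for u
    unfolding m_def merged_V[OF that] by simp
  have Qd: "\<tau> D \<in> TT" "D = quad (ed (\<tau> D) 3)" "polygon_map L quad_edges 4 (\<Phi> D) D"
    "\<Phi> D ` side 4 0 = merged (cor (\<tau> D) 4)" "\<Phi> D ` side 4 2 = merged (cor (\<tau> D) 3)"
    "\<Phi> D ?d = cor (\<tau> D) 4" "\<Phi> D (- ?d) = cor (\<tau> D) 3"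
    "\<Phi> D ` linepath ?d (- ?d) ` {0<..<1} = ed (\<tau> D) 3" if "D \<in> tiles S L quad_edges" for D
    using Q[OF that] unfolding quad_data_def quad_frame_def by blast+
  have tl: "quad (ed T 3) \<in> tiles S L quad_edges" if "T \<in> TT" for T
    unfolding quad_tiles using ed_chord[OF that, of 3] by simp
  \<comment> \<open>\<open>\<tau>\<close> may pick either tile of the quadrilateral; the edge
    between them does not depend on the choice.\<close>
  have same: "ed (\<tau> D) 3 = a" if "D = quad a" "a \<in> chords" for D a
  proof -
    have D: "D \<in> tiles S L quad_edges" using that quad_tiles by simp
    then have "quad (ed (\<tau> D) 3) = quad a" using Qd(2) that(1) by metis
    moreover have "ed (\<tau> D) 3 \<in> chords" using ed_chord[OF Qd(1)[OF D], of 3] by simp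
    ultimately show ?thesis using quad_inj that(2) by blast
  qed
  have d0: "?d \<noteq> 0" using kr_norm[of 4 "1/2"] by (metis norm_zero zero_neq_one)
  have dneg: "- ?d = kr 4 (5/2)"
  proof -
    have "kr 4 (5/2) = ?d * kr 4 2" using kr_add[of 4 "1/2" 2] by simp
    also have "kr 4 2 = -1" unfolding kr_def kap_of_real by simp
    finally show ?thesis by simp
  qed
  have ends: "cor T 3 = u \<or> cor T 4 = u \<longleftrightarrow> u \<in> closure (ed T 3) - ed T 3" if "T \<in> TT" for T u
    using ed_ends[OF that, of 3] by (auto simp: eval_nat_numeral)
  show "simple_pentagonal_subdivision S L quad_edges V E"
    unfolding simple_pentagonal_subdivision_def
  proof (intro exI conjI)
    show "\<forall>e\<in>quad_edges. m e \<in> e"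
    proof
      fix e assume "e \<in> quad_edges"
      then obtain u where u: "u \<in> V - L" "e = merged u" unfolding quad_edges_def by blast
      then show "m e \<in> e" using m by (simp add: merged_def)
    qed
    \<comment> \<open>\<open>quad_frame\<close> places the arc on the same diameter in every model
      square, so \<open>k\<close> is constantly \<open>0\<close> and the arc is always the same
      segment.\<close>
    show "\<forall>D\<in>tiles S L quad_edges. polygon_map L quad_edges 4 (\<Phi> D) D \<and> (\<lambda>_. 0) D \<in> {0, 1} \<and>
        arc ((\<lambda>_. linepath ?d (- ?d)) D) \<and> (\<lambda>_. linepath ?d (- ?d)) D ` {0<..<1} \<subseteq> ball 0 1 \<and>
        pathstart ((\<lambda>_. linepath ?d (- ?d)) D) \<in> side 4 ((\<lambda>_. 0) D) \<and>
        \<Phi> D (pathstart ((\<lambda>_. linepath ?d (- ?d)) D)) = m (\<Phi> D ` side 4 ((\<lambda>_. 0) D)) \<and>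
        pathfinish ((\<lambda>_. linepath ?d (- ?d)) D) \<in> side 4 ((\<lambda>_. 0) D + 2) \<and>
        \<Phi> D (pathfinish ((\<lambda>_. linepath ?d (- ?d)) D)) = m (\<Phi> D ` side 4 ((\<lambda>_. 0) D + 2))"
      (is "\<forall>D\<in>_. ?P D")
    proof
      fix D assume D: "D \<in> tiles S L quad_edges"
      have "?d \<noteq> - ?d" using d0 by simp
      then have "arc (linepath ?d (- ?d))" by (rule arc_linepath)
      moreover have "linepath ?d (- ?d) ` {0<..<1} \<subseteq> ball 0 1"
      proof
        fix z assume "z \<in> linepath ?d (- ?d) ` {0<..<1}"
        then obtain t where t: "0 < t" "t < 1" "z = linepath ?d (- ?d) t" by auto
        have "z = of_real (1 - 2 * t) * ?d" unfolding t(3) by (simp add: linepath_def scaleR_conv_of_real algebra_simps)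
        then have "norm z = \<bar>1 - 2 * t\<bar>" by (simp only: norm_mult norm_of_real kr_norm mult_1_right)
        then show "z \<in> ball 0 1" using t by (simp add: abs_less_iff)
      qed
      moreover have "?d \<in> side 4 0" "- ?d \<in> side 4 2" unfolding dneg side_kr by auto
      moreover have "m (\<Phi> D ` side 4 0) = cor (\<tau> D) 4" "m (\<Phi> D ` side 4 2) = cor (\<tau> D) 3"
        unfolding Qd(4,5)[OF D] using m cor_U[OF Qd(1)[OF D]] by auto
      ultimately show "?P D"
        using Qd(3,6,7)[OF D] by (simp add: numeral_2_eq_2)
    qed
    show "\<forall>e\<in>quad_edges. card {(D, j). D \<in> tiles S L quad_edges \<and> j \<in> {(\<lambda>_. 0) D, (\<lambda>_. 0) D + 2} \<and> \<Phi> D ` side 4 j = e} = 1"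
    proof
      fix e assume "e \<in> quad_edges"
      then obtain u where u: "u \<in> V - L" "e = merged u" unfolding quad_edges_def by blast
      obtain T where T: "T \<in> TT" "cor T 3 = u \<or> cor T 4 = u" using u(1) by (rule chord_at)
      let ?a = "ed T 3" and ?D = "quad (ed T 3)"
      have a: "?a \<in> chords" "u \<in> closure ?a - ?a" using ed_chord[OF T(1), of 3] ends[OF T(1)] T(2) by auto
      have D: "?D \<in> tiles S L quad_edges" by (rule tl[OF T(1)])
      have t3: "ed (\<tau> ?D) 3 = ?a" by (rule same[OF refl a(1)])
      have tt: "cor (\<tau> ?D) 3 = u \<or> cor (\<tau> ?D) 4 = u" using ends[OF Qd(1)[OF D], of u] a(2) t3 by simp
      have n34: "cor (\<tau> ?D) 3 \<noteq> cor (\<tau> ?D) 4" using cor_neq[OF Qd(1)[OF D], of 3 4] by simp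
      \<comment> \<open>A single arc ends at \<open>u\<close>, but \<open>u\<close> may be either of
        its ends; accordingly side \<open>0\<close> or side \<open>2\<close> is the one over
        \<open>e\<close>.\<close>
      define j0 :: nat where "j0 = (if cor (\<tau> ?D) 4 = u then 0 else 2)"
      have key: "\<Phi> D' ` side 4 0 = e \<longleftrightarrow> cor (\<tau> D') 4 = u" "\<Phi> D' ` side 4 2 = e \<longleftrightarrow> cor (\<tau> D') 3 = u"
        if "D' \<in> tiles S L quad_edges" for D'
        unfolding Qd(4,5)[OF that] u(2) using merged_inj[OF _ u(1)] cor_U[OF Qd(1)[OF that]] by auto
      have uniq: "D' = ?D" if D': "D' \<in> tiles S L quad_edges" "cor (\<tau> D') 3 = u \<or> cor (\<tau> D') 4 = u" for D'
      proof -
        have "ed (\<tau> D') 3 \<in> chords" using ed_chord[OF Qd(1)[OF D'(1)], of 3] by simp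
        moreover have "u \<in> closure (ed (\<tau> D') 3) - ed (\<tau> D') 3" using ends[OF Qd(1)[OF D'(1)]] D'(2) by simp
        ultimately have "ed (\<tau> D') 3 = ?a" using chord_unique a u(1) by blast
        then show ?thesis using Qd(2)[OF D'(1)] by simp
      qed
      have "{(D, j). D \<in> tiles S L quad_edges \<and> j \<in> {0, 0 + 2} \<and> \<Phi> D ` side 4 j = e} = {(?D, j0)}"
      proof (intro equalityI subsetI)
        fix p assume p: "p \<in> {(D, j). D \<in> tiles S L quad_edges \<and> j \<in> {0, 0 + 2} \<and> \<Phi> D ` side 4 j = e}"
        obtain D' j where e: "p = (D', j)" by (metis surj_pair)
        have D': "D' \<in> tiles S L quad_edges" "j = 0 \<or> j = 2" "\<Phi> D' ` side 4 j = e" using p e by auto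
        then have c: "(j = 0 \<and> cor (\<tau> D') 4 = u) \<or> (j = 2 \<and> cor (\<tau> D') 3 = u)" using key[OF D'(1)] by auto
        then have "D' = ?D" using uniq[OF D'(1)] by blast
        then show "p \<in> {(?D, j0)}" using c n34 e by (auto simp: j0_def)
      next
        fix p assume "p \<in> {(?D, j0)}"
        then show "p \<in> {(D, j). D \<in> tiles S L quad_edges \<and> j \<in> {0, 0 + 2} \<and> \<Phi> D ` side 4 j = e}"
          using D key[OF D] tt by (auto simp: j0_def)
      qed
      then show "card {(D, j). D \<in> tiles S L quad_edges \<and> j \<in> {(\<lambda>_. 0) D, (\<lambda>_. 0) D + 2} \<and> \<Phi> D ` side 4 j = e} = 1"
        by simp
    qed
    have mE: "m ` quad_edges = V - L" unfolding quad_edges_def image_image using m by simp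
    show "V = L \<union> m ` quad_edges" unfolding mE using LV by blast
    have "(\<Union>e\<in>quad_edges. components (e - {m e})) = (\<Union>u\<in>V - L. half_at u)"
      unfolding quad_edges_def using m half_components by simp
    moreover have "(\<lambda>D. \<Phi> D ` (\<lambda>_. linepath ?d (- ?d)) D ` {0<..<1}) ` tiles S L quad_edges = chords"
    proof -
      have "(\<lambda>D. \<Phi> D ` (\<lambda>_. linepath ?d (- ?d)) D ` {0<..<1}) ` tiles S L quad_edges = (\<lambda>D. ed (\<tau> D) 3) ` tiles S L quad_edges"
        by (rule image_cong[OF refl]) (rule Qd(8))
      also have "\<dots> = (\<lambda>a. a) ` chords" unfolding quad_tiles image_image
        by (rule image_cong[OF refl]) (rule same[OF refl])
      finally show ?thesis by simp
    qed
    ultimately show "E = (\<Union>e\<in>quad_edges. components (e - {m e})) \<union> (\<lambda>D. \<Phi> D ` (\<lambda>_. linepath ?d (- ?d)) D ` {0<..<1}) ` tiles S L quad_edges"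
      using E_halves chords_E by auto
  qed
qed

end

theorem theorem3p1:
  fixes S :: "'a::t2_space set" and V :: "'a set" and E :: "'a set set"
  assumes "closed_surface S" and "orientable_surface S"
    and "pentagonal_tiling S V E"
  shows "(\<exists>VQ EQ. quadrilateral_tiling S VQ EQ \<and> simple_pentagonal_subdivision S VQ EQ V E) \<longleftrightarrow>
         (\<exists>L\<subseteq>V. (\<forall>v\<in>V - L. vertex_degree E v = 3) \<and> (\<forall>T\<in>tiles S V E. type_P1 L V E T))"
proof
  assume "\<exists>VQ EQ. quadrilateral_tiling S VQ EQ \<and> simple_pentagonal_subdivision S VQ EQ V E"
  then obtain VQ EQ where Q: "quadrilateral_tiling S VQ EQ" "simple_pentagonal_subdivision S VQ EQ V E"
    by (elim exE conjE)
  show "\<exists>L\<subseteq>V. (\<forall>v\<in>V - L. vertex_degree E v = 3) \<and> (\<forall>T\<in>tiles S V E. type_P1 L V E T)"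
    using subdivision_imp_labelling[OF assms Q] by (intro exI[of _ VQ])
next
  assume "\<exists>L\<subseteq>V. (\<forall>v\<in>V - L. vertex_degree E v = 3) \<and> (\<forall>T\<in>tiles S V E. type_P1 L V E T)"
  then obtain L where L: "L \<subseteq> V" "\<forall>v\<in>V - L. vertex_degree E v = 3" "\<forall>T\<in>tiles S V E. type_P1 L V E T"
    by (elim exE conjE)
  \<comment> \<open>All conditions are bundled so that one choice provides, for each tile, a map
    satisfying them simultaneously.\<close>
  define P where "P f T \<longleftrightarrow> polygon_map V E 5 f T \<and> inj_on f (sphere 0 1) \<and>
          f (corner 5 0) \<in> L \<and> f (corner 5 1) \<notin> L \<and> f (corner 5 2) \<in> L \<and>
          f (corner 5 3) \<notin> L \<and> f (corner 5 4) \<notin> L" for f T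
  have "\<forall>T\<in>tiles S V E. \<exists>f. P f T" using L(3) unfolding type_P1_def P_def .
  from bchoice[OF this] obtain f where "\<forall>T\<in>tiles S V E. P (f T) T" ..
  then have f: "polygon_map V E 5 (f T) T" "inj_on (f T) (sphere 0 1)"
    "f T (corner 5 0) \<in> L" "f T (corner 5 1) \<notin> L" "f T (corner 5 2) \<in> L"
    "f T (corner 5 3) \<notin> L" "f T (corner 5 4) \<notin> L" if "T \<in> tiles S V E" for T
    using that by (auto simp: P_def)
  have t: "embedded_graph S V E" "\<And>v. v \<in> V \<Longrightarrow> 3 \<le> vertex_degree E v"
    using assms(3) by (auto simp: polygonal_tiling_def tiling_def)
  interpret P: ptiling S V E 5 f
    by unfold_locales (rule assms(1) t(1) | (rule f, assumption) | simp)+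
  interpret labelled S V E f L
  proof unfold_locales
    show "L \<subseteq> V" by (rule L(1))
    show "vertex_degree E v = 3" if "v \<in> V - L" for v using L(2) that by blast
    show "3 \<le> vertex_degree E v" if "v \<in> V" for v using t(2) that .
  qed (unfold P.cor_def, (rule f, assumption)+)
  show "\<exists>VQ EQ. quadrilateral_tiling S VQ EQ \<and> simple_pentagonal_subdivision S VQ EQ V E"
    using labelling_subdivision by (intro exI)
qed

end
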